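(* Let $a_0>0$, $b_0\in\mathbb{R}$ be given constants and let $a(t), b(t)$ be a solution of the Toda lattice $$\dot a(n,t)=a(n,t)\big(b(n+1,t)-b(n,t)\big),\qquad \dot b(n,t)=2\big(a(n,t)^2-a(n-1,t)^2\big),\qquad n\in\mathbb{Z},$$ satisfying $$\sum_{n\in\mathbb{Z}}|n|\big(|a(n,t)-a_0|+|b(n,t)-b_0|\big)<\infty$$ for one (and hence for all) $t\in\mathbb{R}$. Suppose that for two different times $t_0<t_1$, some constant $\delta>0$ and some constant $C$, we have $$\sum_{n\geq M}\big(|a(n,t_j)-a_0|+|b(n,t_j)-b_0|\big)\leq C\frac{1}{M^{(1+\delta)2M}},\qquad M>0,\quad j\in\{0,1\}.$$ Then $$a(n,t)=a_0,\qquad b(n,t)=b_0,\qquad (n,t)\in\mathbb{Z}\times\mathbb{R}.$$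
   Context: The Toda lattice is written in Flaschka's variables. Here $a(t)=(a(n,t))_{n\in\mathbb{Z}}$ and $b(t)=(b(n,t))_{n\in\mathbb{Z}}$ are sequences depending on time $t\in\mathbb{R}$, and the dot denotes the derivative with respect to $t$. *)

theory Defs
  imports "HOL-Analysis.Analysis"
begin

text \<open>
  Solutions of the Toda lattice in Flaschka's variables. Positivity of a is part of Flaschka's
  change of variables, where a is half the exponential of half a difference of neighbouring
  displacements. At each time the sequences are required to lie in the phase space of bounded
  sequences; no uniformity in time is imposed. For equations understood only site by site,
  without this requirement, spatial decay at one time need not persist at other times.
\<close>

definition toda_solution :: "(int \<Rightarrow> real \<Rightarrow> real) \<Rightarrow> (int \<Rightarrow> real \<Rightarrow> real) \<Rightarrow> bool" where
  "toda_solution a b \<longleftrightarrow>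
     (\<forall>n t. a n t > 0) \<and>
     (\<forall>t. bounded (range (\<lambda>n. a n t)) \<and> bounded (range (\<lambda>n. b n t))) \<and>
     (\<forall>n t. (a n has_real_derivative a n t * (b (n + 1) t - b n t)) (at t)) \<and>
     (\<forall>n t. (b n has_real_derivative 2 * ((a n t)\<^sup>2 - (a (n - 1) t)\<^sup>2)) (at t))"

end

theory Submission
  imports Defs "HOL-Complex_Analysis.Complex_Analysis"
begin

text \<open>
  Normalise \<open>a0 = 1\<close>, \<open>b0 = 0\<close> and put \<open>c = a\<^sup>2\<close>, with spectral parameter \<open>z = w + 1/w\<close>. Decay faster than
  any exponential on the right makes the Jost solution \<open>w\<^sup>n F(n, w)\<close> entire in \<open>w\<close> up to the factor
  \<open>w\<^sup>n\<close>, at all times between \<open>t0\<close> and \<open>t1\<close>, and the decay assumed at these two times makes it of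
  minimal exponential type there. For large \<open>w\<close> it is compared with the solution that decays to the
  left, which exists because the coefficients are bounded. Their Wronskian is multiplied by a factor
  of size \<open>exp (- 2 (t1 - t0) Re w)\<close> between the two times, and it has minimal type at both times, so
  it vanishes. Hence \<open>F\<close> is a product of functions that are analytic near \<open>w = \<infinity>\<close>, and it is constant
  by Liouville's theorem. This gives \<open>a = 1\<close>, \<open>b = 0\<close> far to the right, and the continued fraction of
  the left solution carries this over to all sites.

  The coefficients are only assumed to be bounded at each time. That they are bounded uniformly on
  compact time intervals follows from the isospectrality of the flow and a Baire category argument.
\<close>

subsection \<open>Gronwall estimates and the Lax equation\<close>

text \<open>The exponent \<open>2 * M\<close> fits the Jost function: in its recursion two powers of
  \<open>w\<close> cost one site, so the coefficient of \<open>w ^ j\<close> sees the tail from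
  about site \<open>j / 2\<close> on. The assumed tail there is \<open>j\<close> to the power
  \<open>- (1 + \<delta>) * j\<close>, up to a geometric factor. One power \<open>j\<close> to the
  \<open>- j\<close> yields \<open>1 / fact j\<close>; what is left because of
  \<open>\<delta>\<close> beats the geometric factor and every \<open>\<epsilon> ^ j\<close>, and
  this is minimal type. The quantitative decay is available at two times only. In between, Gronwall
  preserves each single exponential rate; that suffices for entire functions that can be
  differentiated in time term by term, and minimal type is used at the two end times alone. The
  contradiction is between minimal type and a factor of positive exponential type. No growth theorem
  for sectors is invoked: rotations by quarter turns average the half plane of decay over all
  directions.\<close>

lemma gronwall_family_forward:
  fixes y y' :: "'i \<Rightarrow> real \<Rightarrow> 'a::real_normed_vector"
  assumes der: "\<And>i t. t \<in> {s..e} \<Longrightarrow> (y i has_vector_derivative y' i t) (at t within {s..e})"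
    and bnd: "\<And>i t. t \<in> {s..e} \<Longrightarrow> norm (y i t) \<le> Y"
    and lip: "\<And>i t c. t \<in> {s..e} \<Longrightarrow> (\<And>j. norm (y j t) \<le> c) \<Longrightarrow> norm (y' i t) \<le> K * c"
    and K: "K > 0"
    and init: "\<And>i. norm (y i s) \<le> A"
    and t: "t \<in> {s..e}"
  shows "norm (y i t) \<le> 2 * A * exp (2 * K * (t - s))"
proof -
  have A0: "A \<ge> 0" using init[of i] norm_ge_zero order_trans by blast
  \<comment> \<open>Integrating \<open>K * Z * exp (2 * K * (x - s))\<close> gives half of
    \<open>Z * exp (2 * K * (r - s))\<close>; this weight thus turns the integral inequality into
    \<open>Z \<le> A + Z / 2\<close>. The bound \<open>Y\<close> makes the supremum finite, so that
    it can be solved for \<open>Z\<close>. The supremum runs over all indices because the members of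
    the family drive each other.\<close>
  define S where "S = {norm (y j r) * exp (- 2 * K * (r - s)) | j r. r \<in> {s..e}}"
  have Sle: "x \<le> Y" if "x \<in> S" for x
  proof -
    from that obtain j r where jr: "r \<in> {s..e}" and x: "x = norm (y j r) * exp (- 2 * K * (r - s))"
      unfolding S_def by blast
    have "exp (- 2 * K * (r - s)) \<le> 1" using jr K by (simp add: mult_nonneg_nonneg)
    then have "x \<le> norm (y j r) * 1" unfolding x by (intro mult_left_mono) auto
    then show ?thesis using bnd[OF jr, of j] by linarith
  qed
  then have bdd: "bdd_above S" by (auto simp: bdd_above_def)
  have ne: "S \<noteq> {}" using t unfolding S_def by blast
  define Z where "Z = Sup S"
  have yle: "norm (y j r) \<le> Z * exp (2 * K * (r - s))" if "r \<in> {s..e}" for j r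
  proof -
    have "norm (y j r) * exp (- 2 * K * (r - s)) \<le> Z"
      unfolding Z_def by (rule cSup_upper[OF _ bdd]) (use that S_def in blast)
    from mult_right_mono[OF this, of "exp (2 * K * (r - s))"] show ?thesis
      by (simp add: mult.assoc flip: exp_add)
  qed
  have "Z \<le> A + Z / 2"
    unfolding Z_def
  proof (rule cSup_least[OF ne])
    fix x assume "x \<in> S"
    then obtain j r where r: "r \<in> {s..e}" and x: "x = norm (y j r) * exp (- 2 * K * (r - s))"
      unfolding S_def by blast
    have "norm (y j r) - norm (y j s) \<le> norm (y j r - y j s)" by (rule norm_triangle_ineq2)
    also have "\<dots> \<le> Z / 2 * exp (2 * K * (r - s)) - Z / 2 * exp (2 * K * (s - s))"
    proof (cases "s = r")
      case False
      then have "s < r" using r by auto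
      then show ?thesis
      proof (rule differentiable_bound_general)
        have sub: "{s..r} \<subseteq> {s..e}" using r by auto
        show "continuous_on {s..r} (\<lambda>t. y j t)"
          using der has_vector_derivative_continuous continuous_on_subset[OF _ sub]
          by (metis (no_types, lifting) continuous_on_eq_continuous_within)
        show "continuous_on {s..r} (\<lambda>t. Z / 2 * exp (2 * K * (t - s)))"
          by (intro continuous_intros)
        fix x assume x: "s < x" "x < r"
        then have "at x within {s..e} = at x" using r by (intro at_within_interior) auto
        then show "(y j has_vector_derivative y' j x) (at x)"
          using der[of x j] x r by auto
        show "((\<lambda>t. Z / 2 * exp (2 * K * (t - s))) has_vector_derivative
                 K * (Z * exp (2 * K * (x - s)))) (at x)"
          unfolding has_real_derivative_iff_has_vector_derivative[symmetric]
          by (auto intro!: derivative_eq_intros)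
        show "norm (y' j x) \<le> K * (Z * exp (2 * K * (x - s)))"
          by (rule lip) (use x r yle in auto)
      qed
    qed auto
    finally have "norm (y j r) \<le> A + Z / 2 * exp (2 * K * (r - s)) - Z / 2"
      using init[of j] by simp
    moreover have "Z \<ge> 0"
      using yle[of s i] r order_trans[OF norm_ge_zero] by simp
    moreover have "exp (- 2 * K * (r - s)) \<le> 1" using r K by (simp add: mult_nonneg_nonneg)
    moreover have "A * exp (- 2 * K * (r - s)) \<le> A * 1"
      by (intro mult_left_mono A0) (use calculation in auto)
    ultimately have "x \<le> (A + Z / 2 * exp (2 * K * (r - s))) * exp (- 2 * K * (r - s))"
      unfolding x by (intro mult_right_mono) auto
    also have "\<dots> = A * exp (- 2 * K * (r - s)) + Z / 2"
      by (simp add: algebra_simps flip: exp_add)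
    also have "\<dots> \<le> A + Z / 2" using \<open>A * exp (- 2 * K * (r - s)) \<le> A * 1\<close> by simp
    finally show "x \<le> A + Sup S / 2" unfolding Z_def .
  qed
  then have "Z \<le> 2 * A" by simp
  then show ?thesis using yle[OF t, of i] by (meson exp_ge_zero mult_right_mono order_trans)
qed

text \<open>Estimates are needed in both time directions, for instance backwards from
  \<open>t1\<close> for the Wronskian. Times before \<open>s\<close> reduce to later ones by
  reflection.\<close>

lemma gronwall_family:
  fixes y y' :: "'i \<Rightarrow> real \<Rightarrow> 'a::real_normed_vector"
  assumes der: "\<And>i t. t \<in> {p..q} \<Longrightarrow> (y i has_vector_derivative y' i t) (at t within {p..q})"
    and bnd: "\<And>i t. t \<in> {p..q} \<Longrightarrow> norm (y i t) \<le> Y"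
    and lip: "\<And>i t c. t \<in> {p..q} \<Longrightarrow> (\<And>j. norm (y j t) \<le> c) \<Longrightarrow> norm (y' i t) \<le> K * c"
    and K: "K > 0"
    and init: "\<And>i. norm (y i s) \<le> A"
    and s: "s \<in> {p..q}" and t: "t \<in> {p..q}"
  shows "norm (y i t) \<le> 2 * A * exp (2 * K * \<bar>t - s\<bar>)"
proof (cases "s \<le> t")
  case True
  have sub: "{s..q} \<subseteq> {p..q}" using s by auto
  have "norm (y i t) \<le> 2 * A * exp (2 * K * (t - s))"
  proof (rule gronwall_family_forward[where e = q and y' = y' and Y = Y])
    fix i t assume "t \<in> {s..q}"
    then have "t \<in> {p..q}" using sub by auto
    then show "(y i has_vector_derivative y' i t) (at t within {s..q})"
      using has_vector_derivative_within_subset[OF der sub] by simp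
  qed (use bnd lip K init sub True t in auto)
  then show ?thesis using True by simp
next
  case False
  have t': "- t \<in> {- s..- p}" using False t by auto
  have sub: "uminus ` {- s..- p} \<subseteq> {p..q}" using s by auto
  have "norm (y i (- (- t))) \<le> 2 * A * exp (2 * K * (- t - - s))"
  proof (rule gronwall_family_forward[where e = "- p" and y = "\<lambda>i t. y i (- t)"
        and y' = "\<lambda>i t. - y' i (- t)" and Y = Y, OF _ _ _ K _ t'])
    fix i t assume t: "t \<in> {- s..- p}"
    then have "- t \<in> {p..q}" using sub by auto
    then have "(y i has_vector_derivative y' i (- t)) (at (- t) within uminus ` {- s..- p})"
      using has_vector_derivative_within_subset[OF der sub] by simp
    then show "((\<lambda>t. y i (- t)) has_vector_derivative - y' i (- t)) (at t within {- s..- p})"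
      using vector_diff_chain_within[of uminus "- 1" t "{- s..- p}" "y i" "y' i (- t)"]
      by (simp add: o_def has_vector_derivative_minus has_vector_derivative_id)
  next
    fix i t c assume t: "t \<in> {- s..- p}" and c: "\<And>j. norm (y j (- t)) \<le> c"
    show "norm (- y' i (- t)) \<le> K * c"
      using lip[OF _ c, of i] t sub by auto
  qed (use bnd init sub in auto)
  then show ?thesis using False by simp
qed

text \<open>The symmetry changes the sign of \<open>b\<close> but not of \<open>a\<close>. It turns
  upper bounds on \<open>b\<close> into lower bounds, and statements about later times into
  statements about earlier ones.\<close>

lemma toda_solution_reverse:
  "toda_solution a b \<Longrightarrow> toda_solution (\<lambda>n t. a n (- t)) (\<lambda>n t. - b n (- t))"
  unfolding toda_solution_def
proof (intro conjI allI; elim conjE)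
  fix n t
  assume d: "\<forall>n t. (a n has_real_derivative a n t * (b (n + 1) t - b n t)) (at t)"
     "\<forall>n t. (b n has_real_derivative 2 * ((a n t)\<^sup>2 - (a (n - 1) t)\<^sup>2)) (at t)"
  have m: "((\<lambda>t::real. - t) has_real_derivative - 1) (at t)"
    by (auto intro!: derivative_eq_intros)
  show "((\<lambda>t. a n (- t)) has_real_derivative a n (- t) * (- b (n + 1) (- t) - - b n (- t))) (at t)"
    using DERIV_chain2[OF d(1)[rule_format] m, of n] by (simp add: algebra_simps)
  show "((\<lambda>t. - b n (- t)) has_real_derivative 2 * ((a n (- t))\<^sup>2 - (a (n - 1) (- t))\<^sup>2)) (at t)"
    using DERIV_minus[OF DERIV_chain2[OF d(2)[rule_format] m, of n]] by (simp add: algebra_simps)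
qed (auto simp: bounded_iff)

text \<open>Both equations are homogeneous of degree two, which permits scaling with time, and
  \<open>b\<close> enters the right-hand sides only through differences, which permits the shift.
  The scaling normalises \<open>a0\<close>; the shift with \<open>r = 1\<close> makes the Jacobi
  matrix entrywise nonnegative.\<close>

lemma toda_solution_rescale:
  assumes "toda_solution a b" "r > 0"
  shows "toda_solution (\<lambda>n t. r * a n (r * t)) (\<lambda>n t. r * (b n (r * t) - \<beta>))"
proof -
  have d: "(a n has_real_derivative a n t * (b (n + 1) t - b n t)) (at t)"
     "(b n has_real_derivative 2 * ((a n t)\<^sup>2 - (a (n - 1) t)\<^sup>2)) (at t)" 
     and bd: "bounded (range (\<lambda>n. a n t))" "bounded (range (\<lambda>n. b n t))"
     and pos: "a n t > 0" for n t
    using assms(1) by (auto simp: toda_solution_def)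
  show ?thesis
    unfolding toda_solution_def
  proof (intro conjI allI)
    fix n t
    show "r * a n (r * t) > 0" using pos assms(2) by simp
    show "bounded (range (\<lambda>n. r * a n (r * t)))"
      using bounded_scaleR_comp[OF bd(1), of r] by simp
    obtain D where D: "\<And>n. \<bar>b n (r * t)\<bar> \<le> D" using bd(2)[of "r * t"] by (auto simp: bounded_iff)
    have "\<bar>r * (b n (r * t) - \<beta>)\<bar> \<le> r * (D + \<bar>\<beta>\<bar>)" for n
      using D[of n] assms(2) by (auto simp: abs_mult intro!: mult_left_mono)
    then show "bounded (range (\<lambda>n. r * (b n (r * t) - \<beta>)))"
      by (auto simp: bounded_iff)
    have m: "((\<lambda>t. r * t) has_real_derivative r) (at t)"
      by (auto intro!: derivative_eq_intros)
    show "((\<lambda>t. r * a n (r * t)) has_real_derivative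
        r * a n (r * t) * (r * (b (n + 1) (r * t) - \<beta>) - r * (b n (r * t) - \<beta>))) (at t)"
      using DERIV_cmult[OF DERIV_chain2[OF d(1) m], of r n] by (simp add: algebra_simps)
    show "((\<lambda>t. r * (b n (r * t) - \<beta>)) has_real_derivative
        2 * ((r * a n (r * t))\<^sup>2 - (r * a (n - 1) (r * t))\<^sup>2)) (at t)"
      using DERIV_cmult[OF DERIV_diff[OF DERIV_chain2[OF d(2) m] DERIV_const], of r n \<beta>]
      by (simp add: algebra_simps power2_eq_square)
  qed
qed

section \<open>Powers of the Jacobi matrix and their Lax equation\<close>

primrec jacobi_power :: "(int \<Rightarrow> real \<Rightarrow> real) \<Rightarrow> (int \<Rightarrow> real \<Rightarrow> real) \<Rightarrow> nat \<Rightarrow> int \<Rightarrow> int \<Rightarrow> real \<Rightarrow> real"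
  where
  "jacobi_power a b 0 i j t = of_bool (i = j)"
| "jacobi_power a b (Suc m) i j t = a (i - 1) t * jacobi_power a b m (i - 1) j t
     + b i t * jacobi_power a b m i j t + a i t * jacobi_power a b m (i + 1) j t"

text \<open>The right-hand side is the commutator of the antisymmetric matrix with entries
  \<open>a i\<close> above and \<open>- a (i - 1)\<close> below the diagonal with the
  \<open>m\<close>-th power of the Jacobi matrix. It always has four terms with coefficients bounded
  by \<open>sup a\<close>, so its Lipschitz constant does not depend on \<open>m\<close>.\<close>

lemma jacobi_power_lax:
  assumes "toda_solution a b"
  shows "(jacobi_power a b m i j has_real_derivative
     a i t * jacobi_power a b m (i + 1) j t - a (i - 1) t * jacobi_power a b m (i - 1) j t
     - a (j - 1) t * jacobi_power a b m i (j - 1) t + a j t * jacobi_power a b m i (j + 1) t) (at t)"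
proof (induction m arbitrary: i)
  case 0
  have *: "jacobi_power a b 0 i j = (\<lambda>t. of_bool (i = j))" by (rule ext) simp
  have "a i t * jacobi_power a b 0 (i + 1) j t - a (i - 1) t * jacobi_power a b 0 (i - 1) j t
     - a (j - 1) t * jacobi_power a b 0 i (j - 1) t + a j t * jacobi_power a b 0 i (j + 1) t = 0"
    by (auto simp: of_bool_def)
  then show ?case unfolding * by simp
next
  case (Suc m)
  have d: "(a n has_real_derivative a n t * (b (n + 1) t - b n t)) (at t)"
     "(b n has_real_derivative 2 * ((a n t)\<^sup>2 - (a (n - 1) t)\<^sup>2)) (at t)" for n t
    using assms by (auto simp: toda_solution_def)
  have *: "jacobi_power a b (Suc m) i j = (\<lambda>t. a (i - 1) t * jacobi_power a b m (i - 1) j t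
     + b i t * jacobi_power a b m i j t + a i t * jacobi_power a b m (i + 1) j t)"
    by (rule ext) simp
  show ?case unfolding *
    apply (rule derivative_eq_intros d Suc.IH refl)+
    apply (simp add: algebra_simps power2_eq_square)
    done
qed

lemma power_dominated_imp_le:
  fixes x y C :: real
  assumes "\<And>m. x ^ m \<le> C * y ^ m" "y > 0"
  shows "x \<le> y"
proof (rule ccontr)
  assume "\<not> x \<le> y"
  then have "x / y > 1" using assms(2) by simp
  then obtain m where "C < (x / y) ^ m" using real_arch_pow by blast
  then show False using assms(1)[of m] assms(2) by (simp add: power_divide field_simps)
qed

subsection \<open>Boundedness on compact time intervals\<close>

lemma jacobi_power_nonneg:
  assumes "\<And>n. a n t \<ge> 0" "\<And>n. b n t \<ge> 0"
  shows "jacobi_power a b m i j t \<ge> 0"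
  using assms by (induction m arbitrary: i) auto

lemma jacobi_power_le:
  assumes "\<And>n. \<bar>a n t\<bar> \<le> A" "\<And>n. \<bar>b n t\<bar> \<le> B"
  shows "\<bar>jacobi_power a b m i j t\<bar> \<le> (2 * A + B) ^ m"
proof (induction m arbitrary: i)
  case (Suc m)
  have AB: "A \<ge> 0" "B \<ge> 0" using assms[of 0] by linarith+
  have "\<bar>jacobi_power a b (Suc m) i j t\<bar> \<le> \<bar>a (i - 1) t * jacobi_power a b m (i - 1) j t\<bar>
     + \<bar>b i t * jacobi_power a b m i j t\<bar> + \<bar>a i t * jacobi_power a b m (i + 1) j t\<bar>"
    by simp
  also have "\<dots> \<le> A * (2 * A + B) ^ m + B * (2 * A + B) ^ m + A * (2 * A + B) ^ m"
    unfolding abs_mult by (intro add_mono mult_mono assms Suc AB) auto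
  finally show ?case by (simp add: algebra_simps)
qed auto

lemma jacobi_power_growth:
  assumes sol: "toda_solution a b"
    and bd: "\<And>n r. r \<in> {p..q} \<Longrightarrow> a n r \<le> B \<and> \<bar>b n r\<bar> \<le> B"
    and init: "\<And>m i j. \<bar>jacobi_power a b m i j s\<bar> \<le> D ^ m"
    and s: "s \<in> {p..q}" and t: "t \<in> {p..q}"
  shows "\<bar>jacobi_power a b m i j t\<bar> \<le> 2 * exp (8 * B * \<bar>t - s\<bar>) * D ^ m"
proof -
  have pos: "a n r > 0" for n r using sol by (simp add: toda_solution_def)
  have B: "B > 0" using bd[OF t, of 0] pos[of 0 t] by linarith
  define y where "y = (\<lambda>(i, j). jacobi_power a b m i j)"
  define y' where "y' = (\<lambda>(i, j) t. a i t * jacobi_power a b m (i + 1) j t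
     - a (i - 1) t * jacobi_power a b m (i - 1) j t
     - a (j - 1) t * jacobi_power a b m i (j - 1) t + a j t * jacobi_power a b m i (j + 1) t)"
  \<comment> \<open>The bound \<open>(2 * B + B) ^ m\<close> serves only as the a priori bound of
    Gronwall's lemma; the base \<open>D\<close> of the result comes from time
    \<open>s\<close>.\<close>
  have "norm (y (i, j) t) \<le> 2 * (D ^ m) * exp (2 * (4 * B) * \<bar>t - s\<bar>)"
  proof (rule gronwall_family[where y' = y' and Y = "(2 * B + B) ^ m"])
    fix ij :: "int \<times> int" and r assume r: "r \<in> {p..q}"
    obtain i j where ij: "ij = (i, j)" by (cases ij) auto
    show "(y ij has_vector_derivative y' ij r) (at r within {p..q})"
      unfolding ij y_def y'_def has_real_derivative_iff_has_vector_derivative[symmetric]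
      using has_field_derivative_at_within[OF jacobi_power_lax[OF sol]] by simp
    have "\<bar>a k r\<bar> \<le> B" "\<bar>b k r\<bar> \<le> B" for k using bd[OF r, of k] pos[of k r] by auto
    then show "norm (y ij r) \<le> (2 * B + B) ^ m"
      unfolding ij y_def real_norm_def prod.case by (rule jacobi_power_le)
    fix c assume c: "\<And>q. norm (y q r) \<le> c"
    have *: "\<bar>a k r * jacobi_power a b m i' j' r\<bar> \<le> B * c" for k i' j'
      unfolding abs_mult using bd[OF r, of k] pos[of k r] c[of "(i', j')"]
      by (intro mult_mono) (auto simp: y_def)
    show "norm (y' ij r) \<le> 4 * B * c"
      using *[of i "i + 1" j] *[of "i - 1" "i - 1" j] *[of "j - 1" i "j - 1"] *[of j i "j + 1"]
      unfolding ij y'_def by simp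
  qed (use B s t init in \<open>auto simp: y_def\<close>)
  then show ?thesis by (simp add: y_def mult_ac)
qed

text \<open>Gronwall's inequality loses a factor that depends on the size \<open>B\<close> of the solution in between.
  Applied to the \<open>m\<close>-th power of the Jacobi matrix it loses the same factor for all \<open>m\<close>, which therefore
  disappears on taking \<open>m\<close>-th roots. The diagonal is shifted by \<open>B\<close> to make all entries nonnegative, so
  that powers of entries bound entries of powers from below.\<close>
lemma toda_bound_diag:
  assumes sol: "toda_solution a b"
    and bd: "\<And>n r. r \<in> {p..q} \<Longrightarrow> a n r \<le> B \<and> \<bar>b n r\<bar> \<le> B"
    and init: "\<And>n. a n s \<le> N \<and> \<bar>b n s\<bar> \<le> N"
    and t: "t \<in> {p..q}"
    and s: "s \<in> {p..q}"
  shows "b n t \<le> 3 * N" and "(\<And>n. b n t \<ge> - 3 * N) \<Longrightarrow> a n t \<le> 6 * N"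
proof -
  have pos: "a n r > 0" for n r using sol by (simp add: toda_solution_def)
  have B: "B > 0" using bd[OF t, of 0] pos[of 0 t] by linarith
  have N: "N > 0" using init[of 0] pos[of 0 s] by linarith
  define d where "d = (\<lambda>n t. b n t + B)"
  have sol': "toda_solution a d"
    using toda_solution_rescale[OF sol, of 1 "- B"] by (simp add: d_def)
  let ?J = "jacobi_power a d"
  let ?G = "2 * exp (8 * (2 * B) * \<bar>t - s\<bar>)"
  have bd': "a n r \<le> 2 * B \<and> \<bar>d n r\<bar> \<le> 2 * B" if "r \<in> {p..q}" for n r
    using bd[OF that, of n] B by (auto simp: d_def)
  have ap: "\<bar>a k s\<bar> \<le> N" for k using init[of k] pos[of k s] by auto
  have dp: "\<bar>d k s\<bar> \<le> N + B" for k using init[of k] B unfolding d_def by linarith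
  \<comment> \<open>Row sum of the shifted matrix at time \<open>s\<close>: \<open>2 * N\<close>
    from the off-diagonal entries and \<open>N + B\<close> from the diagonal.\<close>
  have i3: "2 * N + (N + B) = 3 * N + B" by simp
  have up: "\<bar>?J m i j t\<bar> \<le> ?G * (3 * N + B) ^ m" for m i j
    using jacobi_power_le[of a s N d "N + B", OF ap dp] unfolding i3
    by (intro jacobi_power_growth[OF sol' bd' _ s t])
  have d0: "d n t \<ge> 0" for n using bd[OF t, of n] by (auto simp: d_def)
  have nn: "?J m i j t \<ge> 0" for m i j
    using pos[of _ t] d0 by (intro jacobi_power_nonneg) (auto simp: less_imp_le)
  have low: "d n t ^ m \<le> ?J m n n t" for m n
  proof (induction m)
    case (Suc m)
    have "d n t ^ Suc m \<le> d n t * ?J m n n t" using Suc d0 by (auto intro: mult_left_mono)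
    also have "\<dots> \<le> ?J (Suc m) n n t" using nn pos[of _ t] by (simp add: less_imp_le)
    finally show ?case .
  qed simp
  have "d n t \<le> 3 * N + B"
    by (rule power_dominated_imp_le[where C = ?G]) (use order_trans[OF low abs_le_D1[OF up]] N B in auto)
  then show "b n t \<le> 3 * N" by (simp add: d_def)
  assume lb: "\<And>n. b n t \<ge> - 3 * N"
  \<comment> \<open>The block at sites \<open>n\<close>, \<open>n + 1\<close> has diagonal at least
    \<open>B - 3 * N\<close> and off-diagonal entry \<open>a n t\<close>; applied to the vector
    \<open>(1, 1)\<close> it gives at least \<open>x\<close> times that vector. Powers of
    \<open>x\<close> are therefore below sums of two entries of the powers, and
    \<open>x \<le> 3 * N + B\<close> means \<open>a n t \<le> 6 * N\<close>. For negative
    \<open>x\<close> the claim is immediate.\<close>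
  define x where "x = B - 3 * N + a n t"
  show "a n t \<le> 6 * N"
  proof (cases "x \<ge> 0")
    case True
    have low: "x ^ m \<le> ?J m n n t + ?J m (n + 1) n t" for m
    proof (induction m)
      case (Suc m)
      have "x ^ Suc m \<le> x * (?J m n n t + ?J m (n + 1) n t)"
        using Suc True by (auto intro: mult_left_mono)
      also have "\<dots> = (B - 3 * N) * ?J m n n t + (B - 3 * N) * ?J m (n + 1) n t
          + a n t * ?J m n n t + a n t * ?J m (n + 1) n t"
        by (simp add: x_def algebra_simps)
      also have "\<dots> \<le> d n t * ?J m n n t + d (n + 1) t * ?J m (n + 1) n t
          + a n t * ?J m n n t + a n t * ?J m (n + 1) n t"
        by (intro add_mono mult_right_mono nn order_refl) (use lb[of n] lb[of "n + 1"] in \<open>auto simp: d_def\<close>)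
      also have "\<dots> \<le> ?J (Suc m) n n t + ?J (Suc m) (n + 1) n t"
        using nn pos[of _ t] by (simp add: less_imp_le)
      finally show ?case .
    qed simp
    have "x \<le> 3 * N + B"
    proof (rule power_dominated_imp_le[where C = "2 * ?G"])
      show "x ^ m \<le> 2 * ?G * (3 * N + B) ^ m" for m
        using low[of m] up[of m n n] up[of m "n + 1" n] by linarith
    qed (use N B in auto)
    then show ?thesis by (simp add: x_def)
  next
    case False
    then show ?thesis using N B by (simp add: x_def)
  qed
qed

definition toda_bounded :: "(int \<Rightarrow> real \<Rightarrow> real) \<Rightarrow> (int \<Rightarrow> real \<Rightarrow> real) \<Rightarrow> real \<Rightarrow> real \<Rightarrow> bool" where
  "toda_bounded a b N t \<longleftrightarrow> (\<forall>n. a n t \<le> N \<and> \<bar>b n t\<bar> \<le> N)"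

lemma toda_bounded_mono: "toda_bounded a b N t \<Longrightarrow> N \<le> N' \<Longrightarrow> toda_bounded a b N' t"
  unfolding toda_bounded_def by (meson order_trans)

lemma toda_bounded_reverse:
  "toda_bounded (\<lambda>n t. a n (- t)) (\<lambda>n t. - b n (- t)) N t \<longleftrightarrow> toda_bounded a b N (- t)"
  by (simp add: toda_bounded_def)

text \<open>The constant does not depend on \<open>B\<close>; this is what the category argument needs.\<close>
lemma toda_bounded_propagates:
  assumes sol: "toda_solution a b"
    and bd: "\<And>r. r \<in> {p..q} \<Longrightarrow> toda_bounded a b B r"
    and init: "toda_bounded a b N s" and s: "s \<in> {p..q}" and t: "t \<in> {p..q}"
  shows "toda_bounded a b (6 * N) t"
proof -
  have ub: "b n t \<le> 3 * N" for n
    by (rule toda_bound_diag(1)[OF sol _ _ t s]) (use bd init in \<open>auto simp: toda_bounded_def\<close>)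
  \<comment> \<open>The lower bound on \<open>b\<close> is the upper bound for the time-reversed
    solution.\<close>
  have "- b n (- (- t)) \<le> 3 * N" for n
    by (rule toda_bound_diag(1)[OF toda_solution_reverse[OF sol], of "- q" "- p" B "- s" N "- t"])
      (use bd init s t in \<open>auto simp: toda_bounded_def\<close>)
  then have lb: "b n t \<ge> - 3 * N" for n by (smt (verit) minus_minus)
  have "a n t \<le> 6 * N" for n
    by (rule toda_bound_diag(2)[OF sol _ _ t s lb]) (use bd init in \<open>auto simp: toda_bounded_def\<close>)
  moreover have "N \<ge> 0" using ub[of 0] lb[of 0] by linarith
  then have "\<bar>b n t\<bar> \<le> 6 * N" for n using ub[of n] lb[of n] by linarith
  ultimately show ?thesis by (simp add: toda_bounded_def)
qed

lemma toda_bounded_ex: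
  assumes "toda_solution a b"
  obtains N where "N > 0" "toda_bounded a b N t"
proof -
  have "bounded (range (\<lambda>n. a n t))" "bounded (range (\<lambda>n. b n t))"
    using assms by (auto simp: toda_solution_def)
  then obtain A B where "\<And>n. \<bar>a n t\<bar> \<le> A" "\<And>n. \<bar>b n t\<bar> \<le> B"
    by (auto simp: bounded_iff)
  then have "toda_bounded a b (max 1 (max A B)) t"
    unfolding toda_bounded_def by (meson abs_le_D1 max.coboundedI1 max.coboundedI2)
  then show ?thesis by (rule that[rotated]) simp
qed

lemma closed_toda_bounded:
  assumes sol: "toda_solution a b"
  shows "closed {t. toda_bounded a b N t}"
proof -
  have "isCont (a n) t" "isCont (b n) t" for n t
    using sol unfolding toda_solution_def by (blast intro: DERIV_isCont)+
  then have c: "continuous_on UNIV (a n)" "continuous_on UNIV (b n)" for n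
    by (auto simp: continuous_at_imp_continuous_on)
  have "{t. toda_bounded a b N t} = (\<Inter>n. {t. a n t \<le> N} \<inter> {t. \<bar>b n t\<bar> \<le> N})"
    by (auto simp: toda_bounded_def)
  also have "closed \<dots>"
    by (intro closed_INT closed_Int ballI closed_Collect_le continuous_intros c)
  finally show ?thesis .
qed

section \<open>Local boundedness by the Baire category theorem\<close>

definition toda_regular_at :: "(int \<Rightarrow> real \<Rightarrow> real) \<Rightarrow> (int \<Rightarrow> real \<Rightarrow> real) \<Rightarrow> real \<Rightarrow> bool" where
  "toda_regular_at a b t \<longleftrightarrow> (\<exists>d>0. \<exists>N. \<forall>r. \<bar>r - t\<bar> < d \<longrightarrow> toda_bounded a b N r)"

lemma toda_bounded_interval:
  assumes reg: "\<And>t. t \<in> {p..q} \<Longrightarrow> toda_regular_at a b t"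
  shows "\<exists>N. \<forall>t\<in>{p..q}. toda_bounded a b N t"
proof (cases "p \<le> q")
  case True
  then show ?thesis
  proof (induction rule: Bolzano)
    case (trans x y z)
    then obtain M N where "\<forall>t\<in>{x..y}. toda_bounded a b M t" "\<forall>t\<in>{y..z}. toda_bounded a b N t" by blast
    then have "\<forall>t\<in>{x..z}. toda_bounded a b (max M N) t"
      using toda_bounded_mono[of a b M _ "max M N"] toda_bounded_mono[of a b N _ "max M N"]
      by (auto simp: not_le) (meson atLeastAtMost_iff linear)
    then show ?case by blast
  next
    case (local x)
    then obtain d N where "d > 0" "\<forall>r. \<bar>r - x\<bar> < d \<longrightarrow> toda_bounded a b N r"
      using reg[of x] unfolding toda_regular_at_def by fastforce
    then show ?case by (intro exI[of _ d] conjI allI impI exI[of _ N]) (auto intro!: bexI)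
  qed
qed auto

lemma toda_bounded_gap:
  assumes sol: "toda_solution a b" and st: "s < t"
    and reg: "\<And>r. s < r \<Longrightarrow> r \<le> t \<Longrightarrow> toda_regular_at a b r"
    and init: "toda_bounded a b N s"
  shows "toda_bounded a b (6 * N) t"
proof -
  obtain M where M: "M > 0" "toda_bounded a b M t" using toda_bounded_ex[OF sol] .
  have "toda_bounded a b (6 * M) r" if r: "s < r" "r \<le> t" for r
  proof -
    obtain B where "\<forall>x\<in>{r..t}. toda_bounded a b B x"
      using toda_bounded_interval[of r t a b] reg r by auto
    then show ?thesis using toda_bounded_propagates[OF sol _ M(2), of r t B r] r by auto
  qed
  then have "toda_bounded a b (max N (6 * M)) r" if "r \<in> {s..t}" for r
  proof (cases "r = s")
    case True
    then show ?thesis using toda_bounded_mono[OF init] by simp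
  next
    case False
    then have "toda_bounded a b (6 * M) r" using \<open>\<And>r. s < r \<Longrightarrow> r \<le> t \<Longrightarrow> toda_bounded a b (6 * M) r\<close> that by simp
    then show ?thesis by (rule toda_bounded_mono) simp
  qed
  then show ?thesis using toda_bounded_propagates[OF sol _ init, of s t _ t] st by auto
qed

lemma toda_bounded_gap_left:
  assumes sol: "toda_solution a b" and st: "t < s"
    and reg: "\<And>r. t \<le> r \<Longrightarrow> r < s \<Longrightarrow> toda_regular_at a b r"
    and init: "toda_bounded a b N s"
  shows "toda_bounded a b (6 * N) t"
proof -
  have "toda_regular_at (\<lambda>n t. a n (- t)) (\<lambda>n t. - b n (- t)) r" if "- s < r" "r \<le> - t" for r
  proof -
    have "toda_regular_at a b (- r)" using reg[of "- r"] that by auto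
    then obtain d M where d: "d > 0" "\<And>x. \<bar>x - - r\<bar> < d \<Longrightarrow> toda_bounded a b M x"
      unfolding toda_regular_at_def by blast
    have "toda_bounded a b M (- x)" if "\<bar>x - r\<bar> < d" for x
      using d(2)[of "- x"] that by linarith
    with d(1) show ?thesis unfolding toda_regular_at_def toda_bounded_reverse[of a b] by blast
  qed
  from toda_bounded_gap[OF toda_solution_reverse[OF sol], of "- s" "- t", OF _ this]
  show ?thesis using st init unfolding toda_bounded_reverse[of a b] by simp
qed

text \<open>The closed sets \<open>C N\<close> cover all times. If the closed set \<open>F\<close>
  of irregular times were nonempty, Baire would give a point \<open>x\<close> of \<open>F\<close>
  near which \<open>F\<close> lies in a single \<open>C N\<close>. Regular times near
  \<open>x\<close> lie in gaps of \<open>F\<close> whose end towards \<open>x\<close> belongs to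
  \<open>C N\<close>, so the gap lemmas bound them by \<open>6 * N\<close>. Then \<open>x\<close>
  would be regular.\<close>

lemma toda_regular:
  assumes sol: "toda_solution a b"
  shows "toda_regular_at a b t"
proof (rule ccontr)
  assume "\<not> toda_regular_at a b t"
  define F where "F = {t. \<not> toda_regular_at a b t}"
  have op: "open (- F)"
    unfolding open_dist
  proof
    fix x assume "x \<in> - F"
    then obtain d N where d: "d > 0" "\<And>r. \<bar>r - x\<bar> < d \<Longrightarrow> toda_bounded a b N r"
      unfolding F_def toda_regular_at_def by auto
    show "\<exists>e>0. \<forall>y. dist y x < e \<longrightarrow> y \<in> - F"
    proof (intro exI conjI allI impI)
      fix y assume "dist y x < d / 2"
      then have "\<bar>r - y\<bar> < d / 2 \<Longrightarrow> toda_bounded a b N r" for r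
        using d(2)[of r] unfolding dist_real_def by linarith
      moreover have "d / 2 > 0" using d(1) by simp
      ultimately show "y \<in> - F" unfolding F_def toda_regular_at_def by blast
    qed (use d in auto)
  qed
  then have clF: "closed F" by (simp add: closed_def)
  define C where "C = (\<lambda>N::nat. {t. toda_bounded a b (real N) t})"
  have "\<exists>N. \<not> F \<subseteq> closure (F - C N)"
  proof (rule ccontr)
    assume "\<nexists>N. \<not> F \<subseteq> closure (F - C N)"
    then have dense: "F \<subseteq> closure (F - C N)" for N by blast
    have "F \<subseteq> closure (\<Inter> (range (\<lambda>N. F - C N)))"
    proof (rule Baire[OF clF])
      fix T assume "T \<in> range (\<lambda>N. F - C N)"
      then obtain N where T: "T = F - C N" by blast
      have "open (- C N)" unfolding C_def using closed_toda_bounded[OF sol] by (simp add: open_Compl)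
      then have "openin (top_of_set F) (F \<inter> - C N)" by (rule openin_open_Int)
      then show "openin (top_of_set F) T \<and> F \<subseteq> closure T"
        using dense[of N] unfolding T by (simp add: Diff_eq)
    qed auto
    moreover have "\<Inter> (range (\<lambda>N. F - C N)) = {}"
    proof -
      have "\<exists>N. x \<in> C N" for x
      proof -
        obtain M where "M > 0" "toda_bounded a b M x" using toda_bounded_ex[OF sol] .
        then show ?thesis unfolding C_def using toda_bounded_mono real_nat_ceiling_ge by blast
      qed
      then show ?thesis by blast
    qed
    ultimately have "F = {}" by (metis closure_empty subset_empty)
    then show False using \<open>\<not> toda_regular_at a b t\<close> by (auto simp: F_def)
  qed
  then obtain N x where x: "x \<in> F" "x \<notin> closure (F - C N)" by blast
  then obtain e where e: "e > 0" "\<And>y. y \<in> F \<Longrightarrow> dist y x < e \<Longrightarrow> y \<in> C N"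
    unfolding closure_approachable by blast
  have "toda_bounded a b (6 * real N) y" if y: "\<bar>y - x\<bar> < e" for y
  proof (cases "y \<in> F")
    case True
    then have "toda_bounded a b (real N) y" using e(2)[of y] y by (auto simp: dist_real_def C_def)
    then show ?thesis by (rule toda_bounded_mono) simp
  next
    case False
    then have "y \<noteq> x" using x by auto
    then consider "x < y" | "y < x" by linarith
    then show ?thesis
    proof cases
      case 1
      \<comment> \<open>The last irregular time in \<open>{x..y}\<close>: it is within
        \<open>e\<close> of \<open>x\<close>, hence in \<open>C N\<close>, and the times after it up
        to \<open>y\<close> are regular.\<close>
      define s where "s = Sup (F \<inter> {x..y})"
      have cp: "compact (F \<inter> {x..y})" using clF by (simp add: closed_Int_compact)
      have ne: "F \<inter> {x..y} \<noteq> {}" using x 1 by auto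
      have bdd: "bdd_above (F \<inter> {x..y})" by (rule bdd_aboveI[of _ y]) auto
      have s: "s \<in> F \<inter> {x..y}"
        unfolding s_def using closed_contains_Sup[OF ne bdd] cp compact_imp_closed by blast
      have "r \<notin> F" if "s < r" "r \<le> y" for r
        using cSup_upper[OF _ bdd, of r] that s unfolding s_def[symmetric] by force
      then have reg: "\<And>r. s < r \<Longrightarrow> r \<le> y \<Longrightarrow> toda_regular_at a b r" by (auto simp: F_def)
      have "s \<noteq> y" using s False by auto
      then have "s < y" using s by auto
      moreover have "s \<in> C N" using e(2)[of s] s y by (auto simp: dist_real_def)
      ultimately show ?thesis using toda_bounded_gap[OF sol _ reg] by (auto simp: C_def)
    next
      case 2
      define s where "s = Inf (F \<inter> {y..x})"
      have cp: "compact (F \<inter> {y..x})" using clF by (simp add: closed_Int_compact)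
      have ne: "F \<inter> {y..x} \<noteq> {}" using x 2 by auto
      have bdd: "bdd_below (F \<inter> {y..x})" by (rule bdd_belowI[of _ y]) auto
      have s: "s \<in> F \<inter> {y..x}"
        unfolding s_def using closed_contains_Inf[OF ne bdd] cp compact_imp_closed by blast
      have "r \<notin> F" if "r < s" "y \<le> r" for r
        using cInf_lower[OF _ bdd, of r] that s unfolding s_def[symmetric] by force
      then have reg: "\<And>r. y \<le> r \<Longrightarrow> r < s \<Longrightarrow> toda_regular_at a b r" by (auto simp: F_def)
      have "s \<noteq> y" using s False by auto
      then have "y < s" using s by auto
      moreover have "s \<in> C N" using e(2)[of s] s y by (auto simp: dist_real_def)
      ultimately show ?thesis using toda_bounded_gap_left[OF sol _ reg] by (auto simp: C_def)
    qed
  qed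
  then have "toda_regular_at a b x" using e(1) unfolding toda_regular_at_def by blast
  then show False using x by (simp add: F_def)
qed

theorem toda_solution_bounded_on_interval:
  assumes "toda_solution a b"
  obtains N where "N > 0" "\<And>t n. t \<in> {p..q} \<Longrightarrow> a n t \<le> N \<and> \<bar>b n t\<bar> \<le> N"
proof -
  obtain N where N: "\<forall>t\<in>{p..q}. toda_bounded a b N t"
    using toda_bounded_interval toda_regular[OF assms] by blast
  show ?thesis
  proof (rule that[of "max 1 N"])
    show "a n t \<le> max 1 N \<and> \<bar>b n t\<bar> \<le> max 1 N" if "t \<in> {p..q}" for t n
      using N that toda_bounded_mono[of a b N t "max 1 N"] by (auto simp: toda_bounded_def)
  qed simp
qed

subsection \<open>The left Weyl ratio\<close>

lemma has_vector_derivative_uniform_limit: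
  fixes f :: "nat \<Rightarrow> real \<Rightarrow> 'a::banach"
  assumes S: "convex S"
    and der: "\<And>n x. x \<in> S \<Longrightarrow> (f n has_vector_derivative f' n x) (at x within S)"
    and le: "\<And>n x. x \<in> S \<Longrightarrow> norm (f' n x - g' x) \<le> e n"
    and e: "e \<longlonglongrightarrow> 0"
    and lim: "\<And>x. x \<in> S \<Longrightarrow> (\<lambda>n. f n x) \<longlonglongrightarrow> g x"
    and x: "x \<in> S"
  shows "(g has_vector_derivative g' x) (at x within S)"
proof -
  have "\<exists>G. \<forall>x\<in>S. (\<lambda>n. f n x) \<longlonglongrightarrow> G x \<and> (G has_derivative (\<lambda>h. h *\<^sub>R g' x)) (at x within S)"
  proof (rule has_derivative_sequence[where f' = "\<lambda>n x h. h *\<^sub>R f' n x" and l = "g x"])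
    show "convex S" "x \<in> S" "(\<lambda>n. f n x) \<longlonglongrightarrow> g x" using S x lim by auto
    show "(f n has_derivative (\<lambda>h. h *\<^sub>R f' n x)) (at x within S)" if "x \<in> S" for n x
      using der[OF that] by (simp add: has_vector_derivative_def)
    fix d :: real assume "d > 0"
    then have "\<forall>\<^sub>F n in sequentially. e n < d" by (rule order_tendstoD(2)[OF e])
    then show "\<forall>\<^sub>F n in sequentially. \<forall>x\<in>S. \<forall>h. norm (h *\<^sub>R f' n x - h *\<^sub>R g' x) \<le> d * norm h"
    proof eventually_elim
      case (elim n)
      have "norm (h *\<^sub>R f' n x - h *\<^sub>R g' x) \<le> d * norm h" if "x \<in> S" for x h
      proof -
        have "norm (h *\<^sub>R f' n x - h *\<^sub>R g' x) = \<bar>h\<bar> * norm (f' n x - g' x)"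
          by (simp flip: scaleR_diff_right)
        also have "\<dots> \<le> \<bar>h\<bar> * d" using le[OF that, of n] elim by (intro mult_left_mono) auto
        finally show ?thesis by (simp add: mult.commute)
      qed
      then show ?case by blast
    qed
  qed
  then obtain G where G: "\<And>x. x \<in> S \<Longrightarrow> (\<lambda>n. f n x) \<longlonglongrightarrow> G x"
    "\<And>x. x \<in> S \<Longrightarrow> (G has_derivative (\<lambda>h. h *\<^sub>R g' x)) (at x within S)" by blast
  have "G x = g x" if "x \<in> S" for x using LIMSEQ_unique[OF G(1)[OF that] lim[OF that]] .
  then show ?thesis unfolding has_vector_derivative_def
    using has_derivative_transform[OF x _ G(2)[OF x]] by metis
qed

lemma has_vector_derivative_suminf:
  fixes f :: "nat \<Rightarrow> real \<Rightarrow> 'a::banach"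
  assumes S: "convex S"
    and der: "\<And>n x. x \<in> S \<Longrightarrow> (f n has_vector_derivative f' n x) (at x within S)"
    and le: "\<And>n x. x \<in> S \<Longrightarrow> norm (f' n x) \<le> B n"
    and B: "summable B"
    and sm: "\<And>x. x \<in> S \<Longrightarrow> summable (\<lambda>n. f n x)"
    and x: "x \<in> S"
  shows "((\<lambda>x. \<Sum>n. f n x) has_vector_derivative (\<Sum>n. f' n x)) (at x within S)"
proof (rule has_vector_derivative_uniform_limit[OF S _ _ _ _ x])
  fix n x assume x: "x \<in> S"
  show "((\<lambda>x. \<Sum>i<n. f i x) has_vector_derivative (\<Sum>i<n. f' i x)) (at x within S)"
    by (intro has_vector_derivative_sum der x)
  have s': "summable (\<lambda>n. f' n x)" using le[OF x] by (intro summable_comparison_test'[OF B]) auto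
  have "norm ((\<Sum>i<n. f' i x) - (\<Sum>n. f' n x)) = norm (\<Sum>i. f' (i + n) x)"
    by (subst suminf_split_initial_segment[OF s', of n]) simp
  also have "\<dots> \<le> (\<Sum>i. B (i + n))"
    using B le[OF x] by (intro norm_suminf_le) (auto simp: summable_iff_shift)
  finally show "norm ((\<Sum>i<n. f' i x) - (\<Sum>n. f' n x)) \<le> (\<Sum>i. B (i + n))" .
next
  show "(\<lambda>n. \<Sum>i. B (i + n)) \<longlonglongrightarrow> 0"
    by (rule suminf_exist_split2[OF B])
  show "(\<lambda>n. \<Sum>i<n. f i x) \<longlonglongrightarrow> (\<Sum>n. f n x)" if "x \<in> S" for x
    using sm[OF that] by (simp add: summable_LIMSEQ)
qed

text \<open>Here \<open>c\<close> stands for the square of \<open>a\<close>, the only way in which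
  \<open>a\<close> enters the continued fraction and the normalised Jost function. Derivatives are
  taken within the strip, so they are one-sided at its ends.\<close>

locale toda_strip =
  fixes c b :: "int \<Rightarrow> real \<Rightarrow> real" and t0 t1 N :: real
  assumes t01: "t0 < t1" and N1: "N \<ge> 1"
    and c_deriv: "\<And>n t. t \<in> {t0..t1} \<Longrightarrow>
      (c n has_real_derivative 2 * c n t * (b (n + 1) t - b n t)) (at t within {t0..t1})"
    and b_deriv: "\<And>n t. t \<in> {t0..t1} \<Longrightarrow>
      (b n has_real_derivative 2 * (c n t - c (n - 1) t)) (at t within {t0..t1})"
    and c_le: "\<And>n t. t \<in> {t0..t1} \<Longrightarrow> \<bar>c n t\<bar> \<le> N"
    and b_le: "\<And>n t. t \<in> {t0..t1} \<Longrightarrow> \<bar>b n t\<bar> \<le> N"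
begin

text \<open>If \<open>u\<close> solves \<open>a(n) u(n+1) + a(n-1) u(n-1) + b(n) u(n) = (k + 1/k) u(n)\<close>, then
  \<open>Q(n) = u(n) / (k a(n) u(n+1))\<close> satisfies the continued fraction recursion below; starting it with
  \<open>0\<close> at site \<open>n - j\<close> means imposing a Dirichlet condition there.\<close>
primrec ratio_approx :: "nat \<Rightarrow> int \<Rightarrow> real \<Rightarrow> complex \<Rightarrow> complex" where
  "ratio_approx 0 n t k = 0"
| "ratio_approx (Suc j) n t k =
     1 / (1 + k\<^sup>2 - of_real (b n t) * k - of_real (c (n - 1) t) * k\<^sup>2 * ratio_approx j (n - 1) t k)"

text \<open>The radius makes both \<open>norm k\<close> and \<open>N * norm k\<close> at most
  \<open>1 / 8\<close>. Denominators of the continued fraction then stay above \<open>1 / 2\<close>,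
  its values stay below \<open>2\<close>, and each step contracts.\<close>

abbreviation radius :: real where "radius \<equiv> 1 / (8 * N)"

context
  fixes k :: complex assumes k: "norm k \<le> radius"
begin

lemma k_small: "norm k \<le> 1 / 8" "N * norm k \<le> 1 / 8"
proof -
  show "N * norm k \<le> 1 / 8" using k N1 by (simp add: field_simps)
  moreover have "1 * norm k \<le> N * norm k" using N1 by (intro mult_right_mono) auto
  ultimately show "norm k \<le> 1 / 8" by simp
qed

lemma ck_le: 
  assumes "t \<in> {t0..t1}"
  shows "norm (of_real (c n t) * k\<^sup>2) \<le> 1 / 64"
proof -
  have "norm (of_real (c n t) * k\<^sup>2) \<le> N * norm k * norm k"
    using c_le[OF assms, of n] by (simp add: norm_mult power2_eq_square mult_right_mono mult.assoc)
  also have "\<dots> \<le> 1 / 8 * (1 / 8)" using k_small N1 by (intro mult_mono) auto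
  finally show ?thesis by simp
qed

lemma kb_le:
  assumes t: "t \<in> {t0..t1}"
  shows "norm (k\<^sup>2 - of_real (b n t) * k) \<le> 1 / 4"
proof -
  have "norm (of_real (b n t) * k) \<le> N * norm k"
    using b_le[OF t, of n] by (simp add: norm_mult mult_right_mono)
  moreover have "norm (k\<^sup>2) \<le> 1 / 8 * (1 / 8)"
    unfolding power2_eq_square norm_mult using k_small by (intro mult_mono) auto
  ultimately show ?thesis
    using k_small norm_triangle_ineq4[of "k\<^sup>2" "of_real (b n t) * k"] by linarith
qed

lemma denominator_ge:
  assumes t: "t \<in> {t0..t1}" and y: "norm y \<le> 2"
  shows "norm (1 + k\<^sup>2 - of_real (b n t) * k - of_real (c m t) * k\<^sup>2 * y) \<ge> 1 / 2"
proof -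
  have "norm (of_real (c m t) * k\<^sup>2 * y) \<le> 1 / 64 * 2"
    using mult_mono[OF ck_le[OF t] y] by (simp add: norm_mult)
  moreover have "norm (1 + u - v) \<ge> 1 - norm u - norm v" for u v :: complex
    using norm_triangle_ineq4[of "1 + u" v] norm_triangle_ineq4[of "1 + u - v" "u - v"]
      norm_triangle_ineq4[of u v] by simp
  note this[of "k\<^sup>2 - of_real (b n t) * k" "of_real (c m t) * k\<^sup>2 * y"] kb_le[OF t, of n]
  ultimately show ?thesis by (simp add: add_diff_eq)
qed

lemma ratio_approx_le:
  assumes t: "t \<in> {t0..t1}"
  shows "norm (ratio_approx j n t k) \<le> 2"
proof (induction j arbitrary: n)
  case (Suc j)
  then show ?case
    using denominator_ge[OF t Suc, of n "n - 1" "n - 1"] by (simp add: norm_divide divide_simps)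
qed simp

lemma ratio_approx_Suc_mult:
  assumes t: "t \<in> {t0..t1}"
  shows "ratio_approx (Suc j) n t k * (1 + k\<^sup>2 - of_real (b n t) * k
     - of_real (c (n - 1) t) * k\<^sup>2 * ratio_approx j (n - 1) t k) = 1"
  using denominator_ge[OF t ratio_approx_le[OF t], of n "n - 1" j "n - 1"] by auto

text \<open>A difference of reciprocals is the product of the reciprocals with the difference of the
  denominators. Each level thus gains the factor
  \<open>norm (X * Y * c * k\<^sup>2) \<le> 4 / 64\<close>, and \<open>1 / 4\<close> is more than
  enough.\<close>

lemma ratio_approx_cauchy:
  assumes t: "t \<in> {t0..t1}"
  shows "norm (ratio_approx (m + j) n t k - ratio_approx j n t k) \<le> 2 * (1 / 4) ^ j"
proof (induction j arbitrary: n)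
  case 0
  then show ?case using ratio_approx_le[OF t] by simp
next
  case (Suc j)
  let ?X = "ratio_approx (Suc (m + j)) n t k" and ?Y = "ratio_approx (Suc j) n t k"
  let ?x = "ratio_approx (m + j) (n - 1) t k" and ?y = "ratio_approx j (n - 1) t k"
  let ?g = "of_real (c (n - 1) t) * k\<^sup>2" and ?d = "1 + k\<^sup>2 - of_real (b n t) * k"
  have e: "?X * (?d - ?g * ?x) = 1" "?Y * (?d - ?g * ?y) = 1"
    using ratio_approx_Suc_mult[OF t] by auto
  have "?X - ?Y = ?X * (?Y * (?d - ?g * ?y)) - ?Y * (?X * (?d - ?g * ?x))"
    unfolding e by simp
  also have "\<dots> = ?X * ?Y * (?g * (?x - ?y))" by (simp only: algebra_simps)
  finally have "norm (?X - ?Y) = norm ?X * norm ?Y * (norm ?g * norm (?x - ?y))"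
    by (simp only: norm_mult)
  also have "\<dots> \<le> 2 * 2 * (1 / 64 * (2 * (1 / 4) ^ j))"
    by (intro mult_mono ratio_approx_le t ck_le Suc) auto
  also have "\<dots> \<le> 2 * (1 / 4) ^ Suc j" by simp
  finally show ?case by simp
qed

end

definition ratio :: "int \<Rightarrow> real \<Rightarrow> complex \<Rightarrow> complex" where
  "ratio n t k = lim (\<lambda>j. ratio_approx j n t k)"

context
  fixes k :: complex assumes k: "norm k \<le> radius"
begin

lemma ratio_lim:
  assumes t: "t \<in> {t0..t1}"
  shows "(\<lambda>j. ratio_approx j n t k) \<longlonglongrightarrow> ratio n t k"
proof -
  have z: "(\<lambda>j. 2 * (1 / 4) ^ j :: real) \<longlonglongrightarrow> 0"
    by (intro tendsto_mult_right_zero LIMSEQ_power_zero) simp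
  have "Cauchy (\<lambda>j. ratio_approx j n t k)"
  proof (rule CauchyI')
    fix e :: real assume "e > 0"
    then obtain M where M: "2 * (1 / 4) ^ M < e"
      using order_tendstoD(2)[OF z] by (auto simp: eventually_sequentially)
    have "norm (ratio_approx m n t k - ratio_approx j n t k) < e" if "m \<ge> M" "j > m" for m j
    proof -
      have "norm (ratio_approx m n t k - ratio_approx j n t k) \<le> 2 * (1 / 4) ^ m"
        using ratio_approx_cauchy[OF k t, of "j - m" m n] that by (simp add: norm_minus_commute)
      also have "\<dots> \<le> 2 * (1 / 4) ^ M" using that by (simp add: power_decreasing)
      finally show ?thesis using M by simp
    qed
    then show "\<exists>M. \<forall>m\<ge>M. \<forall>j>m. dist (ratio_approx m n t k) (ratio_approx j n t k) < e"
      unfolding dist_norm by blast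
  qed
  then show ?thesis unfolding ratio_def by (simp add: Cauchy_convergent_iff convergent_LIMSEQ_iff)
qed

lemma ratio_approx_dist:
  assumes t: "t \<in> {t0..t1}"
  shows "norm (ratio_approx j n t k - ratio n t k) \<le> 2 * (1 / 4) ^ j"
proof (rule LIMSEQ_le_const2[where X = "\<lambda>m. norm (ratio_approx j n t k - ratio_approx (m + j) n t k)"])
  have "(\<lambda>m. ratio_approx (m + j) n t k) \<longlonglongrightarrow> ratio n t k"
    using ratio_lim[OF t] by (rule LIMSEQ_ignore_initial_segment)
  then show "(\<lambda>m. norm (ratio_approx j n t k - ratio_approx (m + j) n t k))
      \<longlonglongrightarrow> norm (ratio_approx j n t k - ratio n t k)"
    by (intro tendsto_intros)
  show "\<exists>M. \<forall>m\<ge>M. norm (ratio_approx j n t k - ratio_approx (m + j) n t k) \<le> 2 * (1 / 4) ^ j"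
    using ratio_approx_cauchy[OF k t] by (simp add: norm_minus_commute)
qed

lemma ratio_le:
  assumes t: "t \<in> {t0..t1}"
  shows "norm (ratio n t k) \<le> 2"
  using ratio_approx_dist[OF t, of 0] by simp

lemma ratio_rec:
  assumes t: "t \<in> {t0..t1}"
  shows "ratio n t k * (1 + k\<^sup>2 - of_real (b n t) * k - of_real (c (n - 1) t) * k\<^sup>2 * ratio (n - 1) t k) = 1"
proof (rule LIMSEQ_unique[rotated])
  show "(\<lambda>j. ratio_approx (Suc j) n t k * (1 + k\<^sup>2 - of_real (b n t) * k
     - of_real (c (n - 1) t) * k\<^sup>2 * ratio_approx j (n - 1) t k)) \<longlonglongrightarrow> 1"
    unfolding ratio_approx_Suc_mult[OF k t] by simp
  show "(\<lambda>j. ratio_approx (Suc j) n t k * (1 + k\<^sup>2 - of_real (b n t) * k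
     - of_real (c (n - 1) t) * k\<^sup>2 * ratio_approx j (n - 1) t k)) \<longlonglongrightarrow> 
     ratio n t k * (1 + k\<^sup>2 - of_real (b n t) * k - of_real (c (n - 1) t) * k\<^sup>2 * ratio (n - 1) t k)"
    by (intro tendsto_intros ratio_lim t LIMSEQ_Suc)
qed

text \<open>The truncations satisfy the Riccati equation up to an error that contracts along the recursion.\<close>
lemma ratio_approx_deriv:
  assumes k0: "k \<noteq> 0" and t: "t \<in> {t0..t1}"
  shows "\<exists>D. ((\<lambda>t. ratio_approx j n t k) has_vector_derivative D) (at t within {t0..t1}) \<and>
    norm (D - 2 / k * (1 - (1 + k\<^sup>2 - of_real (b n t) * k) * ratio_approx j n t k
       + of_real (c n t) * k\<^sup>2 * (ratio_approx j n t k)\<^sup>2)) \<le> 2 / norm k * (1 / 4) ^ j"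
proof (induction j arbitrary: n)
  case 0
  \<comment> \<open>The empty truncation has derivative \<open>0\<close>, while the Riccati
    right-hand side at \<open>0\<close> is \<open>2 / k\<close>; this fixes the constant
    \<open>2 / norm k\<close>.\<close>
  show ?case by (rule exI[of _ 0]) (simp add: norm_divide)
next
  case (Suc j)
  let ?m = "n - 1"
  let ?Y = "ratio_approx j ?m t k" and ?X = "ratio_approx (Suc j) n t k"
  let ?den = "\<lambda>t. 1 + k\<^sup>2 - of_real (b n t) * k - of_real (c ?m t) * k\<^sup>2 * ratio_approx j ?m t k"
  obtain D where D: "((\<lambda>t. ratio_approx j ?m t k) has_vector_derivative D) (at t within {t0..t1})"
    and Dle: "norm (D - 2 / k * (1 - (1 + k\<^sup>2 - of_real (b ?m t) * k) * ?Y
       + of_real (c ?m t) * k\<^sup>2 * ?Y\<^sup>2)) \<le> 2 / norm k * (1 / 4) ^ j"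
    using Suc[of ?m] by blast
  have X1: "?X * ?den t = 1" by (rule ratio_approx_Suc_mult[OF k t])
  then have den0: "?den t \<noteq> 0" by force
  have cd: "((\<lambda>t. complex_of_real (c ?m t)) has_vector_derivative
     of_real (2 * c ?m t * (b n t - b ?m t))) (at t within {t0..t1})"
    using has_vector_derivative_of_real[OF c_deriv[OF t, of ?m]] by simp
  have bd: "((\<lambda>t. complex_of_real (b n t)) has_vector_derivative
     of_real (2 * (c n t - c ?m t))) (at t within {t0..t1})"
    using has_vector_derivative_of_real[OF b_deriv[OF t, of n]] .
  define den' where "den' = - (of_real (2 * (c n t - c ?m t)) * k) -
     (of_real (c ?m t) * k\<^sup>2 * D + of_real (2 * c ?m t * (b n t - b ?m t)) * k\<^sup>2 * ?Y)"
  have dd: "(?den has_vector_derivative den') (at t within {t0..t1})"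
    unfolding den'_def
    by (rule derivative_eq_intros bd cd D refl | simp add: algebra_simps)+
  have Xd: "((\<lambda>t. ratio_approx (Suc j) n t k) has_vector_derivative - den' * ?X\<^sup>2) (at t within {t0..t1})"
  proof -
    have "(inverse has_field_derivative - (inverse (?den t))\<^sup>2) (at (?den t) within range ?den)"
      using DERIV_inverse[OF den0, of "range ?den"] by (simp add: numeral_2_eq_2)
    from field_vector_diff_chain_within[OF dd has_field_derivative_subset[OF this]]
    have "((\<lambda>t. inverse (?den t)) has_vector_derivative den' * - (inverse (?den t))\<^sup>2) (at t within {t0..t1})"
      by (auto simp: o_def)
    then show ?thesis by (simp add: inverse_eq_divide)
  qed
  let ?R = "\<lambda>n y. 2 / k * (1 - (1 + k\<^sup>2 - of_real (b n t) * k) * y + of_real (c n t) * k\<^sup>2 * y\<^sup>2)"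
  \<comment> \<open>The Riccati error at one level is exactly
    \<open>c * k\<^sup>2 * X\<^sup>2\<close> times the error of the shorter truncation one site to
    the left. The factor is at most \<open>4 / 64\<close>.\<close>
  have id: "- den' * X\<^sup>2 - ?R n X = of_real (c ?m t) * k\<^sup>2 * X\<^sup>2 * (D - ?R ?m Y)"
    if X: "X * (1 + k\<^sup>2 - of_real (b n t) * k - of_real (c ?m t) * k\<^sup>2 * Y) = 1" and Y: "Y = ?Y" for X Y
  proof -
    define h where "h = 1 / k"
    have hk: "h * k = 1" using k0 by (simp add: h_def)
    have "1 - (1 + k\<^sup>2 - of_real (b n t) * k) * X = - of_real (c ?m t) * k\<^sup>2 * X * Y"
      using X by (simp add: algebra_simps)
    also have "\<dots> = - of_real (c ?m t) * k\<^sup>2 * X * Y * (X * (1 + k\<^sup>2 - of_real (b n t) * k - of_real (c ?m t) * k\<^sup>2 * Y))"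
      unfolding X by simp
    finally have "h * (1 - (1 + k\<^sup>2 - of_real (b n t) * k) * X + of_real (c n t) * k\<^sup>2 * X\<^sup>2) =
       h * (- of_real (c ?m t) * k\<^sup>2 * X * Y * (X * (1 + k\<^sup>2 - of_real (b n t) * k - of_real (c ?m t) * k\<^sup>2 * Y)) + of_real (c n t) * k\<^sup>2 * X\<^sup>2)"
      by (simp only:)
    also have "\<dots> = (h * k) * (of_real (c n t) * k * X\<^sup>2 - of_real (c ?m t) * k * X\<^sup>2 * Y * (1 + k\<^sup>2 - of_real (b n t) * k - of_real (c ?m t) * k\<^sup>2 * Y))"
      by (simp only: power2_eq_square) (simp add: algebra_simps)
    finally have "h * (1 - (1 + k\<^sup>2 - of_real (b n t) * k) * X + of_real (c n t) * k\<^sup>2 * X\<^sup>2) =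
       of_real (c n t) * k * X\<^sup>2 - of_real (c ?m t) * k * X\<^sup>2 * Y * (1 + k\<^sup>2 - of_real (b n t) * k - of_real (c ?m t) * k\<^sup>2 * Y)"
      unfolding hk by simp
    note S = this
    have two: "2 / k * S = 2 * (h * S)" for S by (simp add: h_def)
    have L: "?R n X = 2 * (of_real (c n t) * k * X\<^sup>2 - of_real (c ?m t) * k * X\<^sup>2 * Y * (1 + k\<^sup>2 - of_real (b n t) * k - of_real (c ?m t) * k\<^sup>2 * Y))"
      unfolding two S ..
    have "k\<^sup>2 * ?R ?m Y = (h * k) * (2 * k * (1 - (1 + k\<^sup>2 - of_real (b ?m t) * k) * Y + of_real (c ?m t) * k\<^sup>2 * Y\<^sup>2))"
      using k0 by (simp add: h_def power2_eq_square)
    then have R: "k\<^sup>2 * ?R ?m Y = 2 * k * (1 - (1 + k\<^sup>2 - of_real (b ?m t) * k) * Y + of_real (c ?m t) * k\<^sup>2 * Y\<^sup>2)"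
      unfolding hk by simp
    have "of_real (c ?m t) * k\<^sup>2 * X\<^sup>2 * (D - ?R ?m Y) = of_real (c ?m t) * X\<^sup>2 * (k\<^sup>2 * D - k\<^sup>2 * ?R ?m Y)"
      by (simp add: right_diff_distrib mult_ac)
    then show ?thesis unfolding L unfolding R den'_def Y[symmetric]
      by (simp add: algebra_simps power2_eq_square)
  qed
  have "norm (- den' * ?X\<^sup>2 - ?R n ?X) \<le> (1 / 64) * 2\<^sup>2 * (2 / norm k * (1 / 4) ^ j)"
    unfolding id[OF X1 refl] norm_mult[of _ "D - _"] norm_mult[of "_ * k\<^sup>2"] norm_power[of ?X]
    by (intro mult_mono ck_le[OF k t] Dle power_mono ratio_approx_le[OF k t]) auto
  also have "\<dots> \<le> (1 / 4) * (2 / norm k * (1 / 4) ^ j)"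
    by (intro mult_right_mono) auto
  also have "\<dots> = 2 / norm k * (1 / 4) ^ Suc j" by simp
  finally show ?case using Xd by blast
qed

text \<open>The Riccati equation passes to the limit because both the error of the truncations and
  their distance from the limit are geometric in \<open>j\<close>, uniformly in time.\<close>

lemma ratio_deriv:
  assumes k0: "k \<noteq> 0" and t: "t \<in> {t0..t1}"
  shows "((\<lambda>t. ratio n t k) has_vector_derivative
    2 / k * (1 - (1 + k\<^sup>2 - of_real (b n t) * k) * ratio n t k
       + of_real (c n t) * k\<^sup>2 * (ratio n t k)\<^sup>2)) (at t within {t0..t1})"
proof -
  let ?R = "\<lambda>t y. 2 / k * (1 - (1 + k\<^sup>2 - of_real (b n t) * k) * y + of_real (c n t) * k\<^sup>2 * y\<^sup>2)"
  define P where "P = (\<lambda>j t D. ((\<lambda>t. ratio_approx j n t k) has_vector_derivative D) (at t within {t0..t1})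
    \<and> norm (D - ?R t (ratio_approx j n t k)) \<le> 2 / norm k * (1 / 4) ^ j)"
  define D where "D = (\<lambda>j t. SOME D. P j t D)"
  have PD: "P j t (D j t)" if "t \<in> {t0..t1}" for j t
    unfolding D_def by (rule someI_ex) (use ratio_approx_deriv[OF k0 that, of j n] in \<open>simp add: P_def\<close>)
  then have D: "\<And>j t. t \<in> {t0..t1} \<Longrightarrow> ((\<lambda>t. ratio_approx j n t k) has_vector_derivative D j t) (at t within {t0..t1})"
    "\<And>j t. t \<in> {t0..t1} \<Longrightarrow> norm (D j t - ?R t (ratio_approx j n t k)) \<le> 2 / norm k * (1 / 4) ^ j"
    unfolding P_def by blast+
  show ?thesis
  proof (rule has_vector_derivative_uniform_limit[OF _ D(1) _ _ ratio_lim t])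
    fix j t assume t: "t \<in> {t0..t1}"
    let ?x = "ratio_approx j n t k" and ?q = "ratio n t k"
    have 3: "norm (of_real (c n t) * k\<^sup>2 * (?x + ?q) - (1 + (k\<^sup>2 - of_real (b n t) * k))) \<le> 3"
    proof -
      have "norm (of_real (c n t) * k\<^sup>2 * (?x + ?q)) \<le> 1 / 64 * (2 + 2)"
        unfolding norm_mult[of "_ * k\<^sup>2"]
        by (intro mult_mono ck_le[OF k t] norm_triangle_le add_mono ratio_approx_le[OF k t] ratio_le[OF t]) auto
      moreover have "norm (1 + (k\<^sup>2 - of_real (b n t) * k)) \<le> 1 + 1 / 4"
        using kb_le[OF k t, of n] norm_triangle_ineq[of 1 "k\<^sup>2 - of_real (b n t) * k"] by simp
      ultimately show ?thesis
        by (rule order_trans[OF norm_triangle_ineq4 order_trans[OF add_mono]]) simp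
    qed
    have "?R t ?x - ?R t ?q = 2 / k * ((?x - ?q) * (of_real (c n t) * k\<^sup>2 * (?x + ?q) - (1 + (k\<^sup>2 - of_real (b n t) * k))))"
      by (simp add: algebra_simps power2_eq_square)
    then have "norm (?R t ?x - ?R t ?q) = 2 / norm k * (norm (?x - ?q) * norm (of_real (c n t) * k\<^sup>2 * (?x + ?q) - (1 + (k\<^sup>2 - of_real (b n t) * k))))"
      by (simp only: norm_mult norm_divide) simp
    also have "\<dots> \<le> 2 / norm k * ((2 * (1 / 4) ^ j) * 3)"
      by (intro mult_left_mono mult_mono ratio_approx_dist t 3) auto
    finally have "norm (?R t ?x - ?R t ?q) \<le> 2 / norm k * ((2 * (1 / 4) ^ j) * 3)" .
    then have "norm (D j t - ?R t ?q) \<le> 2 / norm k * (1 / 4) ^ j + 2 / norm k * ((2 * (1 / 4) ^ j) * 3)"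
      by (rule norm_diff_triangle_le[OF D(2)[OF t, of j]])
    \<comment> \<open>\<open>14\<close> consists of \<open>2\<close> for the approximate Riccati
      equation and \<open>12 = 2 * 2 * 3\<close> for replacing the truncation by its limit.\<close>
    then show "norm (D j t - ?R t ?q) \<le> 14 / norm k * (1 / 4) ^ j" by (simp add: algebra_simps)
  next
    show "(\<lambda>j. 14 / norm k * (1 / 4) ^ j) \<longlonglongrightarrow> 0"
      by (intro tendsto_mult_right_zero LIMSEQ_power_zero) simp
  qed auto
qed

end

lemma ratio_holomorphic:
  assumes t: "t \<in> {t0..t1}"
  shows "continuous_on (cball 0 radius) (ratio n t)" "(ratio n t) holomorphic_on ball 0 radius"
proof -
  have hol: "ratio_approx j n t holomorphic_on cball 0 radius" for j n
  proof (induction j arbitrary: n)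
    case 0
    have "ratio_approx 0 n t = (\<lambda>k. 0)" by (rule ext) simp
    then show ?case by simp
  next
    case (Suc j)
    have "ratio_approx (Suc j) n t = (\<lambda>k. 1 / (1 + k\<^sup>2 - of_real (b n t) * k - of_real (c (n - 1) t) * k\<^sup>2 * ratio_approx j (n - 1) t k))"
      by (rule ext) simp
    moreover have "1 + k\<^sup>2 - of_real (b n t) * k - of_real (c (n - 1) t) * k\<^sup>2 * ratio_approx j (n - 1) t k \<noteq> 0"
      if "k \<in> cball 0 radius" for k
      using ratio_approx_Suc_mult[of k t j n] t that by force
    ultimately show ?case
      using Suc by (auto intro!: holomorphic_intros)
  qed
  have ul: "uniform_limit (cball 0 radius) (\<lambda>j k. ratio_approx j n t k) (ratio n t) sequentially"
    unfolding uniform_limit_iff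
  proof (intro allI impI)
    fix e :: real assume "e > 0"
    have z: "(\<lambda>j. 2 * (1 / 4) ^ j :: real) \<longlonglongrightarrow> 0"
      by (intro tendsto_mult_right_zero LIMSEQ_power_zero) simp
    show "\<forall>\<^sub>F j in sequentially. \<forall>k\<in>cball 0 radius. dist (ratio_approx j n t k) (ratio n t k) < e"
      using order_tendstoD(2)[OF z \<open>e > 0\<close>]
    proof eventually_elim
      case (elim j)
      then show ?case using ratio_approx_dist[OF _ t, of _ j n] by (force simp: dist_norm)
    qed
  qed
  have ev: "\<forall>\<^sub>F j in sequentially. continuous_on (cball 0 radius) (ratio_approx j n t) \<and>
      ratio_approx j n t holomorphic_on ball 0 radius"
    using hol holomorphic_on_imp_continuous_on holomorphic_on_subset[OF hol ball_subset_cball]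
    by (intro always_eventually allI conjI) blast+
  show "continuous_on (cball 0 radius) (ratio n t)" "(ratio n t) holomorphic_on ball 0 radius"
    by (rule holomorphic_uniform_limit[OF ev ul]; simp)+
qed

lemma ratio_0:
  assumes t: "t \<in> {t0..t1}"
  shows "ratio n t 0 = 1"
  using ratio_rec[OF _ t, of 0 n] N1 by simp

end

subsection \<open>Jost solutions as entire functions\<close>

text \<open>With \<open>\<beta> = b\<close> and \<open>v = 1 - c\<close> on the right half line, \<open>jost_coeff (Suc j) n\<close> is the coefficient of
  \<open>w ^ j\<close> in the function \<open>F\<close> with \<open>F(n-1) = F(n) - b(n) w F(n) + w\<^sup>2 (F(n) - c(n) F(n+1))\<close> and \<open>F \<rightarrow> 1\<close>.
  The index is shifted so that index \<open>0\<close> stands for the vanishing coefficient of \<open>w ^ (-1)\<close>.\<close>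
fun jost_coeff :: "(nat \<Rightarrow> real) \<Rightarrow> (nat \<Rightarrow> real) \<Rightarrow> nat \<Rightarrow> nat \<Rightarrow> real" where
  "jost_coeff \<beta> v 0 n = 0"
| "jost_coeff \<beta> v (Suc 0) n = 1"
| "jost_coeff \<beta> v (Suc (Suc j)) n = (if j = 1 then 0 else jost_coeff \<beta> v j (Suc n)) +
     (\<Sum>i. v (Suc (n + i)) * jost_coeff \<beta> v j (Suc (Suc (n + i)))
         - \<beta> (Suc (n + i)) * jost_coeff \<beta> v (Suc j) (Suc (n + i)))"

lemmas jost_coeff_Suc_Suc = jost_coeff.simps(3)
declare jost_coeff_Suc_Suc [simp del]

text \<open>The majorant \<open>s\<close> is left open because it is instantiated twice: by a tail
  bound uniform in time, and by the explicit bound assumed at the two given times. The latter bounds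
  tails only from site \<open>1\<close> on, whence the restrictions to
  \<open>n \<ge> 1\<close>.\<close>

locale tail_bound =
  fixes \<beta> v s :: "nat \<Rightarrow> real" and \<sigma> :: real
  assumes sm: "summable (\<lambda>i. \<bar>\<beta> i\<bar> + \<bar>v i\<bar>)"
    and tail: "\<And>n. n \<ge> 1 \<Longrightarrow> (\<Sum>i. \<bar>\<beta> (n + i)\<bar> + \<bar>v (n + i)\<bar>) \<le> s n"
    and anti: "\<And>m n. 1 \<le> m \<Longrightarrow> m \<le> n \<Longrightarrow> s n \<le> s m"
    and s1: "s 1 \<le> \<sigma>"
begin

abbreviation "\<kappa> \<equiv> jost_coeff \<beta> v"

lemma sm_shift: "summable (\<lambda>i. \<bar>\<beta> (n + i)\<bar> + \<bar>v (n + i)\<bar>)"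
  using summable_ignore_initial_segment[OF sm, of n] by (simp add: add.commute)

lemma s_nonneg: "n \<ge> 1 \<Longrightarrow> s n \<ge> 0"
  by (rule order_trans[OF suminf_nonneg[OF sm_shift] tail]) auto

lemma sigma_nonneg: "\<sigma> \<ge> 0" using s_nonneg[of 1] s1 by simp

lemma s_le: "n \<ge> 1 \<Longrightarrow> s n \<le> \<sigma>" using anti[of 1 n] s1 by simp

lemma tail_sum:
  assumes "\<And>m. m \<ge> Suc n \<Longrightarrow> \<bar>p m\<bar> \<le> P" "\<And>m. m \<ge> Suc n \<Longrightarrow> \<bar>r m\<bar> \<le> P"
  shows "summable (\<lambda>i. v (Suc (n + i)) * p (Suc (n + i)) - \<beta> (Suc (n + i)) * r (Suc (n + i)))"
    and "\<bar>\<Sum>i. v (Suc (n + i)) * p (Suc (n + i)) - \<beta> (Suc (n + i)) * r (Suc (n + i))\<bar> \<le> P * s (Suc n)"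
proof -
  let ?e = "\<lambda>i. \<bar>\<beta> (Suc n + i)\<bar> + \<bar>v (Suc n + i)\<bar>"
  have P: "P \<ge> 0" using assms(1)[of "Suc n"] abs_ge_zero order_trans by blast
  have le: "norm (v (Suc (n + i)) * p (Suc (n + i)) - \<beta> (Suc (n + i)) * r (Suc (n + i))) \<le> P * ?e i" for i
  proof -
    have "\<bar>v (Suc (n + i)) * p (Suc (n + i))\<bar> \<le> \<bar>v (Suc (n + i))\<bar> * P"
      "\<bar>\<beta> (Suc (n + i)) * r (Suc (n + i))\<bar> \<le> \<bar>\<beta> (Suc (n + i))\<bar> * P"
      unfolding abs_mult by (intro mult_left_mono assms; simp)+
    then show ?thesis by (simp add: algebra_simps)
  qed
  have sP: "summable (\<lambda>i. P * ?e i)" by (intro summable_mult sm_shift)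
  show "summable (\<lambda>i. v (Suc (n + i)) * p (Suc (n + i)) - \<beta> (Suc (n + i)) * r (Suc (n + i)))"
    by (rule summable_comparison_test'[OF sP]) (use le in auto)
  have "norm (\<Sum>i. v (Suc (n + i)) * p (Suc (n + i)) - \<beta> (Suc (n + i)) * r (Suc (n + i))) \<le> (\<Sum>i. P * ?e i)"
    by (rule norm_suminf_le[OF le sP])
  also have "\<dots> = P * (\<Sum>i. ?e i)" by (rule suminf_mult[OF sm_shift])
  also have "\<dots> \<le> P * s (Suc n)" by (intro mult_left_mono tail P) simp
  finally show "\<bar>\<Sum>i. v (Suc (n + i)) * p (Suc (n + i)) - \<beta> (Suc (n + i)) * r (Suc (n + i))\<bar> \<le> P * s (Suc n)" by simp
qed

text \<open>The coefficient of \<open>w ^ j\<close> is controlled by the tail starting at \<open>n + \<lceil>j/2\<rceil>\<close>. A Gronwall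
  argument for fixed \<open>w\<close> would only bound \<open>F\<close> by an iterated exponential.\<close>
lemma jost_coeff_le: "\<bar>\<kappa> (Suc (Suc j)) n\<bar> \<le> (1 + \<sigma>) ^ Suc j * s (Suc n + j div 2)"
proof (induction j arbitrary: n rule: less_induct)
  case (less j)
  consider "j = 0" | "j = 1" | i where "j = Suc (Suc i)"
    by (metis One_nat_def not0_implies_Suc)
  then show ?case
  proof cases
    case 1
    have "\<bar>\<kappa> (Suc (Suc 0)) n\<bar> \<le> 1 * s (Suc n)"
      using tail_sum(2)[of n "\<lambda>m. \<kappa> 0 (Suc m)" 1 "\<lambda>m. \<kappa> (Suc 0) m"] by (simp add: jost_coeff_Suc_Suc)
    also have "\<dots> \<le> (1 + \<sigma>) * s (Suc n)"
      by (intro mult_right_mono s_nonneg) (use sigma_nonneg in auto)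
    finally show ?thesis using 1 by simp
  next
    case 2
    have 1: "\<bar>\<kappa> (Suc 1) m\<bar> \<le> (1 + \<sigma>)\<^sup>2" for m
    proof -
      have "\<bar>\<kappa> (Suc (Suc 0)) m\<bar> \<le> (1 + \<sigma>) * s (Suc m)" using less[of 0 m] 2 by simp
      also have "\<dots> \<le> (1 + \<sigma>) * (1 + \<sigma>)"
        using s_le[of "Suc m"] sigma_nonneg by (intro mult_left_mono) auto
      finally show ?thesis by (simp add: power2_eq_square)
    qed
    have "\<bar>\<kappa> 1 (Suc m)\<bar> \<le> (1 + \<sigma>)\<^sup>2" for m
      using sigma_nonneg by (simp add: one_le_power)
    from tail_sum(2)[of n "\<lambda>m. \<kappa> 1 (Suc m)" "(1 + \<sigma>)\<^sup>2" "\<lambda>m. \<kappa> (Suc 1) m", OF this 1]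
    show ?thesis using 2 by (simp add: power2_eq_square jost_coeff_Suc_Suc[of _ _ "Suc 0"])
  next
    case 3
    \<comment> \<open>On the right-hand side of the recursion the degree drops by one or two while
      the site moves right by at least one, so no tail index falls below
      \<open>Suc n + j div 2\<close>.\<close>
    let ?S = "s (Suc n + j div 2)"
    let ?P = "(1 + \<sigma>) ^ j * ?S"
    have S0: "?S \<ge> 0" by (rule s_nonneg) simp
    have a: "\<bar>\<kappa> j m\<bar> \<le> ?P" if "m \<ge> Suc n" for m
    proof -
      have "\<bar>\<kappa> j m\<bar> \<le> (1 + \<sigma>) ^ Suc i * s (Suc m + i div 2)" using less[of i m] 3 by simp
      also have "\<dots> \<le> (1 + \<sigma>) ^ j * ?S"
        using sigma_nonneg that 3 S0
        by (intro mult_mono anti power_increasing s_nonneg) auto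
      finally show ?thesis .
    qed
    have b: "\<bar>\<kappa> (Suc j) m\<bar> \<le> ?P" if "m \<ge> Suc n" for m
    proof -
      have "\<bar>\<kappa> (Suc j) m\<bar> \<le> (1 + \<sigma>) ^ Suc (Suc i) * s (Suc m + Suc i div 2)"
        using less[of "Suc i" m] 3 by simp
      also have "\<dots> \<le> (1 + \<sigma>) ^ j * ?S"
      proof -
        have "i div 2 \<le> Suc i div 2" by (simp add: div_le_mono)
        then show ?thesis using sigma_nonneg that 3 by (intro mult_mono anti s_nonneg) auto
      qed
      finally show ?thesis .
    qed
    have "\<bar>\<kappa> (Suc (Suc j)) n\<bar> \<le> \<bar>\<kappa> j (Suc n)\<bar> + ?P * s (Suc n)"
    proof -
      have "j \<noteq> 1" using 3 by simp
      moreover have "\<bar>\<Sum>i. v (Suc (n + i)) * \<kappa> j (Suc (Suc (n + i))) - \<beta> (Suc (n + i)) * \<kappa> (Suc j) (Suc (n + i))\<bar> \<le> ?P * s (Suc n)"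
        by (rule tail_sum(2)[of n "\<lambda>m. \<kappa> j (Suc m)" ?P "\<lambda>m. \<kappa> (Suc j) m"]) (use a b in auto)
      ultimately show ?thesis
        unfolding jost_coeff_Suc_Suc[of _ _ j] by (simp add: order_trans[OF abs_triangle_ineq])
    qed
    also have "\<dots> \<le> ?P + ?P * \<sigma>"
      using sigma_nonneg S0 by (intro add_mono a mult_left_mono s_le) auto
    finally show ?thesis by (simp add: algebra_simps)
  qed
qed

lemma jost_coeff_bounded: "\<bar>\<kappa> j n\<bar> \<le> (1 + \<sigma>) ^ j"
proof -
  consider "j = 0" | "j = 1" | i where "j = Suc (Suc i)"
    by (metis One_nat_def not0_implies_Suc)
  then show ?thesis
  proof cases
    case 3
    have "\<bar>\<kappa> j n\<bar> \<le> (1 + \<sigma>) ^ Suc i * (1 + \<sigma>)"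
      using jost_coeff_le[of i n] s_le[of "Suc n + i div 2"] sigma_nonneg 3
      by (intro order_trans[OF jost_coeff_le[of i n, folded 3]] mult_left_mono) auto
    then show ?thesis using 3 by (simp add: mult_ac)
  qed (use sigma_nonneg in auto)
qed

text \<open>Differences between neighbouring sites undo the summation. The exceptional case
  \<open>j = 1\<close> in the recursion comes from the telescoping sum of \<open>\<kappa> j\<close>:
  it ends at the limit of \<open>\<kappa> j\<close> far to the right, which is \<open>1\<close> for
  the constant coefficient and \<open>0\<close> for all others.\<close>

lemma jost_coeff_diff:
  "\<kappa> (Suc (Suc j)) n - \<kappa> (Suc (Suc j)) (Suc n) =
     \<kappa> j (Suc n) - (1 - v (Suc n)) * \<kappa> j (Suc (Suc n)) - \<beta> (Suc n) * \<kappa> (Suc j) (Suc n)"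
proof -
  let ?f = "\<lambda>i. v (Suc (n + i)) * \<kappa> j (Suc (Suc (n + i))) - \<beta> (Suc (n + i)) * \<kappa> (Suc j) (Suc (n + i))"
  have "summable ?f"
    using tail_sum(1)[of n "\<lambda>m. \<kappa> j (Suc m)" "(1 + \<sigma>) ^ Suc j" "\<lambda>m. \<kappa> (Suc j) m"]
    using jost_coeff_bounded order_trans[OF jost_coeff_bounded power_increasing[of j "Suc j" "1 + \<sigma>"]] sigma_nonneg
    by (metis (no_types, lifting) add_increasing2 le_add_same_cancel1 lessI less_imp_le zero_le_one)
  from suminf_split_head[OF this]
  have "(\<Sum>i. ?f i) = ?f 0 + (\<Sum>i. ?f (Suc i))" by simp
  then show ?thesis by (auto simp: jost_coeff_Suc_Suc[of _ _ j] algebra_simps)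
qed

text \<open>The square in \<open>R\<close> compensates for the tail index growing only with half the
  degree. The factor \<open>2\<close> leaves geometric decay in both degree and site, and the
  summand \<open>1\<close> keeps the base at least \<open>1\<close>, so that exponents may be
  enlarged.\<close>

lemma jost_coeff_geometric:
  assumes r: "r \<ge> 0" and R: "R = (2 * ((1 + \<sigma>) * r + 1))\<^sup>2"
    and fast: "\<And>n. n \<ge> 1 \<Longrightarrow> s n * R ^ n \<le> D"
  shows "\<bar>\<kappa> (Suc (Suc j)) n\<bar> * r ^ Suc j \<le> D * (1 / 2) ^ (Suc j + n)"
proof -
  define \<rho> where "\<rho> = (1 + \<sigma>) * r + 1"
  have \<rho>: "\<rho> \<ge> 1" "(1 + \<sigma>) * r \<le> \<rho>" using r sigma_nonneg by (auto simp: \<rho>_def)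
  let ?m = "Suc n + j div 2"
  have "(2 * \<rho>) ^ (Suc j + n) \<le> (2 * \<rho>) ^ (2 * ?m)"
    by (rule power_increasing) (use \<rho> in auto)
  also have "\<dots> = R ^ ?m" unfolding R \<rho>_def by (rule power_mult)
  finally have "s ?m * (2 * \<rho>) ^ (Suc j + n) \<le> s ?m * R ^ ?m"
    by (intro mult_left_mono s_nonneg) auto
  also have "\<dots> \<le> D" by (rule fast) simp
  finally have sD: "s ?m * (2 * \<rho>) ^ (Suc j + n) \<le> D" .
  have "\<bar>\<kappa> (Suc (Suc j)) n\<bar> * r ^ Suc j \<le> (1 + \<sigma>) ^ Suc j * s ?m * r ^ Suc j"
    by (intro mult_right_mono jost_coeff_le) (use r in auto)
  also have "\<dots> = s ?m * ((1 + \<sigma>) * r) ^ Suc j" by (simp only: power_mult_distrib mult_ac)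
  also have "\<dots> \<le> s ?m * \<rho> ^ (Suc j + n)"
  proof (intro mult_left_mono s_nonneg)
    have "((1 + \<sigma>) * r) ^ Suc j \<le> \<rho> ^ Suc j" using \<rho> r sigma_nonneg by (intro power_mono) auto
    also have "\<dots> \<le> \<rho> ^ (Suc j + n)" using \<rho> by (intro power_increasing) auto
    finally show "((1 + \<sigma>) * r) ^ Suc j \<le> \<rho> ^ (Suc j + n)" .
  qed simp
  also have "\<dots> = (s ?m * (2 * \<rho>) ^ (Suc j + n)) * (1 / 2) ^ (Suc j + n)"
    by (simp only: mult.assoc flip: power_mult_distrib) simp
  also have "\<dots> \<le> D * (1 / 2) ^ (Suc j + n)" by (intro mult_right_mono sD) auto
  finally show ?thesis .
qed

end

definition jost :: "(nat \<Rightarrow> real) \<Rightarrow> (nat \<Rightarrow> real) \<Rightarrow> nat \<Rightarrow> complex \<Rightarrow> complex" where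
  "jost \<beta> v n w = (\<Sum>j. of_real (jost_coeff \<beta> v (Suc j) n) * w ^ j)"

locale fast_tail_bound = tail_bound +
  assumes fast: "\<And>R. R \<ge> 1 \<Longrightarrow> \<exists>D. \<forall>n\<ge>1. s n * R ^ n \<le> D"
begin

lemma jost_coeff_geometric_ex:
  assumes "r \<ge> 0"
  obtains D where "\<And>j n. \<bar>\<kappa> (Suc (Suc j)) n\<bar> * r ^ Suc j \<le> D * (1 / 2) ^ (Suc j + n)"
proof -
  have "(2 * ((1 + \<sigma>) * r + 1))\<^sup>2 \<ge> 1"
    using assms sigma_nonneg by (intro one_le_power) (auto intro: add_nonneg_nonneg)
  from fast[OF this] jost_coeff_geometric[OF assms refl] show ?thesis using that by metis
qed

lemma jost_summable_norm: "summable (\<lambda>j. norm (of_real (\<kappa> (Suc j) n) * w ^ j :: complex))"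
proof -
  obtain D where D: "\<And>j n. \<bar>\<kappa> (Suc (Suc j)) n\<bar> * norm w ^ Suc j \<le> D * (1 / 2) ^ (Suc j + n)"
    using jost_coeff_geometric_ex[of "norm w"] by auto
  have "summable (\<lambda>j. norm (of_real (\<kappa> (Suc (Suc j)) n) * w ^ Suc j :: complex))"
  proof (rule summable_comparison_test')
    show "summable (\<lambda>j. D * (1 / 2) ^ (Suc j + n) :: real)"
      using summable_mult[of "\<lambda>j. (1 / 2 :: real) ^ j" "D * (1 / 2) ^ Suc n"]
      by (simp add: power_add mult_ac)
    show "norm (norm (of_real (\<kappa> (Suc (Suc j)) n) * w ^ Suc j :: complex)) \<le> D * (1 / 2) ^ (Suc j + n)" for j
      using D[of j n] by (simp add: norm_mult norm_power)
  qed
  then show ?thesis by (subst (asm) summable_Suc_iff)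
qed

lemma jost_summable: "summable (\<lambda>j. of_real (\<kappa> (Suc j) n) * w ^ j :: complex)"
  by (rule summable_norm_cancel[OF jost_summable_norm])

lemma jost_shift:
  "summable (\<lambda>j. of_real (\<kappa> j n) * w ^ j :: complex)"
  "(\<Sum>j. of_real (\<kappa> j n) * w ^ j) = w * jost \<beta> v n w"
proof -
  let ?k = "\<lambda>j n. complex_of_real (\<kappa> j n)"
  have s1: "(\<Sum>j. ?k (Suc j) n * w ^ Suc j) = w * jost \<beta> v n w" "summable (\<lambda>j. ?k (Suc j) n * w ^ Suc j)"
    using suminf_mult[OF jost_summable, of w n w] summable_mult[OF jost_summable, of w n w]
    by (simp_all add: jost_def mult_ac)
  then show sm: "summable (\<lambda>j. ?k j n * w ^ j)"
    using summable_Suc_iff[of "\<lambda>j. ?k j n * w ^ j"] by blast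
  show "(\<Sum>j. ?k j n * w ^ j) = w * jost \<beta> v n w"
    using suminf_split_head[OF sm] s1(1) by simp
qed

lemma jost_rec:
  "jost \<beta> v n w = (1 + w\<^sup>2 - of_real (\<beta> (Suc n)) * w) * jost \<beta> v (Suc n) w
     - of_real (1 - v (Suc n)) * w\<^sup>2 * jost \<beta> v (Suc (Suc n)) w"
proof -
  let ?k = "\<lambda>j n. complex_of_real (\<kappa> j n)"
  have sm: "summable (\<lambda>j. ?k (Suc j) m * w ^ j)" for m by (rule jost_summable)
  have s2: "summable (\<lambda>j. ?k j m * w ^ Suc j)" "(\<Sum>j. ?k j m * w ^ Suc j) = w\<^sup>2 * jost \<beta> v m w" for m
    using summable_mult[OF jost_shift(1), of w m w] suminf_mult[OF jost_shift(1), of w m w] jost_shift(2)[of m w]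
    by (simp_all add: mult_ac power2_eq_square)
  have s1: "(\<Sum>j. ?k (Suc j) m * w ^ Suc j) = w * jost \<beta> v m w" "summable (\<lambda>j. ?k (Suc j) m * w ^ Suc j)" for m
    using suminf_mult[OF sm, of w m] summable_mult[OF sm, of w m]
    by (simp_all add: jost_def mult_ac)
  have hd: "jost \<beta> v m w = 1 + (\<Sum>j. ?k (Suc (Suc j)) m * w ^ Suc j)"
    "summable (\<lambda>j. ?k (Suc (Suc j)) m * w ^ Suc j)" for m
    using suminf_split_head[OF sm[of m]] sm[of m] summable_Suc_iff[of "\<lambda>j. ?k (Suc j) m * w ^ j"]
    by (simp_all add: jost_def)
  have "jost \<beta> v n w - jost \<beta> v (Suc n) w = (\<Sum>j. ?k (Suc (Suc j)) n * w ^ Suc j - ?k (Suc (Suc j)) (Suc n) * w ^ Suc j)"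
    unfolding hd(1) suminf_diff[OF hd(2) hd(2), symmetric] by simp
  also have "\<dots> = (\<Sum>j. (?k j (Suc n) * w ^ Suc j - of_real (1 - v (Suc n)) * (?k j (Suc (Suc n)) * w ^ Suc j))
      - of_real (\<beta> (Suc n)) * (?k (Suc j) (Suc n) * w ^ Suc j))"
  proof (rule suminf_cong)
    fix j
    have "?k (Suc (Suc j)) n * w ^ Suc j - ?k (Suc (Suc j)) (Suc n) * w ^ Suc j =
       of_real (\<kappa> (Suc (Suc j)) n - \<kappa> (Suc (Suc j)) (Suc n)) * w ^ Suc j"
      by (simp only: of_real_diff left_diff_distrib)
    also have "\<dots> = (?k j (Suc n) * w ^ Suc j - of_real (1 - v (Suc n)) * (?k j (Suc (Suc n)) * w ^ Suc j))
      - of_real (\<beta> (Suc n)) * (?k (Suc j) (Suc n) * w ^ Suc j)"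
      unfolding jost_coeff_diff by (simp only: of_real_diff of_real_mult left_diff_distrib mult.assoc)
    finally show "?k (Suc (Suc j)) n * w ^ Suc j - ?k (Suc (Suc j)) (Suc n) * w ^ Suc j = \<dots>" .
  qed
  also have "\<dots> = (w\<^sup>2 * jost \<beta> v (Suc n) w - of_real (1 - v (Suc n)) * (w\<^sup>2 * jost \<beta> v (Suc (Suc n)) w))
      - of_real (\<beta> (Suc n)) * (w * jost \<beta> v (Suc n) w)"
    by (simp only: suminf_diff[symmetric] suminf_mult summable_diff summable_mult s1 s2)
  finally show ?thesis by (simp add: algebra_simps)
qed

lemma jost_holomorphic: "jost \<beta> v n holomorphic_on UNIV"
proof -
  have "(\<lambda>w. \<Sum>j. complex_of_real (\<kappa> (Suc j) n) * (w - 0) ^ j) holomorphic_on ball 0 r" for r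
  proof (rule power_series_holomorphic)
    fix w :: complex
    show "(\<lambda>j. complex_of_real (\<kappa> (Suc j) n) * (w - 0) ^ j) sums (\<Sum>j. complex_of_real (\<kappa> (Suc j) n) * (w - 0) ^ j)"
      using summable_sums[OF jost_summable[of n w]] by simp
  qed
  then have h: "jost \<beta> v n holomorphic_on ball 0 r" for r
    by (simp add: jost_def[abs_def])
  show ?thesis unfolding holomorphic_on_def
  proof
    fix w :: complex
    have "jost \<beta> v n field_differentiable at w"
      by (rule holomorphic_on_imp_differentiable_at[OF h[of "norm w + 1"]]) auto
    then show "jost \<beta> v n field_differentiable at w within UNIV" by simp
  qed
qed

lemma jost_0: "jost \<beta> v n 0 = 1"
  by (simp add: jost_def)

text \<open>The constant is the same for all \<open>w\<close> in the disc; the telescoped products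
  need this uniformity on a circle.\<close>

lemma jost_tendsto_1: "\<exists>D. \<forall>n w. norm w \<le> r \<longrightarrow> norm (jost \<beta> v n w - 1) \<le> D * (1 / 2) ^ n"
proof (cases "r \<ge> 0")
  case True
  obtain D where D: "\<And>j n. \<bar>\<kappa> (Suc (Suc j)) n\<bar> * r ^ Suc j \<le> D * (1 / 2) ^ (Suc j + n)"
    using jost_coeff_geometric_ex[OF True] by auto
  have "norm (jost \<beta> v n w - 1) \<le> D * (1 / 2) ^ n" if w: "norm w \<le> r" for n w
  proof -
    have "jost \<beta> v n w - 1 = (\<Sum>j. complex_of_real (\<kappa> (Suc (Suc j)) n) * w ^ Suc j)"
      using suminf_split_head[OF jost_summable[of n w]] by (simp add: jost_def)
    also have "norm \<dots> \<le> (\<Sum>j. D * (1 / 2) ^ n * (1 / 2) ^ Suc j)"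
    proof (rule norm_suminf_le)
      fix j
      have "norm (complex_of_real (\<kappa> (Suc (Suc j)) n) * w ^ Suc j) \<le> \<bar>\<kappa> (Suc (Suc j)) n\<bar> * r ^ Suc j"
        unfolding norm_mult norm_power using w by (intro mult_mono power_mono) auto
      then show "norm (complex_of_real (\<kappa> (Suc (Suc j)) n) * w ^ Suc j) \<le> D * (1 / 2) ^ n * (1 / 2) ^ Suc j"
        using D[of j n] by (simp add: power_add mult_ac)
    next
      show "summable (\<lambda>j. D * (1 / 2) ^ n * (1 / 2 :: real) ^ Suc j)"
        using summable_mult[OF sums_summable[OF power_half_series], of "D * (1 / 2) ^ n"] by simp
    qed
    also have "\<dots> = D * (1 / 2) ^ n"
      using suminf_mult[OF sums_summable[OF power_half_series], of "D * (1 / 2) ^ n"]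
        sums_unique[OF power_half_series] by simp
    finally show ?thesis .
  qed
  then show ?thesis by blast
next
  case False
  then show ?thesis using norm_ge_zero order_trans by blast
qed

end

subsection \<open>Time evolution of the Jost solution\<close>

context toda_strip
begin

text \<open>Gronwall with the weight \<open>R ^ n\<close>, capped at site \<open>n\<close> so that the weighted family is known to be
  bounded; the resulting estimate does not depend on the cap.\<close>
lemma decay_propagates:
  assumes R: "R \<ge> 1"
    and init: "\<And>n::nat. \<bar>b n t0\<bar> * R ^ n \<le> A \<and> \<bar>1 - c n t0\<bar> * R ^ n \<le> A"
  shows "\<exists>D. \<forall>t\<in>{t0..t1}. \<forall>n::nat. \<bar>b n t\<bar> * R ^ n \<le> D \<and> \<bar>1 - c n t\<bar> * R ^ n \<le> D"
proof -
  \<comment> \<open>Sites to the left of \<open>0\<close> carry weight \<open>1\<close>, and there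
    only the trivial bound \<open>N + 1\<close> is available.\<close>
  define A' where "A' = max A (N + 1)"
  define K where "K = 4 * N * R"
  have K: "K > 0" using N1 R by (simp add: K_def)
  have A': "A' \<ge> 0" using N1 by (simp add: A'_def)
  have main: "\<bar>b n t\<bar> * R ^ n \<le> 2 * A' * exp (2 * K * \<bar>t - t0\<bar>)"
    "\<bar>1 - c n t\<bar> * R ^ n \<le> 2 * A' * exp (2 * K * \<bar>t - t0\<bar>)" if t: "t \<in> {t0..t1}" for t and n :: nat
  proof -
    \<comment> \<open>\<open>nat m\<close> is \<open>0\<close> for negative \<open>m\<close>. The
      weight is constant on the left, increases by a factor \<open>R\<close> per site up to
      \<open>n\<close>, and is constant again; neighbouring weights thus differ by at most
      \<open>R\<close>, which is all the Lipschitz estimate needs.\<close>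
    define \<omega> where "\<omega> = (\<lambda>m::int. R ^ min (nat m) n)"
    have \<omega>0: "\<omega> m > 0" for m using R by (simp add: \<omega>_def)
    have \<omega>1: "\<omega> m \<le> \<omega> (m + 1)" for m unfolding \<omega>_def by (intro power_increasing R) auto
    have \<omega>2: "\<omega> m \<le> R * \<omega> (m - 1)" for m
    proof -
      have "\<omega> m \<le> R ^ Suc (min (nat (m - 1)) n)" unfolding \<omega>_def by (intro power_increasing R) auto
      then show ?thesis by (simp add: \<omega>_def)
    qed
    have \<omega>3: "\<omega> m \<le> R ^ n" for m unfolding \<omega>_def by (intro power_increasing R) auto
    define y where "y = (\<lambda>(u, m) t. \<omega> m * (if u then b m t else c m t - 1))"
    define y' where "y' = (\<lambda>(u, m) t. \<omega> m * (if u then 2 * (c m t - c (m - 1) t)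
       else 2 * c m t * (b (m + 1) t - b m t)))"
    have "norm (y i t) \<le> 2 * A' * exp (2 * K * \<bar>t - t0\<bar>)" for i
    proof (rule gronwall_family[where y' = y' and Y = "R ^ n * (N + 1)"])
      fix p :: "bool \<times> int" and r assume r: "r \<in> {t0..t1}"
      obtain u m where p: "p = (u, m)" by (cases p) auto
      show "(y p has_vector_derivative y' p r) (at r within {t0..t1})"
        unfolding p y_def y'_def has_real_derivative_iff_has_vector_derivative[symmetric]
        using DERIV_cmult[OF b_deriv[OF r, of m], of "\<omega> m"]
          DERIV_cmult[OF DERIV_diff[OF c_deriv[OF r, of m] DERIV_const], of "\<omega> m" 1]
        by simp
      have cb: "\<bar>if u then b m r else c m r - 1\<bar> \<le> N + 1" for u m
        using b_le[OF r, of m] c_le[OF r, of m] by (auto split: if_splits)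
      show "norm (y p r) \<le> R ^ n * (N + 1)"
        unfolding p y_def using \<omega>0[of m] cb[of u m] \<omega>3[of m] R by (auto simp: abs_mult intro!: mult_mono)
      fix C assume C: "\<And>j. norm (y j r) \<le> C"
      have C1: "\<omega> m * \<bar>b m r\<bar> \<le> C" "\<omega> m * \<bar>c m r - 1\<bar> \<le> C" for m
        using C[of "(True, m)"] C[of "(False, m)"] \<omega>0[of m] by (auto simp: y_def abs_mult)
      have C0: "C \<ge> 0" using C[of p] norm_ge_zero order_trans by blast
      show "norm (y' p r) \<le> K * C"
      proof (cases u)
        case True
        have "\<omega> m * \<bar>c (m - 1) r - 1\<bar> \<le> R * \<omega> (m - 1) * \<bar>c (m - 1) r - 1\<bar>"
          by (intro mult_right_mono \<omega>2) simp
        also have "\<dots> \<le> R * C" using C1(2)[of "m - 1"] R by (simp add: mult.assoc mult_left_mono)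
        finally have "\<omega> m * \<bar>c m r - 1\<bar> + \<omega> m * \<bar>c (m - 1) r - 1\<bar> \<le> (1 + R) * C"
          using C1(2)[of m] by (simp add: algebra_simps)
        moreover have "\<bar>c m r - c (m - 1) r\<bar> \<le> \<bar>c m r - 1\<bar> + \<bar>c (m - 1) r - 1\<bar>" by simp
        then have "\<omega> m * \<bar>c m r - c (m - 1) r\<bar> \<le> \<omega> m * \<bar>c m r - 1\<bar> + \<omega> m * \<bar>c (m - 1) r - 1\<bar>"
          unfolding distrib_left[symmetric] using \<omega>0[of m] by (intro mult_left_mono) auto
        moreover have "y' p r = 2 * (\<omega> m * (c m r - c (m - 1) r))" using True by (simp add: p y'_def)
        then have "norm (y' p r) = 2 * (\<omega> m * \<bar>c m r - c (m - 1) r\<bar>)"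
          using \<omega>0[of m] by (simp only: real_norm_def abs_mult abs_numeral abs_of_pos)
        ultimately have "norm (y' p r) \<le> 2 * ((1 + R) * C)" by linarith
        also have "\<dots> = (2 * (1 + R)) * C" by simp
        also have "\<dots> \<le> K * C"
        proof (rule mult_right_mono[OF _ C0])
          have "2 * (1 + R) \<le> 4 * 1 * R" using R by simp
          also have "\<dots> \<le> K" unfolding K_def using N1 R by (intro mult_right_mono mult_left_mono) auto
          finally show "2 * (1 + R) \<le> K" .
        qed
        finally show ?thesis .
      next
        case False
        have "\<omega> m * \<bar>b (m + 1) r\<bar> \<le> \<omega> (m + 1) * \<bar>b (m + 1) r\<bar>" by (intro mult_right_mono \<omega>1) simp
        then have "\<omega> m * \<bar>b (m + 1) r\<bar> + \<omega> m * \<bar>b m r\<bar> \<le> 2 * C" using C1(1)[of "m + 1"] C1(1)[of m] by simp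
        moreover have "\<omega> m * \<bar>b (m + 1) r - b m r\<bar> \<le> \<omega> m * \<bar>b (m + 1) r\<bar> + \<omega> m * \<bar>b m r\<bar>"
          unfolding distrib_left[symmetric] using \<omega>0[of m] by (intro mult_left_mono) auto
        ultimately have *: "\<omega> m * \<bar>b (m + 1) r - b m r\<bar> \<le> 2 * C" by simp
        have "norm (y' p r) = 2 * \<bar>c m r\<bar> * (\<omega> m * \<bar>b (m + 1) r - b m r\<bar>)"
          using False \<omega>0[of m] by (simp add: p y'_def abs_mult)
        also have "\<dots> \<le> 2 * N * (2 * C)"
          by (intro mult_mono * c_le r) (use \<omega>0[of m] N1 in auto)
        also have "\<dots> = 4 * N * 1 * C" by simp
        also have "\<dots> \<le> 4 * N * R * C" using N1 R C0 by (intro mult_right_mono mult_left_mono) auto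
        finally show ?thesis by (simp add: K_def)
      qed
    next
      fix p :: "bool \<times> int"
      obtain u m where p: "p = (u, m)" by (cases p) auto
      show "norm (y p t0) \<le> A'"
      proof (cases "m \<ge> 0")
        case True
        have "\<omega> m \<le> R ^ nat m" unfolding \<omega>_def by (intro power_increasing R) auto
        then have "norm (y p t0) \<le> R ^ nat m * \<bar>if u then b m t0 else c m t0 - 1\<bar>"
          using \<omega>0[of m] by (auto simp: p y_def abs_mult intro!: mult_right_mono)
        also have "\<dots> \<le> A" using init[of "nat m"] True by (auto simp: mult.commute abs_minus_commute)
        finally show ?thesis by (simp add: A'_def)
      next
        case False
        then have "\<omega> m = 1" by (simp add: \<omega>_def)
        then have "norm (y p t0) \<le> N + 1"
          using b_le[of t0 m] c_le[of t0 m] t01 by (auto simp: p y_def)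
        then show ?thesis by (simp add: A'_def)
      qed
    qed (use K t t01 in auto)
    from this[of "(True, int n)"] this[of "(False, int n)"] R
    show "\<bar>b n t\<bar> * R ^ n \<le> 2 * A' * exp (2 * K * \<bar>t - t0\<bar>)"
      "\<bar>1 - c n t\<bar> * R ^ n \<le> 2 * A' * exp (2 * K * \<bar>t - t0\<bar>)"
      by (auto simp: y_def \<omega>_def abs_mult mult.commute abs_minus_commute)
  qed
  have "2 * A' * exp (2 * K * \<bar>t - t0\<bar>) \<le> 2 * A' * exp (2 * K * (t1 - t0))" if "t \<in> {t0..t1}" for t
    using that A' K by (intro mult_left_mono) auto
  with main show ?thesis by (meson order_trans)
qed

end

locale toda_decay = toda_strip +
  assumes decay: "\<And>R. R \<ge> 1 \<Longrightarrow> \<exists>D. \<forall>t\<in>{t0..t1}. \<forall>n::nat. \<bar>b n t\<bar> * R ^ n \<le> D \<and> \<bar>1 - c n t\<bar> * R ^ n \<le> D"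
begin

section \<open>Tail bounds uniform in time\<close>

abbreviation "\<beta> t n \<equiv> b (int n) t"
abbreviation "v t n \<equiv> 1 - c (int n) t"

text \<open>Taking the supremum over time at each site, before summing, gives one majorant for all
  times; the uniform limits behind the time derivatives rest on it.\<close>

definition site_sup :: "nat \<Rightarrow> real" where
  "site_sup n = (SUP t\<in>{t0..t1}. \<bar>\<beta> t n\<bar> + \<bar>v t n\<bar>)"

definition tail_sup :: "nat \<Rightarrow> real" where
  "tail_sup n = (\<Sum>i. site_sup (n + i))"

lemma site_le: 
  assumes "t \<in> {t0..t1}"
  shows "\<bar>\<beta> t n\<bar> + \<bar>v t n\<bar> \<le> site_sup n"
proof -
  have "bdd_above ((\<lambda>t. \<bar>\<beta> t n\<bar> + \<bar>v t n\<bar>) ` {t0..t1})"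
  proof (rule bdd_aboveI2)
    fix t assume "t \<in> {t0..t1}"
    then have "\<bar>\<beta> t n\<bar> \<le> N" "\<bar>c (int n) t\<bar> \<le> N" by (rule b_le c_le)+
    moreover have "\<bar>v t n\<bar> \<le> 1 + \<bar>c (int n) t\<bar>"
      using abs_triangle_ineq4[of 1 "c (int n) t"] by simp
    moreover have "x + z \<le> N + (1 + N)" if "x \<le> N" "y \<le> N" "z \<le> 1 + y" for x y z
      using that by linarith
    ultimately show "\<bar>\<beta> t n\<bar> + \<bar>v t n\<bar> \<le> N + (1 + N)" by blast
  qed
  then show ?thesis unfolding site_sup_def by (rule cSUP_upper[OF assms])
qed

lemma site_nonneg: "site_sup n \<ge> 0"
proof (rule order_trans)
  show "0 \<le> \<bar>\<beta> t0 n\<bar> + \<bar>v t0 n\<bar>" by (intro add_nonneg_nonneg abs_ge_zero)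
  show "\<bar>\<beta> t0 n\<bar> + \<bar>v t0 n\<bar> \<le> site_sup n" by (rule site_le) (use t01 in simp)
qed

lemma site_sup_decay:
  assumes "R \<ge> 1"
  obtains D where "D \<ge> 0" "\<And>n. site_sup n * R ^ n \<le> D"
proof -
  obtain D where D: "\<And>t n. t \<in> {t0..t1} \<Longrightarrow> \<bar>\<beta> t n\<bar> * R ^ n \<le> D \<and> \<bar>v t n\<bar> * R ^ n \<le> D"
    using decay[OF assms] by blast
  have le: "site_sup n \<le> 2 * D / R ^ n" for n
    unfolding site_sup_def
  proof (rule cSUP_least)
    fix t assume "t \<in> {t0..t1}"
    from D[OF this, of n] show "\<bar>\<beta> t n\<bar> + \<bar>v t n\<bar> \<le> 2 * D / R ^ n"
      using assms by (simp add: field_simps)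
  qed (use t01 in auto)
  have "site_sup n * R ^ n \<le> 2 * D" for n using le[of n] assms by (simp add: field_simps)
  moreover from this[of 0] have "2 * D \<ge> 0" using site_nonneg[of 0] by simp
  ultimately show ?thesis using that by blast
qed

lemma site_sup_le_geometric:
  assumes "R \<ge> 1"
  obtains D where "D \<ge> 0" "\<And>n i. site_sup (n + i) * R ^ n \<le> D * (1 / 2) ^ i"
proof -
  obtain D where D: "D \<ge> 0" "\<And>n. site_sup n * (2 * R) ^ n \<le> D"
    using site_sup_decay[of "2 * R"] assms by auto
  have "site_sup (n + i) * R ^ n \<le> D * (1 / 2) ^ i" for n i
  proof -
    have "R ^ n * 2 ^ i \<le> (2 * R) ^ n * (2 * R) ^ i"
      using assms by (intro mult_mono power_mono) auto
    also have "\<dots> = (2 * R) ^ (n + i)" by (simp add: power_add)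
    finally have "site_sup (n + i) * (R ^ n * 2 ^ i) \<le> site_sup (n + i) * (2 * R) ^ (n + i)"
      by (intro mult_left_mono site_nonneg)
    also have "\<dots> \<le> D" by (rule D)
    finally show ?thesis by (simp add: power_divide field_simps)
  qed
  with D(1) show ?thesis using that by blast
qed

lemma site_summable: "summable (\<lambda>i. site_sup (n + i))"
proof -
  obtain D where "D \<ge> 0" and D: "\<And>n i. site_sup (n + i) * 1 ^ n \<le> D * (1 / 2) ^ i"
    by (rule site_sup_le_geometric[OF order_refl]) (blast intro: that)
  show ?thesis
  proof (rule summable_comparison_test')
    show "summable (\<lambda>i. D * (1 / 2) ^ i :: real)" by (intro summable_mult summable_geometric) simp
    show "norm (site_sup (n + i)) \<le> D * (1 / 2) ^ i" for i using D[of n i] site_nonneg by simp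
  qed
qed

lemma tail_sup_decay:
  assumes "R \<ge> 1"
  shows "\<exists>D. \<forall>n. tail_sup n * R ^ n \<le> D"
proof -
  obtain D where "D \<ge> 0" and D: "\<And>n i. site_sup (n + i) * R ^ n \<le> D * (1 / 2) ^ i"
    by (rule site_sup_le_geometric[OF assms]) (blast intro: that)
  have "tail_sup n * R ^ n \<le> D * 2" for n
  proof -
    have "tail_sup n * R ^ n = (\<Sum>i. site_sup (n + i) * R ^ n)"
      unfolding tail_sup_def by (rule suminf_mult2[OF site_summable])
    also have "\<dots> \<le> (\<Sum>i. D * (1 / 2) ^ i)"
      by (intro suminf_le D summable_mult2 site_summable summable_mult summable_geometric) simp
    also have "\<dots> = D * 2"
      using suminf_mult[OF summable_geometric[of "1 / 2 :: real"], of D] suminf_geometric[of "1 / 2 :: real"] by simp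
    finally show ?thesis .
  qed
  then show ?thesis by blast
qed

lemma tail_sup_Suc: "tail_sup (Suc n) \<le> tail_sup n"
  using suminf_split_head[OF site_summable[of n]] site_nonneg[of n] by (simp add: tail_sup_def)

lemma tail_sup_antimono: "m \<le> n \<Longrightarrow> tail_sup n \<le> tail_sup m"
  by (rule lift_Suc_antimono_le[of tail_sup, OF tail_sup_Suc])

lemma tail_sup_tendsto_0: "(\<lambda>n. tail_sup (m + n)) \<longlonglongrightarrow> 0"
proof -
  obtain D where D: "\<And>n. tail_sup n * 2 ^ n \<le> D" using tail_sup_decay[of 2] by auto
  have nn: "tail_sup n \<ge> 0" for n unfolding tail_sup_def by (intro suminf_nonneg site_summable site_nonneg)
  have le: "tail_sup n \<le> D * (1 / 2) ^ n" for n using D[of n] by (simp add: power_divide field_simps)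
  have "tail_sup \<longlonglongrightarrow> 0"
  proof (rule tendsto_sandwich[of "\<lambda>_. 0"])
    show "(\<lambda>n. D * (1 / 2) ^ n) \<longlonglongrightarrow> 0"
      by (intro tendsto_mult_right_zero LIMSEQ_power_zero) simp
  qed (use nn le in auto)
  then show ?thesis using LIMSEQ_ignore_initial_segment[of tail_sup 0 m] by (simp add: add.commute)
qed

lemma fast_tail:
  assumes t: "t \<in> {t0..t1}"
  shows "fast_tail_bound (\<beta> t) (v t) tail_sup (tail_sup 1)"
proof (rule fast_tail_bound.intro[OF tail_bound.intro fast_tail_bound_axioms.intro])
  define g where "g = (\<lambda>m. \<bar>\<beta> t m\<bar> + \<bar>v t m\<bar>)"
  have g: "g m \<le> site_sup m" for m unfolding g_def by (rule site_le[OF t])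
  have g0: "0 \<le> g m" for m unfolding g_def by (intro add_nonneg_nonneg abs_ge_zero)
  have le: "norm (g m) \<le> site_sup m" for m using g[of m] g0[of m] by simp
  have sm: "summable (\<lambda>i. g (n + i))" for n
    by (rule summable_comparison_test'[OF site_summable[of n] le])
  from sm[of 0] show "summable (\<lambda>i. \<bar>\<beta> t i\<bar> + \<bar>v t i\<bar>)" by (simp add: g_def)
  have "(\<Sum>i. g (n + i)) \<le> tail_sup n" for n
    unfolding tail_sup_def by (rule suminf_le[OF g sm site_summable])
  then show "(\<Sum>i. \<bar>\<beta> t (n + i)\<bar> + \<bar>v t (n + i)\<bar>) \<le> tail_sup n" for n
    unfolding g_def .
  show "\<exists>D. \<forall>n\<ge>1. tail_sup n * R ^ n \<le> D" if "R \<ge> 1" for R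
    using tail_sup_decay[OF that] by blast
  show "tail_sup n \<le> tail_sup m" if "m \<le> n" for m n by (rule tail_sup_antimono[OF that])
  show "tail_sup 1 \<le> tail_sup 1" by (rule order_refl)
qed

section \<open>Time derivatives of the Taylor coefficients\<close>

abbreviation "kap t j n \<equiv> jost_coeff (\<beta> t) (v t) j n"

text \<open>The coefficient of \<open>w ^ j\<close> in \<open>2 * w * (c(n) F(n+1) - F(n))\<close>;
  the factor \<open>w\<close> is absorbed by the index shift of \<open>jost_coeff\<close>.\<close>

definition coeff_deriv :: "nat \<Rightarrow> nat \<Rightarrow> real \<Rightarrow> real" where
  "coeff_deriv j n t = 2 * (c (int n) t * kap t j (Suc n) - kap t j n)"

lemma coeff_diff:
  assumes t: "t \<in> {t0..t1}"
  shows "kap t (Suc (Suc j)) n - kap t (Suc (Suc j)) (Suc n) =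
     kap t j (Suc n) - c (int (Suc n)) t * kap t j (Suc (Suc n)) - \<beta> t (Suc n) * kap t (Suc j) (Suc n)"
  using tail_bound.jost_coeff_diff[OF fast_tail_bound.axioms(1)[OF fast_tail[OF t]], of j n] by simp

lemma coeff_le:
  assumes t: "t \<in> {t0..t1}"
  shows "\<bar>kap t (Suc (Suc j)) n\<bar> \<le> (1 + tail_sup 1) ^ Suc j * tail_sup n"
proof -
  interpret fast_tail_bound "\<beta> t" "v t" tail_sup "tail_sup 1" by (rule fast_tail[OF t])
  show ?thesis
    by (rule order_trans[OF jost_coeff_le mult_left_mono[OF tail_sup_antimono]])
      (use sigma_nonneg in auto)
qed

lemma coeff_deriv_le:
  assumes t: "t \<in> {t0..t1}"
  shows "\<bar>coeff_deriv (Suc j) n t\<bar> \<le> 2 * (N + 1) * ((1 + tail_sup 1) ^ j * tail_sup n)"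
proof (cases j)
  case 0
  have "tail_sup n \<ge> site_sup n"
    using suminf_split_head[OF site_summable[of n]] suminf_nonneg[OF site_summable[of "Suc n"]] site_nonneg
    by (simp add: tail_sup_def)
  then have "\<bar>v t n\<bar> \<le> tail_sup n" using site_le[OF t, of n] by linarith
  moreover from this have "2 * 1 * tail_sup n \<le> 2 * (N + 1) * tail_sup n"
    using N1 by (intro mult_right_mono) auto
  ultimately show ?thesis using 0 by (simp add: coeff_deriv_def abs_minus_commute)
next
  case (Suc i)
  let ?S = "(1 + tail_sup 1) ^ j * tail_sup n"
  interpret fast_tail_bound "\<beta> t" "v t" tail_sup "tail_sup 1" by (rule fast_tail[OF t])
  have 1: "\<bar>kap t (Suc j) n\<bar> \<le> ?S" using coeff_le[OF t, of i n] Suc by simp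
  have 2: "\<bar>kap t (Suc j) (Suc n)\<bar> \<le> ?S"
    using order_trans[OF coeff_le[OF t, of i "Suc n"] mult_left_mono[OF tail_sup_Suc]] Suc sigma_nonneg by simp
  have "\<bar>c (int n) t * kap t (Suc j) (Suc n)\<bar> \<le> N * ?S"
    unfolding abs_mult by (intro mult_mono 2 c_le t) (use N1 in auto)
  with 1 show ?thesis unfolding coeff_deriv_def by (simp add: algebra_simps)
qed

text \<open>Compatibility of the spatial recursion with the time evolution. The recursion expresses
  the degree \<open>j\<close> coefficients at sites \<open>n\<close> and \<open>n + 2\<close>
  through those at \<open>n + 1\<close> and lower ones; after this substitution both sides agree
  identically.\<close>

lemma coeff_diff_deriv:
  assumes IH: "\<And>i n t. i \<le> j \<Longrightarrow> t \<in> {t0..t1} \<Longrightarrow>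
      ((\<lambda>t. kap t (Suc i) n) has_real_derivative coeff_deriv i n t) (at t within {t0..t1})"
    and t: "t \<in> {t0..t1}"
  shows "((\<lambda>t. kap t j (Suc n) - c (int (Suc n)) t * kap t j (Suc (Suc n)) - \<beta> t (Suc n) * kap t (Suc j) (Suc n))
     has_real_derivative coeff_deriv (Suc j) n t - coeff_deriv (Suc j) (Suc n) t) (at t within {t0..t1})"
proof (cases j)
  case 0
  show ?thesis
    using DERIV_minus[OF b_deriv[OF t, of "int (Suc n)"]] 0 by (simp add: coeff_deriv_def algebra_simps)
next
  case (Suc i)
  have cd: "(c (int (Suc n)) has_real_derivative 2 * c (int (Suc n)) t * (\<beta> t (Suc (Suc n)) - \<beta> t (Suc n))) (at t within {t0..t1})"
    using c_deriv[OF t, of "int (Suc n)"] by (simp add: add.commute)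
  have bd: "(b (int (Suc n)) has_real_derivative 2 * (c (int (Suc n)) t - c (int n) t)) (at t within {t0..t1})"
    using b_deriv[OF t, of "int (Suc n)"] by simp
  have e1: "kap t (Suc j) n = kap t (Suc j) (Suc n) + kap t i (Suc n) - c (int (Suc n)) t * kap t i (Suc (Suc n)) - \<beta> t (Suc n) * kap t (Suc i) (Suc n)"
    using coeff_diff[OF t, of i n] Suc by simp
  have e2: "kap t (Suc j) (Suc (Suc n)) = kap t (Suc j) (Suc n) - kap t i (Suc (Suc n)) + c (int (Suc (Suc n))) t * kap t i (Suc (Suc (Suc n)))
      + \<beta> t (Suc (Suc n)) * kap t (Suc i) (Suc (Suc n))"
    using coeff_diff[OF t, of i "Suc n"] Suc by simp
  have "((\<lambda>t. kap t j (Suc n) - c (int (Suc n)) t * kap t j (Suc (Suc n)) - \<beta> t (Suc n) * kap t (Suc j) (Suc n))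
     has_real_derivative coeff_deriv i (Suc n) t
       - (2 * c (int (Suc n)) t * (\<beta> t (Suc (Suc n)) - \<beta> t (Suc n)) * kap t j (Suc (Suc n))
          + coeff_deriv i (Suc (Suc n)) t * c (int (Suc n)) t)
       - (2 * (c (int (Suc n)) t - c (int n) t) * kap t (Suc j) (Suc n) + coeff_deriv j (Suc n) t * \<beta> t (Suc n)))
     (at t within {t0..t1})"
    unfolding Suc
    by (intro DERIV_diff DERIV_mult cd bd IH t) (use Suc in auto)
  moreover have "coeff_deriv i (Suc n) t
       - (2 * c (int (Suc n)) t * (\<beta> t (Suc (Suc n)) - \<beta> t (Suc n)) * kap t j (Suc (Suc n))
          + coeff_deriv i (Suc (Suc n)) t * c (int (Suc n)) t)
       - (2 * (c (int (Suc n)) t - c (int n) t) * kap t (Suc j) (Suc n) + coeff_deriv j (Suc n) t * \<beta> t (Suc n))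
     = coeff_deriv (Suc j) n t - coeff_deriv (Suc j) (Suc n) t"
    unfolding coeff_deriv_def[of "Suc j"] unfolding e1 e2 unfolding coeff_deriv_def Suc
    by (simp only: algebra_simps)
  ultimately show ?thesis by simp
qed

text \<open>Each coefficient is an infinite sum over sites, but its difference from the value at
  site \<open>n + M\<close> is a finite one, differentiable by induction on the degree. As
  \<open>M\<close> grows, the value at \<open>n + M\<close> tends to zero and its formal derivative
  does so uniformly in time.\<close>

lemma coeff_has_deriv:
  assumes "t \<in> {t0..t1}"
  shows "((\<lambda>t. kap t (Suc j) n) has_real_derivative coeff_deriv j n t) (at t within {t0..t1})"
  using assms
proof (induction j arbitrary: n t rule: less_induct)
  case (less j)
  show ?case
  proof (cases j)
    case 0
    then show ?thesis by (simp add: coeff_deriv_def)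
  next
    case (Suc i)
    let ?f = "\<lambda>M t. kap t (Suc j) n - kap t (Suc j) (n + M)"
    let ?e = "\<lambda>M. 2 * (N + 1) * ((1 + tail_sup 1) ^ i * tail_sup (n + M))"
    show ?thesis
      unfolding has_real_derivative_iff_has_vector_derivative
    proof (rule has_vector_derivative_uniform_limit[where f = ?f and e = ?e])
      fix M t assume t: "t \<in> {t0..t1}"
      have "(?f M has_real_derivative coeff_deriv j n t - coeff_deriv j (n + M) t) (at t within {t0..t1})"
      proof (induction M)
        case 0
        then show ?case by simp
      next
        case (Suc M)
        have "((\<lambda>t. kap t i (Suc (n + M)) - c (int (Suc (n + M))) t * kap t i (Suc (Suc (n + M)))
             - \<beta> t (Suc (n + M)) * kap t (Suc i) (Suc (n + M)))
          has_real_derivative coeff_deriv (Suc i) (n + M) t - coeff_deriv (Suc i) (Suc (n + M)) t) (at t within {t0..t1})"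
          by (rule coeff_diff_deriv[OF _ t]) (use less.IH \<open>j = Suc i\<close> in auto)
        from DERIV_add[OF Suc this]
        have "((\<lambda>t. ?f M t + (kap t i (Suc (n + M)) - c (int (Suc (n + M))) t * kap t i (Suc (Suc (n + M)))
             - \<beta> t (Suc (n + M)) * kap t (Suc i) (Suc (n + M)))) has_real_derivative
           coeff_deriv j n t - coeff_deriv j (n + Suc M) t) (at t within {t0..t1})"
          by (simp add: \<open>j = Suc i\<close>)
        then show ?case
          unfolding has_real_derivative_iff_has_vector_derivative
        proof (rule has_vector_derivative_transform[OF t, rotated])
          fix r assume "r \<in> {t0..t1}"
          from coeff_diff[OF this, of i "n + M"] \<open>j = Suc i\<close>
          show "?f (Suc M) r = ?f M r + (kap r i (Suc (n + M)) - c (int (Suc (n + M))) r * kap r i (Suc (Suc (n + M)))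
             - \<beta> r (Suc (n + M)) * kap r (Suc i) (Suc (n + M)))" by simp
        qed
      qed
      then show "(?f M has_vector_derivative coeff_deriv j n t - coeff_deriv j (n + M) t) (at t within {t0..t1})"
        by (simp add: has_real_derivative_iff_has_vector_derivative)
      show "norm (coeff_deriv j n t - coeff_deriv j (n + M) t - coeff_deriv j n t) \<le> ?e M"
        using coeff_deriv_le[OF t, of i "n + M"] Suc by simp
    next
      show "?e \<longlonglongrightarrow> 0"
        by (intro tendsto_mult_right_zero tail_sup_tendsto_0)
      fix t assume t: "t \<in> {t0..t1}"
      have "(\<lambda>M. kap t (Suc j) (n + M)) \<longlonglongrightarrow> 0"
      proof (rule Lim_null_comparison)
        show "\<forall>\<^sub>F M in sequentially. norm (kap t (Suc j) (n + M)) \<le> (1 + tail_sup 1) ^ j * tail_sup (n + M)"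
          using coeff_le[OF t, of i] Suc by simp
        show "(\<lambda>M. (1 + tail_sup 1) ^ j * tail_sup (n + M)) \<longlonglongrightarrow> 0"
          by (intro tendsto_mult_right_zero tail_sup_tendsto_0)
      qed
      from tendsto_diff[OF tendsto_const[of "kap t (Suc j) n"] this]
      show "(\<lambda>M. ?f M t) \<longlonglongrightarrow> kap t (Suc j) n" by simp
    qed (use less.prems in auto)
  qed
qed

abbreviation "F t n w \<equiv> jost (\<beta> t) (v t) n w"

lemma jost_deriv:
  assumes t: "t \<in> {t0..t1}"
  shows "((\<lambda>t. F t n w) has_vector_derivative 2 * w * (of_real (c (int n) t) * F t (Suc n) w - F t n w)) (at t within {t0..t1})"
proof -
  define r where "r = norm w"
  define \<sigma> where "\<sigma> = tail_sup 1"
  define R where "R = (2 * ((1 + \<sigma>) * r + 1))\<^sup>2"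
  have \<sigma>0: "\<sigma> \<ge> 0" unfolding \<sigma>_def using fast_tail_bound.axioms(1)[OF fast_tail[OF t]] by (rule tail_bound.sigma_nonneg)
  have r0: "r \<ge> 0" by (simp add: r_def)
  have "R \<ge> 1" unfolding R_def using \<sigma>0 r0 by (intro one_le_power) (auto intro: add_nonneg_nonneg)
  then obtain D where D: "\<And>n. tail_sup n * R ^ n \<le> D" using tail_sup_decay by blast
  \<comment> \<open>\<open>kap t j\<close> belongs to the power \<open>j - 1\<close>, so multiplying
    it by \<open>r ^ j\<close> costs one more factor \<open>r\<close>, and the \<open>2\<close>
    makes up for the shifted power of \<open>1 / 2\<close>. The \<open>1\<close> covers the constant
    coefficient.\<close>
  define D' where "D' = 2 * r * (1 + \<bar>D\<bar>)"
  have kle: "\<bar>kap t j m\<bar> * r ^ j \<le> D' * (1 / 2) ^ j" if t: "t \<in> {t0..t1}" for t j m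
  proof -
    interpret fast_tail_bound "\<beta> t" "v t" tail_sup "tail_sup 1" by (rule fast_tail[OF t])
    consider "j = 0" | "j = 1" | i where "j = Suc (Suc i)"
      by (metis One_nat_def not0_implies_Suc)
    then show ?thesis
    proof cases
      case 3
      have "\<bar>kap t j m\<bar> * r ^ Suc i \<le> D * (1 / 2) ^ (Suc i + m)"
        using jost_coeff_geometric[OF r0, of R D i m] D 3 by (simp add: R_def \<sigma>_def)
      also have "\<dots> \<le> (1 + \<bar>D\<bar>) * (1 / 2) ^ Suc i"
        by (intro mult_mono power_decreasing) auto
      finally have "\<bar>kap t j m\<bar> * r ^ Suc i * r \<le> (1 + \<bar>D\<bar>) * (1 / 2) ^ Suc i * r"
        using r0 by (rule mult_right_mono)
      moreover have "\<bar>kap t j m\<bar> * r ^ j = \<bar>kap t j m\<bar> * r ^ Suc i * r"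
        using 3 by (simp only: power_Suc mult_ac)
      moreover have "(1 + \<bar>D\<bar>) * (1 / 2) ^ Suc i * r = D' * (1 / 2) ^ j"
        using 3 by (simp add: D'_def)
      ultimately show ?thesis by (simp only:)
    qed (use r0 in \<open>auto simp: D'_def algebra_simps\<close>)
  qed
  have "((\<lambda>t. \<Sum>j. of_real (kap t (Suc j) n) * w ^ j) has_vector_derivative
     (\<Sum>j. of_real (coeff_deriv j n t) * w ^ j)) (at t within {t0..t1})"
  proof (rule has_vector_derivative_suminf[where B = "\<lambda>j. 2 * (N + 1) * D' * (1 / 2) ^ j"])
    fix j t assume t: "t \<in> {t0..t1}"
    show "((\<lambda>t. complex_of_real (kap t (Suc j) n) * w ^ j) has_vector_derivative
      of_real (coeff_deriv j n t) * w ^ j) (at t within {t0..t1})"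
      by (intro has_vector_derivative_mult_left has_vector_derivative_of_real coeff_has_deriv t)
    have "\<bar>coeff_deriv j n t\<bar> \<le> 2 * (\<bar>c (int n) t\<bar> * \<bar>kap t j (Suc n)\<bar> + \<bar>kap t j n\<bar>)"
      unfolding coeff_deriv_def by (simp add: abs_mult[symmetric])
    also have "\<dots> \<le> 2 * (N * \<bar>kap t j (Suc n)\<bar> + \<bar>kap t j n\<bar>)"
      by (intro mult_left_mono add_mono mult_right_mono c_le t) auto
    finally have "\<bar>coeff_deriv j n t\<bar> * r ^ j \<le> 2 * (N * \<bar>kap t j (Suc n)\<bar> + \<bar>kap t j n\<bar>) * r ^ j"
      using r0 by (intro mult_right_mono) auto
    also have "\<dots> = 2 * (N * (\<bar>kap t j (Suc n)\<bar> * r ^ j) + \<bar>kap t j n\<bar> * r ^ j)"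
      by (simp add: algebra_simps)
    also have "\<dots> \<le> 2 * (N * (D' * (1 / 2) ^ j) + D' * (1 / 2) ^ j)"
      using N1 by (intro mult_left_mono add_mono kle t) auto
    finally show "norm (complex_of_real (coeff_deriv j n t) * w ^ j) \<le> 2 * (N + 1) * D' * (1 / 2) ^ j"
      by (simp add: norm_mult norm_power r_def algebra_simps)
  next
    show "summable (\<lambda>j. 2 * (N + 1) * D' * (1 / 2 :: real) ^ j)"
      by (intro summable_mult summable_geometric) simp
  next
    fix t assume "t \<in> {t0..t1}"
    then show "summable (\<lambda>j. complex_of_real (kap t (Suc j) n) * w ^ j)"
      using fast_tail_bound.jost_summable[OF fast_tail] by blast
  qed (use t in auto)
  also have "(\<Sum>j. of_real (coeff_deriv j n t) * w ^ j) = 2 * w * (of_real (c (int n) t) * F t (Suc n) w - F t n w)"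
  proof -
    interpret fast_tail_bound "\<beta> t" "v t" tail_sup "tail_sup 1" by (rule fast_tail[OF t])
    have "of_real (coeff_deriv j n t) * w ^ j = 2 * (of_real (c (int n) t) * (of_real (kap t j (Suc n)) * w ^ j)
        - of_real (kap t j n) * w ^ j)" for j
      by (simp add: coeff_deriv_def algebra_simps)
    then have "(\<Sum>j. of_real (coeff_deriv j n t) * w ^ j) = 2 * (of_real (c (int n) t) * (w * F t (Suc n) w) - w * F t n w)"
      by (simp add: suminf_mult suminf_diff[symmetric] summable_diff summable_mult jost_shift flip: jost_shift(2))
    then show ?thesis by (simp add: algebra_simps)
  qed
  finally show ?thesis by (simp add: jost_def)
qed

end

subsection \<open>Functions of minimal exponential type\<close>

text \<open>The exponential series is a majorant; the finitely many coefficients below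
  \<open>L\<close> only enlarge the constant.\<close>

lemma exponential_type_bound:
  fixes k :: "nat \<Rightarrow> real" and \<epsilon> :: real
  assumes \<epsilon>: "\<epsilon> > 0" and le: "\<And>l. l \<ge> L \<Longrightarrow> \<bar>k l\<bar> \<le> A * (\<epsilon> ^ l / fact l)"
  shows "\<exists>D. \<forall>w::complex. norm (\<Sum>l. of_real (k l) * w ^ l) \<le> D * exp (\<epsilon> * norm w)"
proof -
  define D where "D = \<bar>A\<bar> + (\<Sum>l<L. \<bar>k l\<bar> * (fact l / \<epsilon> ^ l))"
  have D: "\<bar>k l\<bar> \<le> D * (\<epsilon> ^ l / fact l)" for l
  proof -
    have pos: "\<epsilon> ^ l / fact l > 0" using \<epsilon> by simp
    have nn: "0 \<le> (\<Sum>l<L. \<bar>k l\<bar> * (fact l / \<epsilon> ^ l))" using \<epsilon> by (intro sum_nonneg) simp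
    show ?thesis
    proof (cases "l \<ge> L")
      case True
      have "A * (\<epsilon> ^ l / fact l) \<le> D * (\<epsilon> ^ l / fact l)"
        using pos nn by (intro mult_right_mono) (auto simp: D_def)
      with le[OF True] show ?thesis by linarith
    next
      case False
      then have "\<bar>k l\<bar> * (fact l / \<epsilon> ^ l) \<le> (\<Sum>l<L. \<bar>k l\<bar> * (fact l / \<epsilon> ^ l))"
        using \<epsilon> by (intro member_le_sum) auto
      then have "\<bar>k l\<bar> * (fact l / \<epsilon> ^ l) \<le> D" by (simp add: D_def)
      then show ?thesis using \<epsilon> by (simp add: field_simps)
    qed
  qed
  have "norm (\<Sum>l. of_real (k l) * w ^ l) \<le> D * exp (\<epsilon> * norm w)" for w :: complex
  proof -
    have s: "(\<lambda>l. D * ((\<epsilon> * norm w) ^ l /\<^sub>R fact l)) sums (D * exp (\<epsilon> * norm w))"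
      by (intro sums_mult exp_converges)
    have "norm (of_real (k l) * w ^ l) \<le> D * ((\<epsilon> * norm w) ^ l /\<^sub>R fact l)" for l
    proof -
      have "norm (of_real (k l) * w ^ l) = \<bar>k l\<bar> * norm w ^ l" by (simp add: norm_mult norm_power)
      also have "\<dots> \<le> D * (\<epsilon> ^ l / fact l) * norm w ^ l" by (intro mult_right_mono D) simp
      finally show ?thesis by (simp add: power_mult_distrib field_simps)
    qed
    from norm_suminf_le[OF this sums_summable[OF s]] sums_unique[OF s] show ?thesis by simp
  qed
  then show ?thesis by blast
qed

text \<open>Degree \<open>l\<close> corresponds to the tail at some \<open>m \<ge> l / 2\<close>,
  where the assumption gives at most \<open>A\<close> divided by \<open>l / 2\<close> to the power
  \<open>(1 + \<delta>) * l\<close>. The part \<open>l ^ l\<close> dominates \<open>fact l\<close>.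
  The remaining \<open>l powr (- \<delta>)\<close>, raised to the power \<open>l\<close>, outweighs
  \<open>\<Lambda> ^ l\<close>, in which all geometric losses are collected.\<close>

lemma (in tail_bound) jost_minimal_type:
  assumes s: "\<And>m. m \<ge> 1 \<Longrightarrow> s m \<le> A / real m powr ((1 + \<delta>) * 2 * real m)"
    and A: "A \<ge> 0" and \<delta>: "\<delta> > 0" and \<epsilon>: "\<epsilon> > 0"
  shows "\<exists>D. \<forall>w. norm (jost \<beta> v n w) \<le> D * exp (\<epsilon> * norm w)"
proof -
  define \<Lambda> where "\<Lambda> = (1 + \<sigma>) * 2 powr (1 + \<delta>)"
  have "(\<lambda>l. \<Lambda> * real l powr (- \<delta>)) \<longlonglongrightarrow> \<Lambda> * 0"
    by (intro tendsto_mult tendsto_const tendsto_neg_powr filterlim_real_sequentially) (use \<delta> in simp)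
  then have "\<forall>\<^sub>F l in sequentially. \<Lambda> * real l powr (- \<delta>) < \<epsilon>"
    using order_tendstoD(2) \<epsilon> by fastforce
  then obtain L where L: "\<And>l. l \<ge> L \<Longrightarrow> \<Lambda> * real l powr (- \<delta>) < \<epsilon>"
    by (auto simp: eventually_sequentially)
  have "\<bar>jost_coeff \<beta> v (Suc l) n\<bar> \<le> A * (\<epsilon> ^ l / fact l)" if l: "l \<ge> Suc L" for l
  proof -
    obtain j where j: "l = Suc j" using l by (cases l) auto
    define m where "m = Suc (j div 2)"
    have lm: "real l \<le> 2 * real m" "real m \<ge> 1" "real l \<ge> 1" using j by (auto simp: m_def)
    have sg: "1 + \<sigma> \<ge> 0" using sigma_nonneg by simp
    have "\<bar>jost_coeff \<beta> v (Suc l) n\<bar> \<le> (1 + \<sigma>) ^ l * s (Suc n + j div 2)"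
      using jost_coeff_le[of j n] j by simp
    also have "\<dots> \<le> (1 + \<sigma>) ^ l * (A / real m powr ((1 + \<delta>) * 2 * real m))"
      using sg by (intro mult_left_mono order_trans[OF anti s]) (auto simp: m_def)
    also have "\<dots> \<le> (1 + \<sigma>) ^ l * (A / (real l powr ((1 + \<delta>) * real l) / 2 powr ((1 + \<delta>) * real l)))"
    proof (intro mult_left_mono divide_left_mono A)
      have "real l powr ((1 + \<delta>) * real l) / 2 powr ((1 + \<delta>) * real l) = (real l / 2) powr ((1 + \<delta>) * real l)"
        by (simp add: powr_divide)
      also have "\<dots> \<le> real m powr ((1 + \<delta>) * real l)"
        using lm \<delta> by (intro powr_mono2) auto
      also have "\<dots> \<le> real m powr ((1 + \<delta>) * 2 * real m)"
      proof (rule powr_mono)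
        have "(1 + \<delta>) * real l \<le> (1 + \<delta>) * (2 * real m)" using lm \<delta> by (intro mult_left_mono) auto
        then show "(1 + \<delta>) * real l \<le> (1 + \<delta>) * 2 * real m" by (simp only: mult.assoc)
      qed (use lm in auto)
      finally show "real l powr ((1 + \<delta>) * real l) / 2 powr ((1 + \<delta>) * real l) \<le> real m powr ((1 + \<delta>) * 2 * real m)" .
      show "0 < real m powr ((1 + \<delta>) * 2 * real m) * (real l powr ((1 + \<delta>) * real l) / 2 powr ((1 + \<delta>) * real l))"
        using lm by (intro mult_pos_pos divide_pos_pos) (auto simp: powr_gt_zero)
    qed (use sg in auto)
    also have "\<dots> = A * ((\<Lambda> * real l powr (- \<delta>)) ^ l / real l ^ l)"
    proof -
      have p: "x powr (y * real l) = (x powr y) ^ l" if "x > 0" for x y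
        using that by (simp add: powr_powr[symmetric] powr_realpow)
      have "real l powr (1 + \<delta>) = real l / real l powr (- \<delta>)"
        using lm by (simp add: powr_add powr_minus field_simps)
      then show ?thesis using lm
        by (simp add: p \<Lambda>_def power_mult_distrib power_divide)
    qed
    also have "\<dots> \<le> A * (\<epsilon> ^ l / fact l)"
    proof (intro mult_left_mono A frac_le power_mono)
      show "fact l \<le> real l ^ l" using fact_le_power[of l, where ?'a = real] by simp
      show "\<Lambda> * real l powr (- \<delta>) \<le> \<epsilon>" using L[of l] l by simp
      show "0 \<le> \<Lambda> * real l powr (- \<delta>)" unfolding \<Lambda>_def using sg by (intro mult_nonneg_nonneg) auto
    qed (use \<epsilon> in auto)
    finally show ?thesis .
  qed
  from exponential_type_bound[OF \<epsilon> this] show ?thesis by (simp add: jost_def)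
qed

lemma mult_eq_0_on_open:
  fixes f g :: "complex \<Rightarrow> complex"
  assumes U: "open U" "U \<noteq> {}" and f: "continuous_on U f" and 0: "\<And>w. w \<in> U \<Longrightarrow> f w * g w = 0"
  shows "\<exists>V. open V \<and> V \<noteq> {} \<and> V \<subseteq> U \<and> ((\<forall>w\<in>V. f w = 0) \<or> (\<forall>w\<in>V. g w = 0))"
proof (cases "\<forall>w\<in>U. f w = 0")
  case True
  then show ?thesis using U by blast
next
  case False
  let ?V = "{w \<in> U. f w \<noteq> 0}"
  have "open ?V"
    using continuous_open_preimage[OF f U(1), of "- {0}"] by (simp add: vimage_def Int_def open_Compl conj_commute)
  moreover have "?V \<noteq> {}" using False by auto
  ultimately show ?thesis using 0 by (intro exI[of _ ?V]) auto
qed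

text \<open>A function that decays exponentially in a half plane and has minimal type elsewhere: the
  product of its values at the four points \<open>\<plusminus>w\<close>, \<open>\<plusminus>\<i>w\<close> decays exponentially in all directions.\<close>
lemma holomorphic_exterior_eq_0:
  fixes g :: "complex \<Rightarrow> complex"
  assumes hol: "g holomorphic_on - cball 0 \<rho>" and \<rho>: "\<rho> > 0"
    and le1: "\<And>w. norm w > \<rho> \<Longrightarrow> norm (g w) \<le> D * exp (\<epsilon> * norm w)"
    and le2: "\<And>w. norm w > \<rho> \<Longrightarrow> norm (g w) \<le> D * exp (\<epsilon> * norm w + \<tau> * Re w)"
    and \<tau>: "4 * \<epsilon> < \<tau>" "\<tau> > 0"
    and w: "norm w > \<rho>"
  shows "g w = 0"
proof -
  define M where "M = (\<lambda>w. g w * g (- w) * (g (\<i> * w) * g (- (\<i> * w))))"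
  have pair: "norm (g w * g (- w)) \<le> D\<^sup>2 * exp (2 * \<epsilon> * norm w - \<tau> * \<bar>Re w\<bar>)" if w: "norm w > \<rho>" for w
  proof -
    have *: "norm (g w * g (- w)) \<le> D\<^sup>2 * exp (2 * \<epsilon> * norm w - \<tau> * \<bar>Re w\<bar>)" if w: "norm w > \<rho>" and re: "Re w \<le> 0" for w
    proof -
      have "norm (g w * g (- w)) \<le> (D * exp (\<epsilon> * norm w + \<tau> * Re w)) * (D * exp (\<epsilon> * norm w))"
        unfolding norm_mult using le2[OF w] le1[of "- w"] w
        by (intro mult_mono) (auto intro: order_trans[OF norm_ge_zero])
      also have "\<dots> = D\<^sup>2 * exp (2 * \<epsilon> * norm w - \<tau> * \<bar>Re w\<bar>)"
        using re by (simp add: power2_eq_square algebra_simps flip: exp_add)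
      finally show ?thesis .
    qed
    show ?thesis
    proof (cases "Re w \<le> 0")
      case True
      then show ?thesis using * w by blast
    next
      case False
      then show ?thesis using *[of "- w"] w by (simp add: mult.commute)
    qed
  qed
  \<comment> \<open>Each opposite pair contributes growth \<open>2 * \<epsilon>\<close>, in total
    \<open>4 * \<epsilon>\<close>; the decay is
    \<open>\<tau> * (\<bar>Re w\<bar> + \<bar>Im w\<bar>)\<close>, which is at least
    \<open>\<tau> * norm w\<close>.\<close>
  define \<mu> where "\<mu> = \<tau> - 4 * \<epsilon>"
  have \<mu>: "\<mu> > 0" using \<tau> by (simp add: \<mu>_def)
  have Mle: "norm (M w) \<le> (D\<^sup>2)\<^sup>2 * exp (- (\<mu> * norm w))" if w: "norm w > \<rho>" for w
  proof -
    have iw: "norm (\<i> * w) > \<rho>" using w by (simp add: norm_mult)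
    have "norm (M w) \<le> (D\<^sup>2 * exp (2 * \<epsilon> * norm w - \<tau> * \<bar>Re w\<bar>)) * (D\<^sup>2 * exp (2 * \<epsilon> * norm (\<i> * w) - \<tau> * \<bar>Re (\<i> * w)\<bar>))"
      unfolding M_def norm_mult[of "g w * g (- w)"]
      by (intro mult_mono pair w iw) (auto intro: order_trans[OF norm_ge_zero])
    also have "\<dots> = (D\<^sup>2)\<^sup>2 * exp (4 * \<epsilon> * norm w - \<tau> * (\<bar>Re w\<bar> + \<bar>Im w\<bar>))"
      by (simp add: norm_mult power2_eq_square algebra_simps flip: exp_add)
    also have "\<dots> \<le> (D\<^sup>2)\<^sup>2 * exp (- (\<mu> * norm w))"
    proof -
      have "\<tau> * norm w \<le> \<tau> * (\<bar>Re w\<bar> + \<bar>Im w\<bar>)" using \<tau> cmod_le by (intro mult_left_mono) auto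
      then show ?thesis by (intro mult_left_mono) (auto simp: \<mu>_def algebra_simps)
    qed
    finally show ?thesis .
  qed
  let ?S = "- cball (0::complex) \<rho>"
  have g2: "(\<lambda>w. g (c * w)) holomorphic_on ?S" if "norm c = 1" for c
  proof -
    have "(\<lambda>w. c * w) ` ?S \<subseteq> ?S" using that by (auto simp: norm_mult)
    then show ?thesis
      using holomorphic_on_compose_gen[of "\<lambda>w. c * w" ?S g ?S] hol
      by (auto simp: o_def intro!: holomorphic_intros)
  qed
  have Mhol: "M holomorphic_on ?S"
    using hol g2[of "- 1"] g2[of \<i>] g2[of "- \<i>"] unfolding M_def
    by (intro holomorphic_on_mult) (auto simp: o_def)
  \<comment> \<open>In the coordinate \<open>k = 1 / w\<close> the product decays like
    \<open>exp (- \<mu> / norm k)\<close> at \<open>0\<close>, so the singularity there is removable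
    with value \<open>0\<close>.\<close>
  define H where "H = (\<lambda>k. if k = 0 then 0 else M (1 / k))"
  let ?B = "ball (0::complex) (1 / \<rho>)"
  have kB: "norm (1 / k) > \<rho>" if "k \<in> ?B" "k \<noteq> 0" for k
    using that \<rho> by (simp add: norm_divide field_simps)
  have Hhol0: "H holomorphic_on ?B - {0}"
  proof (rule holomorphic_transform)
    show "(\<lambda>k. M (1 / k)) holomorphic_on ?B - {0}"
    proof (rule holomorphic_on_compose_gen[of "\<lambda>k. 1 / k" "?B - {0}" M ?S, unfolded o_def])
      show "(\<lambda>k. 1 / k) holomorphic_on ?B - {0}" by (intro holomorphic_intros) auto
      show "(\<lambda>k. 1 / k) ` (?B - {0}) \<subseteq> ?S"
      proof (rule image_subsetI)
        fix k assume "k \<in> ?B - {0}"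
        then have "norm (1 / k) > \<rho>" by (intro kB) auto
        then show "1 / k \<in> ?S" by (simp only: Compl_iff mem_cball dist_0_norm not_le)
      qed
    qed (rule Mhol)
  qed (auto simp: H_def)
  have Hle: "norm (H k) \<le> (D\<^sup>2)\<^sup>2 * (norm k / \<mu>)" if k: "k \<in> ?B" for k
  proof (cases "k = 0")
    case False
    have "norm (H k) \<le> (D\<^sup>2)\<^sup>2 * exp (- (\<mu> / norm k))"
      using Mle[OF kB[OF k False]] False by (simp add: H_def norm_divide)
    also have "\<dots> \<le> (D\<^sup>2)\<^sup>2 * (norm k / \<mu>)"
    proof (intro mult_left_mono)
      have "\<mu> / norm k \<le> exp (\<mu> / norm k)" using exp_ge_add_one_self[of "\<mu> / norm k"] by linarith
      then show "exp (- (\<mu> / norm k)) \<le> norm k / \<mu>"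
        using \<mu> False by (simp add: exp_minus field_simps)
    qed auto
    finally show ?thesis .
  qed (simp add: H_def)
  have "continuous_on ?B H"
    unfolding continuous_on_eq_continuous_at[OF open_ball]
  proof
    fix k assume k: "k \<in> ?B"
    show "isCont H k"
    proof (cases "k = 0")
      case False
      then show ?thesis
        using holomorphic_on_imp_continuous_on[OF Hhol0] k
        by (simp add: continuous_on_eq_continuous_at open_delete)
    next
      case True
      have "H \<midarrow>0\<rightarrow> 0"
      proof (rule Lim_null_comparison)
        show "\<forall>\<^sub>F k in at 0. norm (H k) \<le> (D\<^sup>2)\<^sup>2 * (norm k / \<mu>)"
        proof (rule eventually_mono)
          show "\<forall>\<^sub>F k in at 0. k \<in> ?B \<and> k \<in> UNIV" using \<rho> by (intro eventually_at_ball) simp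
        qed (use Hle in blast)
        show "(\<lambda>k. (D\<^sup>2)\<^sup>2 * (norm k / \<mu>)) \<midarrow>(0::complex)\<rightarrow> 0"
          using \<mu> by (auto intro!: tendsto_eq_intros)
      qed
      then show ?thesis using True by (simp add: isCont_def H_def)
    qed
  qed
  then have Hhol: "H holomorphic_on ?B"
    by (rule no_isolated_singularity[of _ _ "{0}"]) (use Hhol0 in auto)
  \<comment> \<open>Otherwise \<open>H\<close> would vanish at \<open>0\<close> to a finite order
    \<open>n\<close>. Along \<open>k = 1 / (m + 1)\<close> exponential decay is faster than any
    power, so the nonvanishing cofactor \<open>h\<close> would be \<open>0\<close> at the
    origin.\<close>
  have Hconst: "H constant_on ?B"
  proof (rule ccontr)
    assume nc: "\<not> H constant_on ?B"
    obtain h r n where n: "0 < n" and r: "0 < r" "ball 0 r \<subseteq> ?B" and h: "h holomorphic_on ball 0 r"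
      and Hh: "\<And>k. k \<in> ball 0 r \<Longrightarrow> H k = (k - 0) ^ n * h k" and h0: "\<And>k. k \<in> ball 0 r \<Longrightarrow> h k \<noteq> 0"
      by (rule holomorphic_factor_zero_nonconstant[OF Hhol _ _ _ _ nc, of 0]) (use \<rho> in \<open>auto simp: H_def\<close>)
    define k where "k = (\<lambda>m. complex_of_real (inverse (real (Suc m))))"
    have k0: "k \<longlonglongrightarrow> 0"
      unfolding k_def using tendsto_of_real[OF LIMSEQ_inverse_real_of_nat, where 'a = complex]
      by (simp only: of_real_0)
    have "isCont h 0"
      using holomorphic_on_imp_continuous_on[OF h] r by (simp add: continuous_on_eq_continuous_at)
    then have lim: "(\<lambda>m. h (k m)) \<longlonglongrightarrow> h 0" using k0 by (rule isCont_tendsto_compose)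
    have ev: "\<forall>\<^sub>F m in sequentially. k m \<in> ball 0 r"
      using topological_tendstoD[OF k0, of "ball 0 r"] r by auto
    have "(\<lambda>m. h (k m)) \<longlonglongrightarrow> 0"
    proof (rule Lim_null_comparison)
      let ?x = "\<lambda>m. \<mu> * real (Suc m)"
      show "\<forall>\<^sub>F m in sequentially. norm (h (k m)) \<le> (D\<^sup>2)\<^sup>2 / \<mu> ^ n * (?x m ^ n / exp (?x m))"
        using ev
      proof eventually_elim
        case (elim m)
        have km: "k m \<noteq> 0" "norm (k m) = inverse (real (Suc m))" "norm (1 / k m) = real (Suc m)"
          by (simp_all add: k_def norm_divide norm_inverse divide_inverse del: of_nat_Suc)
        have "norm (k m) ^ n * norm (h (k m)) = norm (M (1 / k m))"
          using Hh[OF elim] km by (simp add: H_def norm_mult norm_power)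
        also have "\<dots> \<le> (D\<^sup>2)\<^sup>2 * exp (- ?x m)"
        proof -
          have "k m \<in> ?B" using elim r by blast
          from Mle[OF kB[OF this km(1)]] show ?thesis unfolding km(3) .
        qed
        finally show ?case using \<mu> km
          by (simp add: exp_minus field_simps power_mult_distrib del: of_nat_Suc)
      qed
      have "filterlim ?x at_top sequentially"
        using \<mu> by (intro filterlim_tendsto_pos_mult_at_top[OF tendsto_const]
            filterlim_compose[OF filterlim_real_sequentially filterlim_Suc])
      then have "(\<lambda>m. ?x m ^ n / exp (?x m)) \<longlonglongrightarrow> 0"
        by (rule filterlim_compose[OF tendsto_power_div_exp_0])
      then show "(\<lambda>m. (D\<^sup>2)\<^sup>2 / \<mu> ^ n * (?x m ^ n / exp (?x m))) \<longlonglongrightarrow> 0"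
        by (rule tendsto_mult_right_zero)
    qed
    then have "h 0 = 0" using LIMSEQ_unique[OF lim] by simp
    then show False using h0[of 0] r by simp
  qed
  have M0: "M w = 0" if w: "norm w > \<rho>" for w
  proof -
    have w0: "w \<noteq> 0" using w \<rho> by auto
    have "1 / w \<in> ?B" using w w0 \<rho> by (simp add: norm_divide field_simps)
    then have "H (1 / w) = H 0" using Hconst \<rho> by (auto simp: constant_on_def)
    then show ?thesis using w0 by (simp add: H_def)
  qed
  have opS: "open ?S" by (simp add: open_Compl)
  have wS: "w \<in> ?S" using w by simp
  then have neS: "?S \<noteq> {}" by blast
  have cg: "continuous_on V (\<lambda>w. g (c * w))" if "V \<subseteq> ?S" "norm c = 1" for V c
    using holomorphic_on_imp_continuous_on[OF g2[OF that(2)]] that(1) continuous_on_subset by blast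
  \<comment> \<open>A vanishing product of four continuous functions has a factor that vanishes on a
    smaller open set. The identity theorem on the connected exterior extends this to the
    corresponding rotation of \<open>g\<close>, hence to \<open>g\<close>.\<close>
  obtain V where V: "open V" "V \<noteq> {}" "V \<subseteq> ?S" "\<exists>c. norm c = 1 \<and> (\<forall>w\<in>V. g (c * w) = 0)"
  proof -
    obtain V1 where V1: "open V1" "V1 \<noteq> {}" "V1 \<subseteq> ?S"
        "(\<forall>w\<in>V1. g (1 * w) = 0) \<or> (\<forall>w\<in>V1. g (- 1 * w) * (g (\<i> * w) * g (- \<i> * w)) = 0)"
    proof -
      have "g (1 * w) * (g (- 1 * w) * (g (\<i> * w) * g (- \<i> * w))) = 0" if "w \<in> ?S" for w
        using M0[of w] that by (simp add: M_def)
      from mult_eq_0_on_open[OF opS neS cg[OF order_refl norm_one] this] show ?thesis using that by blast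
    qed
    then consider "\<forall>w\<in>V1. g (1 * w) = 0" | "\<forall>w\<in>V1. g (- 1 * w) * (g (\<i> * w) * g (- \<i> * w)) = 0" by blast
    then show ?thesis
    proof cases
      case 1
      then show ?thesis using that[of V1] V1 by (metis norm_one)
    next
      case 2
      obtain V2 where V2: "open V2" "V2 \<noteq> {}" "V2 \<subseteq> V1"
        "(\<forall>w\<in>V2. g (- 1 * w) = 0) \<or> (\<forall>w\<in>V2. g (\<i> * w) * g (- \<i> * w) = 0)"
        using mult_eq_0_on_open[OF V1(1,2) cg[OF V1(3), of "- 1"] bspec[OF 2]] by auto
      then consider "\<forall>w\<in>V2. g (- 1 * w) = 0" | "\<forall>w\<in>V2. g (\<i> * w) * g (- \<i> * w) = 0" by blast
      then show ?thesis
      proof cases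
        case 1
        then show ?thesis using that[of V2] V1 V2 by (metis norm_one norm_minus_cancel order_trans)
      next
        case 2
        have V2S: "V2 \<subseteq> ?S" using V1 V2 by blast
        obtain V3 where V3: "open V3" "V3 \<noteq> {}" "V3 \<subseteq> V2"
          "(\<forall>w\<in>V3. g (\<i> * w) = 0) \<or> (\<forall>w\<in>V3. g (- \<i> * w) = 0)"
          using mult_eq_0_on_open[OF V2(1,2) cg[OF V2S, of \<i>] bspec[OF 2]] by auto
        then show ?thesis using that[of V3] V2S by (metis norm_ii norm_minus_cancel order_trans)
      qed
    qed
  qed
  then obtain c where c: "norm c = 1" "\<And>w. w \<in> V \<Longrightarrow> g (c * w) = 0" by blast
  have c0: "c \<noteq> 0" using c by auto
  have conn: "connected ?S" by (rule connected_complement_bounded_convex) auto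
  have "(\<lambda>w. g (c * w)) (w / c) = 0"
  proof (rule analytic_continuation_open[OF V(1) opS V(2) conn V(3) g2[OF c(1)], of "\<lambda>_. 0"])
    show "w / c \<in> ?S" using w c by (simp add: norm_divide)
  qed (use c in auto)
  then show ?thesis using c0 by simp
qed

subsection \<open>Vanishing of the Wronskian\<close>

context toda_decay
begin

lemma F_rec:
  assumes t: "t \<in> {t0..t1}"
  shows "F t n w = (1 + w\<^sup>2 - of_real (b (int (Suc n)) t) * w) * F t (Suc n) w
     - of_real (c (int (Suc n)) t) * w\<^sup>2 * F t (Suc (Suc n)) w"
  using fast_tail_bound.jost_rec[OF fast_tail[OF t], of n w] by simp

lemma F_holomorphic: "t \<in> {t0..t1} \<Longrightarrow> F t n holomorphic_on UNIV"
  using fast_tail_bound.jost_holomorphic[OF fast_tail] .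

text \<open>Up to a factor this is the Wronskian of the solution that decays to the left and the Jost
  solution from the right, continued to large \<open>w\<close>.\<close>
definition wronskian :: "nat \<Rightarrow> real \<Rightarrow> complex \<Rightarrow> complex" where
  "wronskian n t w = F t n w - of_real (c (int n) t) * ratio (int n) t (1 / w) * F t (Suc n) w"

lemma norm_inverse_le_radius: "norm w \<ge> 8 * N \<Longrightarrow> norm (1 / w) \<le> radius" for w :: complex
  using N1 by (auto simp: norm_divide intro!: divide_left_mono mult_pos_pos)

text \<open>If both solutions moved by the Lax flow, their Wronskian would be constant. Fixing the
  limit of the right solution and a neighbouring value of the left one changes this to a scalar
  linear equation: each normalisation contributes about \<open>- w\<close> to the rate, and the
  correction from the ratio is bounded for large \<open>w\<close>.\<close>

lemma wronskian_deriv: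
  assumes w: "norm w \<ge> 8 * N" and t: "t \<in> {t0..t1}"
  shows "((\<lambda>t. wronskian n t w) has_vector_derivative
    (2 * of_real (c (int n) t) * ratio (int n) t (1 / w) / w - 2 * w) * wronskian n t w) (at t within {t0..t1})"
proof -
  let ?I = "at t within {t0..t1}"
  have w0: "w \<noteq> 0" using w N1 by auto
  define k where "k = 1 / w"
  have wk: "w * k = 1" using w0 by (simp add: k_def)
  have k0: "k \<noteq> 0" and iw: "inverse k = w" using w0 by (auto simp: k_def)
  have kr: "norm k \<le> radius" unfolding k_def by (rule norm_inverse_le_radius[OF w])
  define C where "C = complex_of_real (c (int n) t)"
  define B where "B = complex_of_real (b (int n) t)"
  define B' where "B' = complex_of_real (b (int (Suc n)) t)"
  define C' where "C' = complex_of_real (c (int (Suc n)) t)"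
  define Q where "Q = ratio (int n) t k"
  define x y z where "x = F t n w" and "y = F t (Suc n) w" and "z = F t (Suc (Suc n)) w"
  have x: "x = (1 + w\<^sup>2 - B' * w) * y - C' * w\<^sup>2 * z"
    unfolding x_def y_def z_def B'_def C'_def by (rule F_rec[OF t])
  have dx: "((\<lambda>t. F t n w) has_vector_derivative 2 * w * (C * y - x)) ?I"
    unfolding C_def x_def y_def by (rule jost_deriv[OF t])
  have dy: "((\<lambda>t. F t (Suc n) w) has_vector_derivative 2 * w * (C' * z - y)) ?I"
    unfolding C'_def y_def z_def by (rule jost_deriv[OF t])
  have dc: "((\<lambda>t. complex_of_real (c (int n) t)) has_vector_derivative 2 * C * (B' - B)) ?I"
    using has_vector_derivative_of_real[OF c_deriv[OF t, of "int n"], where 'a = complex]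
    by (simp add: C_def B_def B'_def add.commute)
  have dQ: "((\<lambda>t. ratio (int n) t k) has_vector_derivative 2 / k * (1 - (1 + k\<^sup>2 - B * k) * Q + C * k\<^sup>2 * Q\<^sup>2)) ?I"
    unfolding B_def C_def Q_def by (rule ratio_deriv[OF kr k0 t])
  have "((\<lambda>t. wronskian n t w) has_vector_derivative
     2 * w * (C * y - x) - (C * Q * (2 * w * (C' * z - y))
       + (C * (2 / k * (1 - (1 + k\<^sup>2 - B * k) * Q + C * k\<^sup>2 * Q\<^sup>2)) + 2 * C * (B' - B) * Q) * y)) ?I"
    unfolding wronskian_def k_def[symmetric]
    using has_vector_derivative_diff[OF dx has_vector_derivative_mult[OF has_vector_derivative_mult[OF dc dQ] dy]]
    by (simp add: C_def Q_def y_def)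
  moreover have "2 * w * (C * y - x) - (C * Q * (2 * w * (C' * z - y))
       + (C * (2 / k * (1 - (1 + k\<^sup>2 - B * k) * Q + C * k\<^sup>2 * Q\<^sup>2)) + 2 * C * (B' - B) * Q) * y)
     = (2 * C * Q * k - 2 * w) * (x - C * Q * y)"
  proof -
    \<comment> \<open>The spatial recursion removes the site \<open>Suc (Suc n)\<close>, and
      \<open>w * k = 1\<close> clears the mixed powers; only then are both sides polynomials in the
      same quantities.\<close>
    have "w * (C' * z) = (w * k) * (w * (C' * z))" by (simp add: wk)
    also have "\<dots> = k * ((1 + w\<^sup>2 - B' * w) * y - x)"
      unfolding x by (simp add: power2_eq_square algebra_simps)
    also have "\<dots> = k * y + (w * k) * w * y - (w * k) * B' * y - k * x"
      by (simp add: power2_eq_square algebra_simps)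
    finally have z: "w * (C' * z) = k * y + w * y - B' * y - k * x" by (simp add: wk)
    have "2 / k * (1 - (1 + k\<^sup>2 - B * k) * Q + C * k\<^sup>2 * Q\<^sup>2)
        = 2 * w * (1 - (1 + k\<^sup>2 - B * k) * Q + C * k\<^sup>2 * Q\<^sup>2)"
      by (simp add: divide_inverse iw)
    also have "\<dots> = 2 * w - 2 * w * Q - 2 * (w * k) * k * Q + 2 * (w * k) * B * Q + 2 * C * (w * k) * k * Q\<^sup>2"
      by (simp add: power2_eq_square algebra_simps)
    finally have q: "2 / k * (1 - (1 + k\<^sup>2 - B * k) * Q + C * k\<^sup>2 * Q\<^sup>2)
       = 2 * w - 2 * w * Q - 2 * k * Q + 2 * B * Q + 2 * C * k * Q\<^sup>2"
      by (simp add: wk)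
    have "2 * w * (C' * z - y) = 2 * (w * (C' * z)) - 2 * w * y" by (simp add: algebra_simps)
    then show ?thesis unfolding q \<open>2 * w * (C' * z - y) = _\<close> unfolding z by (simp add: power2_eq_square algebra_simps)
  qed
  ultimately show ?thesis
    by (simp add: C_def Q_def k_def wronskian_def x_def y_def divide_inverse)
qed

text \<open>Multiplication by \<open>e\<close> removes the rate \<open>- 2 * w\<close>. The
  remaining rate has norm at most \<open>1\<close>, and Gronwall, applied to a family with the
  single index of type \<open>unit\<close>, costs a constant independent of
  \<open>w\<close>.\<close>

lemma wronskian_backward:
  assumes w: "norm w \<ge> 8 * N"
  shows "norm (wronskian n t0 w) \<le> 2 * exp (2 * (t1 - t0)) * norm (wronskian n t1 w) * exp (2 * (t1 - t0) * Re w)"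
proof -
  have w0: "w \<noteq> 0" using w N1 by auto
  define e where "e = (\<lambda>t. exp (of_real (t - t0) * (2 * w)))"
  define p where "p = (\<lambda>_::unit. \<lambda>t. e t * wronskian n t w)"
  define l where "l = (\<lambda>t. 2 * of_real (c (int n) t) * ratio (int n) t (1 / w) / w)"
  have l_le: "norm (l t) \<le> 1" if t: "t \<in> {t0..t1}" for t
  proof -
    have "norm (l t) = 2 * \<bar>c (int n) t\<bar> * norm (ratio (int n) t (1 / w)) / norm w"
      by (simp add: l_def norm_mult norm_divide)
    also have "\<dots> \<le> 2 * N * 2 / (8 * N)"
      using N1 w by (intro frac_le mult_mono c_le t ratio_le[OF norm_inverse_le_radius[OF w]]) auto
    also have "\<dots> \<le> 1" using N1 by simp
    finally show ?thesis .
  qed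
  have de: "(e has_vector_derivative 2 * w * e t) (at t within {t0..t1})" for t
  proof -
    have "((\<lambda>z. exp ((z - of_real t0) * (2 * w))) has_field_derivative
        2 * w * exp ((of_real t - of_real t0) * (2 * w))) (at (of_real t))"
      by (auto intro!: derivative_eq_intros)
    from has_vector_derivative_real_field[OF this] show ?thesis by (simp add: e_def)
  qed
  have dp: "(p u has_vector_derivative l t * p u t) (at t within {t0..t1})" if t: "t \<in> {t0..t1}" for u t
  proof -
    have "(p u has_vector_derivative e t * ((l t - 2 * w) * wronskian n t w) + 2 * w * e t * wronskian n t w) (at t within {t0..t1})"
      unfolding p_def l_def by (intro has_vector_derivative_mult de wronskian_deriv w t)
    then show ?thesis by (simp add: p_def algebra_simps)
  qed
  have "continuous_on {t0..t1} (p ())"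
    unfolding continuous_on_eq_continuous_within using dp has_vector_derivative_continuous by blast
  then have "bounded (p () ` {t0..t1})" by (intro compact_imp_bounded compact_continuous_image) auto
  then obtain Y where Y: "\<And>t. t \<in> {t0..t1} \<Longrightarrow> norm (p () t) \<le> Y"
    unfolding bounded_iff by force
  have "norm (p () t0) \<le> 2 * norm (p () t1) * exp (2 * 1 * \<bar>t0 - t1\<bar>)"
  proof (rule gronwall_family[where y' = "\<lambda>u t. l t * p u t" and Y = Y, OF dp])
    fix i :: unit and t x assume t: "t \<in> {t0..t1}" and "\<And>j. norm (p j t) \<le> x"
    then have "norm (p i t) \<le> x" by blast
    with l_le[OF t] show "norm (l t * p i t) \<le> 1 * x"
      unfolding norm_mult by (intro mult_mono) auto
  qed (use t01 Y in auto)
  then have "norm (wronskian n t0 w) \<le> 2 * (norm (e t1) * norm (wronskian n t1 w)) * exp (2 * (t1 - t0))"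
    using t01 by (simp add: p_def e_def norm_mult)
  moreover have "norm (e t1) = exp (2 * (t1 - t0) * Re w)"
    by (simp add: e_def)
  ultimately show ?thesis by (simp add: mult_ac)
qed

end

section \<open>Vanishing Wronskian, Liouville's theorem and descent to the left\<close>

locale toda_minimal_type = toda_decay +
  assumes minimal_type: "\<And>t n \<epsilon>. t \<in> {t0, t1} \<Longrightarrow> \<epsilon> > 0 \<Longrightarrow> \<exists>D. \<forall>w. norm (F t n w) \<le> D * exp (\<epsilon> * norm w)"
begin

lemma wronskian_minimal_type:
  assumes t: "t \<in> {t0, t1}" and \<epsilon>: "\<epsilon> > 0"
  shows "\<exists>D. \<forall>w. norm w \<ge> 8 * N \<longrightarrow> norm (wronskian n t w) \<le> D * exp (\<epsilon> * norm w)"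
proof -
  have tI: "t \<in> {t0..t1}" using t t01 by auto
  obtain D1 D2 where D: "\<And>w. norm (F t n w) \<le> D1 * exp (\<epsilon> * norm w)"
    "\<And>w. norm (F t (Suc n) w) \<le> D2 * exp (\<epsilon> * norm w)"
    using minimal_type[OF t \<epsilon>, of n] minimal_type[OF t \<epsilon>, of "Suc n"] by blast
  have "norm (wronskian n t w) \<le> (D1 + N * 2 * D2) * exp (\<epsilon> * norm w)" if w: "norm w \<ge> 8 * N" for w
  proof -
    have "norm (of_real (c (int n) t) * ratio (int n) t (1 / w) * F t (Suc n) w) \<le> N * 2 * (D2 * exp (\<epsilon> * norm w))"
      unfolding norm_mult norm_of_real
      using N1 by (intro mult_mono c_le ratio_le norm_inverse_le_radius w tI D mult_nonneg_nonneg) auto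
    then show ?thesis
      using norm_triangle_ineq4[of "F t n w" "of_real (c (int n) t) * ratio (int n) t (1 / w) * F t (Suc n) w"] D(1)[of w]
      unfolding wronskian_def by (simp add: algebra_simps)
  qed
  then show ?thesis by blast
qed

lemma wronskian_holomorphic:
  assumes t: "t \<in> {t0..t1}"
  shows "wronskian n t holomorphic_on - cball 0 (8 * N)"
proof -
  have "(\<lambda>w. ratio (int n) t (1 / w)) holomorphic_on - cball 0 (8 * N)"
  proof (rule holomorphic_on_compose_gen[of "\<lambda>w. 1 / w" _ "ratio (int n) t" "ball 0 radius", unfolded o_def])
    show "(\<lambda>w. 1 / w) holomorphic_on - cball 0 (8 * N)" using N1 by (intro holomorphic_intros) auto
    show "ratio (int n) t holomorphic_on ball 0 radius" by (rule ratio_holomorphic[OF t])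
    show "(\<lambda>w::complex. 1 / w) ` (- cball 0 (8 * N)) \<subseteq> ball 0 radius"
    proof (rule image_subsetI)
      fix w :: complex assume "w \<in> - cball 0 (8 * N)"
      then have "8 * N < norm w" by simp
      then have "1 / norm w < radius" using N1 by (intro divide_strict_left_mono mult_pos_pos) auto
      then have "norm (1 / w) < radius" by (simp add: norm_divide)
      then show "1 / w \<in> ball 0 radius" by simp
    qed
  qed
  moreover have "F t m holomorphic_on - cball 0 (8 * N)" for m
    using F_holomorphic[OF t] holomorphic_on_subset by blast
  ultimately show ?thesis
    unfolding wronskian_def[abs_def] by (intro holomorphic_intros)
qed

lemma wronskian_eq_0:
  assumes w: "norm w > 8 * N"
  shows "wronskian n t0 w = 0"
proof -
  let ?T = "t1 - t0"
  have T: "?T > 0" using t01 by simp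
  \<comment> \<open>Type \<open>?T / 4\<close> is small enough: the decay rate below is
    \<open>2 * ?T\<close>, and \<open>4 * (?T / 4) < 2 * ?T\<close>.\<close>
  obtain D0 D1 where D: "\<And>w. norm w \<ge> 8 * N \<Longrightarrow> norm (wronskian n t0 w) \<le> D0 * exp (?T / 4 * norm w)"
    "\<And>w. norm w \<ge> 8 * N \<Longrightarrow> norm (wronskian n t1 w) \<le> D1 * exp (?T / 4 * norm w)"
    using wronskian_minimal_type[of t0 "?T / 4" n] wronskian_minimal_type[of t1 "?T / 4" n] T by auto
  define D where "D = max D0 (2 * exp (2 * ?T) * D1)"
  have t0I: "t0 \<in> {t0..t1}" using t01 by simp
  have N8: "8 * N > 0" using N1 by simp
  show ?thesis
  proof (rule holomorphic_exterior_eq_0[OF wronskian_holomorphic[OF t0I] N8 _ _ _ _ w])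
    fix w :: complex assume w: "norm w > 8 * N"
    have "norm (wronskian n t0 w) \<le> D0 * exp (?T / 4 * norm w)" using D(1)[of w] w by simp
    also have "\<dots> \<le> D * exp (?T / 4 * norm w)" by (intro mult_right_mono) (auto simp: D_def)
    finally show "norm (wronskian n t0 w) \<le> D * exp (?T / 4 * norm w)" .
    have "norm (wronskian n t0 w) \<le> 2 * exp (2 * ?T) * norm (wronskian n t1 w) * exp (2 * ?T * Re w)"
      using wronskian_backward[of w n] w by simp
    also have "\<dots> \<le> 2 * exp (2 * ?T) * (D1 * exp (?T / 4 * norm w)) * exp (2 * ?T * Re w)"
      using D(2)[of w] w by (intro mult_right_mono mult_left_mono) auto
    also have "\<dots> = (2 * exp (2 * ?T) * D1) * exp (?T / 4 * norm w + 2 * ?T * Re w)"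
      by (simp add: exp_add)
    also have "\<dots> \<le> D * exp (?T / 4 * norm w + 2 * ?T * Re w)"
      by (intro mult_right_mono) (auto simp: D_def)
    finally show "norm (wronskian n t0 w) \<le> D * exp (?T / 4 * norm w + 2 * ?T * Re w)" .
  qed (use T in auto)
qed

lemma t0_in: "t0 \<in> {t0..t1}" using t01 by simp

text \<open>A vanishing Wronskian says that \<open>F n\<close> and \<open>F (Suc n)\<close> have the
  quotient prescribed by the left solution. The quotients are analytic at
  \<open>w = \<infinity>\<close>, and iterating moves the remaining factor far to the right, where
  it is close to \<open>1\<close>.\<close>

lemma F_telescope:
  assumes w: "norm w > 8 * N"
  shows "F t0 n w = (\<Prod>i<m. of_real (c (int (n + i)) t0) * ratio (int (n + i)) t0 (1 / w)) * F t0 (n + m) w"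
proof (induction m)
  case (Suc m)
  have "F t0 (n + m) w = of_real (c (int (n + m)) t0) * ratio (int (n + m)) t0 (1 / w) * F t0 (Suc (n + m)) w"
    using wronskian_eq_0[OF w, of "n + m"] by (simp add: wronskian_def)
  then show ?case using Suc by (simp add: mult.assoc)
qed simp

text \<open>By the maximum principle in \<open>k = 1 / w\<close>, the products are bounded by their values on a circle, where
  \<open>F (n + m)\<close> tends to \<open>1\<close> uniformly.\<close>
lemma F_eq_1: "F t0 n w = 1"
proof -
  interpret fast_tail_bound "\<beta> t0" "v t0" tail_sup "tail_sup 1" by (rule fast_tail[OF t0_in])
  \<comment> \<open>Just beyond \<open>8 * N\<close>: the telescoped identity holds on the circle of
    radius \<open>r\<close>, and the closed disc of radius \<open>1 / r\<close> lies where the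
    ratios are holomorphic.\<close>
  define r where "r = 8 * N + 1"
  have r: "r > 8 * N" "r > 0" using N1 by (auto simp: r_def)
  define P where "P = (\<lambda>m k. \<Prod>i<m. of_real (c (int (n + i)) t0) * ratio (int (n + i)) t0 k)"
  have tel: "F t0 n w = P m (1 / w) * F t0 (n + m) w" if "norm w > 8 * N" for w m
    using F_telescope[OF that, of n m] by (simp add: P_def)
  have to1: "(\<lambda>m. F t0 (n + m) w) \<longlonglongrightarrow> 1" and ev: "\<forall>\<^sub>F m in sequentially. \<forall>w. norm w \<le> r \<longrightarrow> norm (F t0 (n + m) w - 1) < 1 / 2" for w
  proof -
    have z: "(\<lambda>m. D * (1 / 2) ^ (n + m) :: real) \<longlonglongrightarrow> 0" for D
      unfolding power_add by (intro tendsto_mult_right_zero LIMSEQ_power_zero) simp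
    obtain D where D: "\<And>m u. norm u \<le> norm w \<Longrightarrow> norm (F t0 m u - 1) \<le> D * (1 / 2) ^ m"
      using jost_tendsto_1[of "norm w"] by blast
    have "(\<lambda>m. F t0 (n + m) w - 1) \<longlonglongrightarrow> 0"
      by (rule Lim_null_comparison[OF _ z[of D]]) (use D in auto)
    then show "(\<lambda>m. F t0 (n + m) w) \<longlonglongrightarrow> 1" by (simp add: LIM_zero_iff)
    obtain D where D: "\<And>m u. norm u \<le> r \<Longrightarrow> norm (F t0 m u - 1) \<le> D * (1 / 2) ^ m"
      using jost_tendsto_1[of r] by blast
    have "\<forall>\<^sub>F m in sequentially. D * (1 / 2) ^ (n + m) < 1 / 2" by (rule order_tendstoD(2)[OF z]) simp
    then show "\<forall>\<^sub>F m in sequentially. \<forall>w. norm w \<le> r \<longrightarrow> norm (F t0 (n + m) w - 1) < 1 / 2"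
      by eventually_elim (use D in \<open>blast intro: le_less_trans\<close>)
  qed
  have "bounded (F t0 n ` cball 0 r)"
    by (intro compact_imp_bounded compact_continuous_image holomorphic_on_imp_continuous_on
        holomorphic_on_subset[OF F_holomorphic[OF t0_in]]) auto
  then obtain B where B': "\<forall>x\<in>F t0 n ` cball 0 r. norm x \<le> B" unfolding bounded_iff by blast
  have B: "norm (F t0 n w) \<le> B" if "norm w \<le> r" for w
    by (rule bspec[OF B']) (use that in simp)
  have B0: "B \<ge> 0" using order_trans[OF norm_ge_zero B[of 0]] r by simp
  have Pc: "continuous_on (cball 0 (1 / r)) (P m)" "P m holomorphic_on ball 0 (1 / r)" for m
  proof -
    have "1 / r < radius" using r N1 by (intro divide_strict_left_mono mult_pos_pos) auto
    then have sub: "cball 0 (1 / r) \<subseteq> ball (0::complex) radius"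
      unfolding cball_subset_ball_iff by (simp only: dist_self add_0 simp_thms)
    have "P m holomorphic_on ball 0 radius"
      unfolding P_def[abs_def] by (intro holomorphic_intros ratio_holomorphic t0_in)
    then show "continuous_on (cball 0 (1 / r)) (P m)" "P m holomorphic_on ball 0 (1 / r)"
      using holomorphic_on_subset[OF _ sub, of "P m"] holomorphic_on_imp_continuous_on
        holomorphic_on_subset[OF _ order_trans[OF ball_subset_cball sub], of "P m"] by blast+
  qed
  have Ple: "\<forall>\<^sub>F m in sequentially. \<forall>k\<in>cball 0 (1 / r). norm (P m k) \<le> 2 * B"
    using ev
  proof eventually_elim
    case (elim m)
    show ?case
    proof
      fix k :: complex assume k: "k \<in> cball 0 (1 / r)"
      show "norm (P m k) \<le> 2 * B"
      proof (rule maximum_modulus_frontier[of "P m" "cball 0 (1 / r)"])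
        show "P m holomorphic_on interior (cball 0 (1 / r))" using Pc by simp
        show "continuous_on (closure (cball 0 (1 / r))) (P m)" using Pc by simp
        fix u :: complex assume "u \<in> frontier (cball 0 (1 / r))"
        then have u: "norm u = 1 / r" by (simp add: frontier_cball)
        define w where "w = 1 / u"
        have w: "norm w = r" "1 / w = u" using u r by (auto simp: w_def norm_divide)
        have "norm (F t0 (n + m) w - 1) < 1 / 2" using elim w by simp
        then have half: "norm (F t0 (n + m) w) \<ge> 1 / 2"
          using norm_triangle_ineq2[of 1 "1 - F t0 (n + m) w"] by (simp add: norm_minus_commute)
        have "norm (P m u) * norm (F t0 (n + m) w) \<le> B"
          using tel[of w m] w r B[of w] by (simp add: norm_mult)
        moreover have "norm (P m u) * (1 / 2) \<le> norm (P m u) * norm (F t0 (n + m) w)"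
          by (intro mult_left_mono half) simp
        ultimately show "norm (P m u) \<le> 2 * B" by simp
      qed (use k in auto)
    qed
  qed
  have "norm (F t0 n w) \<le> 2 * B" for w
  proof (cases "norm w \<le> r")
    case True
    then show ?thesis using B[of w] B0 by simp
  next
    case False
    have k: "1 / w \<in> cball 0 (1 / r)" using False r by (auto simp: norm_divide intro!: divide_left_mono mult_pos_pos)
    \<comment> \<open>Outside the disc the bound on the products and the pointwise limit of
      \<open>F t0 (n + m) w\<close> bound \<open>F t0 n w\<close>; no uniformity in \<open>w\<close>
      is available here.\<close>
    have "(\<lambda>m. 2 * B * norm (F t0 (n + m) w)) \<longlonglongrightarrow> 2 * B * norm (1 :: complex)"
      by (intro tendsto_intros to1)
    then have "norm (F t0 n w) \<le> 2 * B * norm (1 :: complex)"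
    proof (rule tendsto_lowerbound)
      show "\<forall>\<^sub>F m in sequentially. norm (F t0 n w) \<le> 2 * B * norm (F t0 (n + m) w)"
        using Ple
      proof eventually_elim
        case (elim m)
        have "norm (F t0 n w) = norm (P m (1 / w)) * norm (F t0 (n + m) w)"
          using tel[of w m] False r by (simp add: norm_mult)
        also have "\<dots> \<le> 2 * B * norm (F t0 (n + m) w)" using elim k by (intro mult_right_mono) auto
        finally show ?case .
      qed
    qed simp
    then show ?thesis by simp
  qed
  then have "bounded (range (F t0 n))" by (auto simp: bounded_iff)
  then have "F t0 n constant_on UNIV" by (rule Liouville_theorem[OF F_holomorphic[OF t0_in]])
  then have "F t0 n w = F t0 n 0" by (auto simp: constant_on_def)
  then show ?thesis by (simp add: jost_0)
qed

text \<open>The left solution has the free quotient between sites \<open>m\<close> and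
  \<open>m + 1\<close>. As an identity in \<open>k\<close> near \<open>0\<close> it contains
  \<open>c m t0 = 1\<close> in the limit, and through the recursion also the data further left. The
  point \<open>k = 0\<close> is left out because it corresponds to
  \<open>w = \<infinity>\<close>.\<close>

definition flat :: "int \<Rightarrow> bool" where
  "flat m \<longleftrightarrow> (\<forall>k. 0 < norm k \<and> norm k < radius \<longrightarrow> of_real (c m t0) * ratio m t0 k = 1)"

lemma flat_nat: "flat (int n)"
  unfolding flat_def
proof (intro allI impI)
  fix k :: complex assume k: "0 < norm k \<and> norm k < radius"
  have "norm (1 / k) > 8 * N" using k N1 by (auto simp: norm_divide field_simps)
  from wronskian_eq_0[OF this, of n] k show "of_real (c (int n) t0) * ratio (int n) t0 k = 1"
    by (simp add: wronskian_def F_eq_1)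
qed

lemma radius_tendsto:
  fixes f :: "complex \<Rightarrow> complex"
  assumes f: "f \<midarrow>0\<rightarrow> a" and eq: "\<And>k. 0 < norm k \<Longrightarrow> norm k < radius \<Longrightarrow> f k = g k" and g: "g \<midarrow>0\<rightarrow> d"
  shows "a = d"
proof -
  have "\<forall>\<^sub>F k in at 0. k \<in> ball 0 radius \<and> k \<noteq> 0 \<and> k \<in> UNIV"
    using N1 by (intro eventually_at_ball') auto
  then have "\<forall>\<^sub>F k in at 0. f k = g k" by eventually_elim (use eq in auto)
  with f have "g \<midarrow>0\<rightarrow> a" by (rule Lim_transform_eventually)
  then show ?thesis using g LIM_unique by blast
qed

lemma ratio_tendsto_1: "ratio m t0 \<midarrow>0\<rightarrow> 1"
proof -
  have "isCont (ratio m t0) 0"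
    using holomorphic_on_imp_continuous_on[OF ratio_holomorphic(2)[OF t0_in]] N1
    by (simp add: continuous_on_eq_continuous_at)
  then show ?thesis using ratio_0[OF t0_in, of m] by (simp add: isCont_def)
qed

lemma flat_c:
  assumes "flat m" shows "c m t0 = 1"
proof -
  have "complex_of_real (c m t0) * 1 = 1"
    by (rule radius_tendsto[OF tendsto_mult[OF tendsto_const ratio_tendsto_1] _ tendsto_const])
      (use assms in \<open>auto simp: flat_def\<close>)
  then show ?thesis by simp
qed

text \<open>In the recursion, \<open>b m = k (1 - c (m - 1) Q (m - 1))\<close> with a bounded right factor; let \<open>k\<close> tend to \<open>0\<close>.\<close>
lemma flat_descent:
  assumes m: "flat m"
  shows "b m t0 = 0" "flat (m - 1)"
proof -
  have eq: "of_real (b m t0) = k * (1 - of_real (c (m - 1) t0) * ratio (m - 1) t0 k)"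
    if k: "0 < norm k" "norm k < radius" for k
  proof -
    have "ratio m t0 k = 1" using m flat_c[OF m] k by (simp add: flat_def)
    with ratio_rec[OF less_imp_le[OF k(2)] t0_in, of m]
    have "k * (k - of_real (b m t0) - of_real (c (m - 1) t0) * k * ratio (m - 1) t0 k) = 0"
      by (simp add: power2_eq_square algebra_simps)
    then have "k - of_real (b m t0) - of_real (c (m - 1) t0) * k * ratio (m - 1) t0 k = 0" using k by simp
    then show ?thesis by (simp add: algebra_simps)
  qed
  have "complex_of_real (b m t0) = 0 * (1 - of_real (c (m - 1) t0) * 1)"
    by (rule radius_tendsto[OF tendsto_const eq]) (assumption | intro tendsto_intros ratio_tendsto_1)+
  then show b0: "b m t0 = 0" by simp
  show "flat (m - 1)" unfolding flat_def using eq b0 by auto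
qed

theorem trivial_at_t0: "c m t0 = 1 \<and> b m t0 = 0"
proof -
  \<comment> \<open>Flatness is inherited only to the left, so each site is reached from a
    nonnegative one.\<close>
  have "flat (int n - int i)" for n i
  proof (induction i)
    case (Suc i)
    from flat_descent(2)[OF Suc] show ?case by (simp add: algebra_simps)
  qed (simp add: flat_nat)
  moreover have "int (nat \<bar>m\<bar>) - int (nat (\<bar>m\<bar> - m)) = m" by linarith
  ultimately have "flat m" by metis
  then show ?thesis using flat_c flat_descent by blast
qed

end

subsection \<open>Conclusion\<close>

text \<open>Gronwall with initial size \<open>0\<close>; this is uniqueness of the stationary
  solution among bounded ones.\<close>

lemma (in toda_strip) trivial_propagates:
  assumes s: "s \<in> {t0..t1}" and c: "\<And>n. c n s = 1" and b: "\<And>n. b n s = 0" and t: "t \<in> {t0..t1}"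
  shows "c n t = 1 \<and> b n t = 0"
proof -
  define y where "y = (\<lambda>(u, m) t. if u then b m t else c m t - 1)"
  define y' where "y' = (\<lambda>(u, m) t. if u then 2 * (c m t - c (m - 1) t) else 2 * c m t * (b (m + 1) t - b m t))"
  have "norm (y i t) \<le> 2 * 0 * exp (2 * (4 * N) * \<bar>t - s\<bar>)" for i
  proof (rule gronwall_family[where y' = y' and Y = "N + 1"])
    fix p :: "bool \<times> int" and r assume r: "r \<in> {t0..t1}"
    obtain u m where p: "p = (u, m)" by (cases p) auto
    show "(y p has_vector_derivative y' p r) (at r within {t0..t1})"
      unfolding p y_def y'_def has_real_derivative_iff_has_vector_derivative[symmetric]
      using b_deriv[OF r, of m] DERIV_diff[OF c_deriv[OF r, of m] DERIV_const, of 1] by simp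
    show "norm (y p r) \<le> N + 1"
      using b_le[OF r, of m] c_le[OF r, of m] by (auto simp: p y_def)
    fix C assume C: "\<And>j. norm (y j r) \<le> C"
    have b1: "\<bar>b m r\<bar> \<le> C" and c1: "\<bar>c m r - 1\<bar> \<le> C" for m
      using C[of "(True, m)"] C[of "(False, m)"] by (auto simp: y_def)
    have C0: "C \<ge> 0" using order_trans[OF abs_ge_zero b1] .
    show "norm (y' p r) \<le> 4 * N * C"
    proof (cases u)
      case True
      have "\<bar>c m r - c (m - 1) r\<bar> \<le> 2 * C" using c1[of m] c1[of "m - 1"] by linarith
      then have "norm (y' p r) \<le> 4 * 1 * C" using True by (simp add: p y'_def)
      also have "\<dots> \<le> 4 * N * C" using N1 C0 by (intro mult_right_mono mult_left_mono) auto
      finally show ?thesis .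
    next
      case False
      have "norm (y' p r) = 2 * \<bar>c m r\<bar> * \<bar>b (m + 1) r - b m r\<bar>"
        using False by (simp add: p y'_def abs_mult)
      also have "\<dots> \<le> 2 * N * (2 * C)"
        using b1[of m] b1[of "m + 1"] N1 by (intro mult_mono c_le r mult_left_mono) auto
      finally show ?thesis by simp
    qed
  qed (use N1 s t b c in \<open>auto simp: y_def\<close>)
  from this[of "(True, n)"] this[of "(False, n)"] show ?thesis by (simp add: y_def)
qed

lemma toda_solution_strip:
  assumes sol: "toda_solution a b" and pq: "p < q"
  obtains N where "toda_strip (\<lambda>n t. (a n t)\<^sup>2) b p q N"
    "\<And>n t. t \<in> {p..q} \<Longrightarrow> \<bar>1 + a n t\<bar> \<le> 1 + N"
proof -
  have pos: "a n t > 0" for n t using sol by (simp add: toda_solution_def)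
  have d: "(a n has_real_derivative a n t * (b (n + 1) t - b n t)) (at t)"
     "(b n has_real_derivative 2 * ((a n t)\<^sup>2 - (a (n - 1) t)\<^sup>2)) (at t)" for n t
    using sol by (auto simp: toda_solution_def)
  obtain M where M: "M > 0" "\<And>t n. t \<in> {p..q} \<Longrightarrow> a n t \<le> M \<and> \<bar>b n t\<bar> \<le> M"
    by (rule toda_solution_bounded_on_interval[OF sol, where p = p and q = q]) (blast intro: that)
  \<comment> \<open>The square of \<open>M + 1\<close> dominates \<open>M\<close>, the square of
    \<open>M\<close> and \<open>1\<close> at once, as the strip bounds both \<open>a\<^sup>2\<close>
    and \<open>b\<close> by the same constant.\<close>
  define N where "N = (M + 1)\<^sup>2"
  have MN: "M \<le> N" "M\<^sup>2 \<le> N" "1 \<le> N" using M(1) by (auto simp: N_def power2_eq_square algebra_simps)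
  have "toda_strip (\<lambda>n t. (a n t)\<^sup>2) b p q N"
  proof
    fix n t assume t: "t \<in> {p..q}"
    show "((\<lambda>t. (a n t)\<^sup>2) has_real_derivative 2 * (a n t)\<^sup>2 * (b (n + 1) t - b n t)) (at t within {p..q})"
      using has_field_derivative_at_within[OF DERIV_power[OF d(1)[of n t], of 2]]
      by (simp add: power2_eq_square algebra_simps)
    show "(b n has_real_derivative 2 * ((a n t)\<^sup>2 - (a (n - 1) t)\<^sup>2)) (at t within {p..q})"
      by (rule has_field_derivative_at_within[OF d(2)])
    have "(a n t)\<^sup>2 \<le> M\<^sup>2" using M(2)[OF t, of n] pos[of n t] by (intro power_mono) auto
    then show "\<bar>(a n t)\<^sup>2\<bar> \<le> N" using MN by simp
    show "\<bar>b n t\<bar> \<le> N" using M(2)[OF t, of n] MN by linarith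
  qed (use pq MN in auto)
  moreover have "\<bar>1 + a n t\<bar> \<le> 1 + N" if "t \<in> {p..q}" for n t
    using M(2)[OF that, of n] pos[of n t] MN by simp
  ultimately show ?thesis using that by blast
qed

lemma toda_trivial_at_all_times:
  assumes sol: "toda_solution a b" and a: "\<And>n. a n s = 1" and b: "\<And>n. b n s = 0"
  shows "a n t = 1 \<and> b n t = 0"
proof -
  \<comment> \<open>Uniform bounds hold on every compact time interval, so the times are not
    confined to the original strip. The margin \<open>1\<close> keeps the interval nondegenerate
    when \<open>s = t\<close>.\<close>
  define p q where "p = min s t - 1" and "q = max s t + 1"
  obtain N where "toda_strip (\<lambda>n t. (a n t)\<^sup>2) b p q N"
    by (rule toda_solution_strip[OF sol, of p q]) (auto simp: p_def q_def)
  moreover have "s \<in> {p..q}" "t \<in> {p..q}" unfolding p_def q_def atLeastAtMost_iff by linarith+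
  ultimately have "(a n t)\<^sup>2 = 1 \<and> b n t = 0"
    using toda_strip.trivial_propagates[of "\<lambda>n t. (a n t)\<^sup>2" b p q N s t n] a b by simp
  moreover have "a n t > 0" using sol by (simp add: toda_solution_def)
  ultimately show ?thesis by (simp add: power2_eq_1_iff)
qed

text \<open>The denominator is at least \<open>n ^ n\<close>, hence at least \<open>fact n\<close>,
  and a single term of the exponential series is at most its sum.\<close>

lemma powr_superexponential:
  assumes "\<delta> > 0" "n \<ge> 1" "R \<ge> 0"
  shows "R ^ n / real n powr ((1 + \<delta>) * 2 * real n) \<le> exp R"
proof -
  have "R ^ n / real n powr ((1 + \<delta>) * 2 * real n) \<le> R ^ n / fact n"
  proof (intro divide_left_mono)
    have "fact n \<le> real n ^ n" using fact_le_power[of n, where ?'a = real] by simp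
    also have "\<dots> = real n powr real n" using assms by (simp add: powr_realpow)
    also have "\<dots> \<le> real n powr ((1 + \<delta>) * 2 * real n)"
    proof (rule powr_mono)
      have "1 * real n \<le> ((1 + \<delta>) * 2) * real n" using assms by (intro mult_right_mono) auto
      then show "real n \<le> (1 + \<delta>) * 2 * real n" by simp
    qed (use assms in auto)
    finally show "fact n \<le> real n powr ((1 + \<delta>) * 2 * real n)" .
    show "0 < real n powr ((1 + \<delta>) * 2 * real n) * fact n" using assms by simp
  qed (use assms in auto)
  also have "\<dots> \<le> (\<Sum>k. R ^ k / fact k)"
  proof -
    have s: "(\<lambda>k. R ^ k / fact k) sums exp R"
      using exp_converges[of R] by (simp add: divide_inverse mult.commute)
    have "sum (\<lambda>k. R ^ k / fact k) {n} \<le> (\<Sum>k. R ^ k / fact k)"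
      by (rule sum_le_suminf[OF sums_summable[OF s]]) (use assms in auto)
    then show ?thesis by simp
  qed
  also have "\<dots> = exp R"
    using sums_unique[OF exp_converges[of R]] by (simp add: divide_inverse mult.commute)
  finally show ?thesis .
qed

text \<open>Two tail bounds for the same coefficients are at work. On the whole strip decay beyond
  every exponential rate is known, which gives the time evolution of the Jost function; at
  \<open>s0\<close> and \<open>s1\<close> the explicit bound holds, which gives minimal
  type.\<close>

lemma normalized_toda_trivial:
  fixes a b :: "int \<Rightarrow> real \<Rightarrow> real"
  assumes sol: "toda_solution a b" and st: "s0 < s1" and \<delta>: "\<delta> > 0"
    and sm: "\<And>n t. n \<ge> 1 \<Longrightarrow> t \<in> {s0, s1} \<Longrightarrow> summable (\<lambda>i. \<bar>a (int (n + i)) t - 1\<bar> + \<bar>b (int (n + i)) t\<bar>)"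
    and le: "\<And>n t. n \<ge> 1 \<Longrightarrow> t \<in> {s0, s1} \<Longrightarrow>
      (\<Sum>i. \<bar>a (int (n + i)) t - 1\<bar> + \<bar>b (int (n + i)) t\<bar>) \<le> C / real n powr ((1 + \<delta>) * 2 * real n)"
  shows "a n t = 1 \<and> b n t = 0"
proof -
  obtain N where strip: "toda_strip (\<lambda>n t. (a n t)\<^sup>2) b s0 s1 N"
    and aN: "\<And>n t. t \<in> {s0..s1} \<Longrightarrow> \<bar>1 + a n t\<bar> \<le> 1 + N"
    using toda_solution_strip[OF sol st] by blast
  interpret toda_strip "\<lambda>n t. (a n t)\<^sup>2" b s0 s1 N by (rule strip)
  define e where "e = (\<lambda>t n. \<bar>a (int n) t - 1\<bar> + \<bar>b (int n) t\<bar>)"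
  define p where "p = (\<lambda>n::nat. real n powr ((1 + \<delta>) * 2 * real n))"
  have p0: "p n > 0" if "n \<ge> 1" for n using that by (simp add: p_def)
  have e0: "e t n \<ge> 0" for t n by (simp add: e_def)
  have sme: "summable (\<lambda>i. e t (n + i))" and lee: "(\<Sum>i. e t (n + i)) \<le> C / p n"
    if "n \<ge> 1" "t \<in> {s0, s1}" for n t
    using sm[OF that] le[OF that] by (simp_all add: e_def p_def)
  have e_le: "e t n \<le> C / p n" if "n \<ge> 1" "t \<in> {s0, s1}" for n t
  proof -
    have "sum (\<lambda>i. e t (n + i)) {0} \<le> (\<Sum>i. e t (n + i))"
      by (rule sum_le_suminf[OF sme[OF that]]) (use e0 in auto)
    then show ?thesis using lee[OF that] by simp
  qed
  have C0: "C \<ge> 0"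
    using order_trans[OF e0 e_le[of 1 s0]] by (simp add: p_def)
  have v_le: "\<bar>1 - (a (int n) t)\<^sup>2\<bar> \<le> (1 + N) * \<bar>a (int n) t - 1\<bar>" if "t \<in> {s0..s1}" for n t
  proof -
    have "1 - (a (int n) t)\<^sup>2 = (1 + a (int n) t) * (1 - a (int n) t)"
      by (simp add: power2_eq_square algebra_simps)
    then have "\<bar>1 - (a (int n) t)\<^sup>2\<bar> = \<bar>1 + a (int n) t\<bar> * \<bar>a (int n) t - 1\<bar>"
      by (simp add: abs_mult abs_minus_commute)
    then show ?thesis using aN[OF that, of "int n"] by (simp add: mult_right_mono)
  qed
  have bv_le: "\<bar>b (int n) t\<bar> + \<bar>1 - (a (int n) t)\<^sup>2\<bar> \<le> (1 + N) * e t n" if "t \<in> {s0..s1}" for n t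
  proof -
    have "1 * \<bar>b (int n) t\<bar> \<le> (1 + N) * \<bar>b (int n) t\<bar>" using N1 by (intro mult_right_mono) auto
    then show ?thesis using v_le[OF that, of n] by (simp add: e_def algebra_simps)
  qed
  have decay0: "\<exists>A. \<forall>n::nat. \<bar>b n s0\<bar> * R ^ n \<le> A \<and> \<bar>1 - (a n s0)\<^sup>2\<bar> * R ^ n \<le> A" if R: "R \<ge> 1" for R
  proof -
    \<comment> \<open>The assumed bound starts at site \<open>1\<close>, so site \<open>0\<close> is
      included by hand; \<open>1 + N\<close> converts \<open>\<bar>a - 1\<bar>\<close> into a bound
      for \<open>\<bar>1 - a\<^sup>2\<bar>\<close>.\<close>
    define A where "A = (1 + N) * max (e s0 0) (C * exp R)"
    have "(\<bar>b n s0\<bar> + \<bar>1 - (a n s0)\<^sup>2\<bar>) * R ^ n \<le> A" for n :: nat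
    proof -
      have "e s0 n * R ^ n \<le> max (e s0 0) (C * exp R)"
      proof (cases "n = 0")
        case False
        then have n: "n \<ge> 1" by simp
        have "e s0 n * R ^ n \<le> C / p n * R ^ n" using R e_le[OF n, of s0] by (intro mult_right_mono) auto
        also have "\<dots> = C * (R ^ n / p n)" by simp
        also have "\<dots> \<le> C * exp R"
          unfolding p_def using R by (intro mult_left_mono powr_superexponential \<delta> n C0) auto
        finally show ?thesis by simp
      qed simp
      then have "(1 + N) * (e s0 n * R ^ n) \<le> A" unfolding A_def using N1 by (intro mult_left_mono) auto
      moreover have "(\<bar>b n s0\<bar> + \<bar>1 - (a n s0)\<^sup>2\<bar>) * R ^ n \<le> (1 + N) * e s0 n * R ^ n"
        using bv_le[of s0 n] st R by (intro mult_right_mono) auto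
      ultimately show ?thesis by (simp add: mult.assoc)
    qed
    moreover have "\<bar>b n s0\<bar> * R ^ n \<le> (\<bar>b n s0\<bar> + \<bar>1 - (a n s0)\<^sup>2\<bar>) * R ^ n"
      "\<bar>1 - (a n s0)\<^sup>2\<bar> * R ^ n \<le> (\<bar>b n s0\<bar> + \<bar>1 - (a n s0)\<^sup>2\<bar>) * R ^ n" for n :: nat
      using R by (intro mult_right_mono; simp)+
    ultimately show ?thesis by (meson order_trans)
  qed
  interpret toda_decay "\<lambda>n t. (a n t)\<^sup>2" b s0 s1 N
  proof
    fix R :: real assume R: "R \<ge> 1"
    from decay0[OF R] obtain A where "\<And>n::nat. \<bar>b n s0\<bar> * R ^ n \<le> A \<and> \<bar>1 - (a n s0)\<^sup>2\<bar> * R ^ n \<le> A" by blast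
    from decay_propagates[OF R this]
    show "\<exists>D. \<forall>t\<in>{s0..s1}. \<forall>n::nat. \<bar>b (int n) t\<bar> * R ^ n \<le> D \<and> \<bar>1 - (a (int n) t)\<^sup>2\<bar> * R ^ n \<le> D" .
  qed
  define K where "K = (1 + N) * C"
  have K: "K \<ge> 0" using C0 N1 by (simp add: K_def)
  have tb: "tail_bound (\<lambda>n. b (int n) t) (\<lambda>n. 1 - (a (int n) t)\<^sup>2) (\<lambda>n. K / p n) K" if t: "t \<in> {s0, s1}" for t
  proof -
    have tI: "t \<in> {s0..s1}" using t st by auto
    define g where "g = (\<lambda>n. \<bar>b (int n) t\<bar> + \<bar>1 - (a (int n) t)\<^sup>2\<bar>)"
    have g: "g n \<le> (1 + N) * e t n" "0 \<le> g n" for n using bv_le[OF tI, of n] by (simp_all add: g_def)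
    have smg: "summable (\<lambda>i. g (n + i))" if n: "n \<ge> 1" for n
      by (rule summable_comparison_test'[OF summable_mult[OF sme[OF n t], of "1 + N"]]) (use g in simp)
    have "summable (\<lambda>i. g (Suc i))" using smg[of 1] by simp
    then have sm0: "summable g" by (simp only: summable_Suc_iff)
    have tl: "(\<Sum>i. g (n + i)) \<le> K / p n" if n: "n \<ge> 1" for n
    proof -
      have "(\<Sum>i. g (n + i)) \<le> (\<Sum>i. (1 + N) * e t (n + i))"
        by (intro suminf_le g smg n summable_mult sme t)
      also have "\<dots> = (1 + N) * (\<Sum>i. e t (n + i))" by (rule suminf_mult[OF sme[OF n t]])
      also have "\<dots> \<le> (1 + N) * (C / p n)" using N1 by (intro mult_left_mono lee n t) auto
      finally show ?thesis by (simp add: K_def)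
    qed
    have an: "K / p n \<le> K / p m" if m: "1 \<le> m" "m \<le> n" for m n
    proof (intro divide_left_mono K mult_pos_pos p0)
      have "p m \<le> real n powr ((1 + \<delta>) * 2 * real m)"
        unfolding p_def using m \<delta> by (intro powr_mono2) auto
      also have "\<dots> \<le> p n"
        unfolding p_def using m \<delta> by (intro powr_mono mult_left_mono) auto
      finally show "p m \<le> p n" .
    qed (use m in auto)
    show ?thesis
      by (rule tail_bound.intro) (use sm0 tl an in \<open>simp_all add: g_def p_def\<close>)
  qed
  interpret toda_minimal_type "\<lambda>n t. (a n t)\<^sup>2" b s0 s1 N
  proof
    fix t :: real and n :: nat and \<epsilon> :: real
    assume t: "t \<in> {s0, s1}" and \<epsilon>: "\<epsilon> > 0"
    show "\<exists>D. \<forall>w. norm (F t n w) \<le> D * exp (\<epsilon> * norm w)"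
      by (rule tail_bound.jost_minimal_type[OF tb[OF t] _ K \<delta> \<epsilon>]) (simp add: p_def)
  qed
  have "a n s0 = 1" "b n s0 = 0" for n
  proof -
    have "a n s0 > 0" using sol by (simp add: toda_solution_def)
    then show "a n s0 = 1" using trivial_at_t0[of n] by (simp add: power2_eq_1_iff)
    show "b n s0 = 0" using trivial_at_t0[of n] by simp
  qed
  then show ?thesis by (rule toda_trivial_at_all_times[OF sol])
qed

lemma summable_on_atLeast_int_sums:
  fixes f :: "int \<Rightarrow> real"
  assumes "f summable_on {int n..}"
  shows "(\<lambda>i. f (int (n + i))) sums (\<Sum>\<^sub>\<infinity>m\<in>{int n..}. f m)"
proof -
  have bij: "bij_betw (\<lambda>i. int (n + i)) UNIV {int n..}"
    by (rule bij_betwI[where g = "\<lambda>m. nat (m - int n)"]) auto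
  have "(f has_sum (\<Sum>\<^sub>\<infinity>m\<in>{int n..}. f m)) {int n..}" using assms by (rule has_sum_infsum)
  then have "((\<lambda>i. f (int (n + i))) has_sum (\<Sum>\<^sub>\<infinity>m\<in>{int n..}. f m)) UNIV"
    by (simp only: has_sum_reindex_bij_betw[OF bij])
  then show ?thesis by (rule has_sum_imp_sums)
qed

theorem theorem1p1:
  fixes a b :: "int \<Rightarrow> real \<Rightarrow> real" and a0 b0 t0 t1 \<delta> C :: real
  assumes "a0 > 0"
    and "toda_solution a b"
    and "\<exists>t. (\<lambda>n. \<bar>real_of_int n\<bar> * (\<bar>a n t - a0\<bar> + \<bar>b n t - b0\<bar>)) summable_on UNIV"
    and "t0 < t1"
    and "\<delta> > 0"
    and "\<And>M t. M > 0 \<Longrightarrow> t \<in> {t0, t1} \<Longrightarrow>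
           (\<lambda>n. \<bar>a n t - a0\<bar> + \<bar>b n t - b0\<bar>) summable_on {M..} \<and>
           (\<Sum>\<^sub>\<infinity>n\<in>{M..}. \<bar>a n t - a0\<bar> + \<bar>b n t - b0\<bar>)
             \<le> C * (1 / real_of_int M powr ((1 + \<delta>) * 2 * real_of_int M))"
  shows "\<forall>n t. a n t = a0 \<and> b n t = b0"
proof (intro allI)
  fix n t
  \<comment> \<open>Scaling by \<open>1 / a0\<close> also rescales time: the new solution at
    \<open>a0 * t\<close> corresponds to the old one at \<open>t\<close>.\<close>
  define r where "r = 1 / a0"
  have r: "r > 0" "r * a0 = 1" using assms(1) by (auto simp: r_def)
  define A where "A = (\<lambda>n t. r * a n (r * t))"
  define B where "B = (\<lambda>n t. r * (b n (r * t) - b0))"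
  have sol: "toda_solution A B"
    unfolding A_def B_def by (rule toda_solution_rescale[OF assms(2) r(1)])
  have tail: "(\<lambda>i. \<bar>A (int (n + i)) t - 1\<bar> + \<bar>B (int (n + i)) t\<bar>) sums
      (r * (\<Sum>\<^sub>\<infinity>m\<in>{int n..}. \<bar>a m (r * t) - a0\<bar> + \<bar>b m (r * t) - b0\<bar>))"
    "r * (\<Sum>\<^sub>\<infinity>m\<in>{int n..}. \<bar>a m (r * t) - a0\<bar> + \<bar>b m (r * t) - b0\<bar>)
      \<le> (r * C) / real n powr ((1 + \<delta>) * 2 * real n)"
    if n: "n \<ge> 1" and t: "t \<in> {a0 * t0, a0 * t1}" for n t
  proof -
    have rt: "r * t \<in> {t0, t1}" using t assms(1) by (auto simp: r_def)
    have n0: "int n > 0" using n by simp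
    note h = assms(6)[OF n0 rt]
    have "\<bar>A m t - 1\<bar> + \<bar>B m t\<bar> = r * (\<bar>a m (r * t) - a0\<bar> + \<bar>b m (r * t) - b0\<bar>)" for m
    proof -
      have "A m t - 1 = r * (a m (r * t) - a0)" using r(2) by (simp add: A_def algebra_simps)
      then have "\<bar>A m t - 1\<bar> = r * \<bar>a m (r * t) - a0\<bar>" using r(1) by (simp add: abs_mult)
      moreover have "\<bar>B m t\<bar> = r * \<bar>b m (r * t) - b0\<bar>" using r(1) by (simp add: B_def abs_mult)
      ultimately show ?thesis by (simp add: distrib_left)
    qed
    then show "(\<lambda>i. \<bar>A (int (n + i)) t - 1\<bar> + \<bar>B (int (n + i)) t\<bar>) sums
      (r * (\<Sum>\<^sub>\<infinity>m\<in>{int n..}. \<bar>a m (r * t) - a0\<bar> + \<bar>b m (r * t) - b0\<bar>))"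
      using sums_mult[OF summable_on_atLeast_int_sums[OF conjunct1[OF h]], of r] by simp
    show "r * (\<Sum>\<^sub>\<infinity>m\<in>{int n..}. \<bar>a m (r * t) - a0\<bar> + \<bar>b m (r * t) - b0\<bar>)
      \<le> (r * C) / real n powr ((1 + \<delta>) * 2 * real n)"
      using mult_left_mono[OF conjunct2[OF h], of r] r(1) by simp
  qed
  have "a0 * t0 < a0 * t1" using assms(1,4) by simp
  from normalized_toda_trivial[OF sol this assms(5), of "r * C" n "a0 * t"]
  have "A n (a0 * t) = 1 \<and> B n (a0 * t) = 0"
    using tail sums_summable sums_unique by (metis (no_types, lifting))
  then show "a n t = a0 \<and> b n t = b0"
    using assms(1) by (auto simp: A_def B_def r_def)
qed

end
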